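(* Let $F$ be a field, let $n\geq 1$, and let $\Gamma\leq \operatorname{GL}_n(F)$ be a finitely generated infinite subgroup. Then $$\tau_{\mathrm u}(\Gamma)=0.$$
   Context: For a finitely generated group $\Gamma$ and a finite generating set $S$ of $\Gamma$, let $$\tau(\Gamma,S)=\inf_{\pi}\ \inf_{\substack{\xi\in\mathcal H\\ \|\xi\|=1}}\ \max_{s\in S}\|\pi(s)\xi-\xi\|,$$ where the first infimum is over all unitary representations $\pi:\Gamma\to\mathcal U(\mathcal H)$ on Hilbert spaces $\mathcal H$ such that $\pi$ has finite image and $\mathcal H^\Gamma=\{0\}$ (no nonzero $\Gamma$-invariant vectors). Set $$\tau_{\mathrm u}(\Gamma)=\inf_{\substack{S\subseteq\Gamma\text{ finite}\\ \langle S\rangle=\Gamma}}\tau(\Gamma,S),$$ the infimum over all finite generating sets $S$ of $\Gamma$. *)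

theory Defs
  imports
    "HOL-Library.Extended_Real"
    "HOL-Library.Infinite_Typeclass"
    "HOL-Algebra.Bij"
    "HOL-Algebra.Generated_Groups"
    "Jordan_Normal_Form.VS_Connect"
begin

text \<open>
  Hilbert spaces are carrier-based, over the field \<open>class_ring :: complex ring\<close>, because
  the infimum below ranges over all of them. The inner product is linear in its first argument.
\<close>

record 'h inner_space = "(complex, 'h) module" +
  ip :: "'h \<Rightarrow> 'h \<Rightarrow> complex"

definition hnorm :: "('h, 'm) inner_space_scheme \<Rightarrow> 'h \<Rightarrow> real" where
  "hnorm H x = sqrt (Re (ip H x x))"

locale complex_inner_space = vectorspace "class_ring :: complex ring" H
  for H :: "('h, 'm) inner_space_scheme" (structure) +
  assumes ip_add: "x \<in> carrier H \<Longrightarrow> y \<in> carrier H \<Longrightarrow> z \<in> carrier H \<Longrightarrow>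
      ip H (x \<oplus> y) z = ip H x z + ip H y z"
    and ip_smult: "x \<in> carrier H \<Longrightarrow> y \<in> carrier H \<Longrightarrow> ip H (c \<odot>\<^bsub>H\<^esub> x) y = c * ip H x y"
    and ip_cnj: "x \<in> carrier H \<Longrightarrow> y \<in> carrier H \<Longrightarrow> ip H y x = cnj (ip H x y)"
    and ip_pos: "x \<in> carrier H \<Longrightarrow> x \<noteq> \<zero> \<Longrightarrow> 0 < Re (ip H x x)"

locale complex_hilbert_space = complex_inner_space H
  for H :: "('h, 'm) inner_space_scheme" (structure) +
  assumes complete: "range X \<subseteq> carrier H \<Longrightarrow>
      (\<And>e. 0 < e \<Longrightarrow> \<exists>N. \<forall>m\<ge>N. \<forall>n\<ge>N. hnorm H (X m \<ominus> X n) < e) \<Longrightarrow>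
      \<exists>x\<in>carrier H. (\<lambda>n. hnorm H (X n \<ominus> x)) \<longlonglongrightarrow> 0"

definition unitary_group :: "('h, 'm) inner_space_scheme \<Rightarrow> ('h \<Rightarrow> 'h) monoid" where
  "unitary_group H = BijGroup (carrier H)
     \<lparr>carrier := {U \<in> Bij (carrier H). U \<in> module_hom class_ring H H \<and>
        (\<forall>x\<in>carrier H. \<forall>y\<in>carrier H. ip H (U x) (U y) = ip H x y)}\<rparr>"

definition invariant_vectors ::
  "('g, 'b) monoid_scheme \<Rightarrow> ('h, 'm) inner_space_scheme \<Rightarrow> ('g \<Rightarrow> 'h \<Rightarrow> 'h) \<Rightarrow> 'h set" where
  "invariant_vectors G H \<pi> = {v \<in> carrier H. \<forall>g\<in>carrier G. \<pi> g v = v}"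

definition finite_image_reps ::
  "'h itself \<Rightarrow> ('g, 'b) monoid_scheme \<Rightarrow> ('h inner_space \<times> ('g \<Rightarrow> 'h \<Rightarrow> 'h)) set" where
  "finite_image_reps _ G = {(H, \<pi>). complex_hilbert_space H \<and> \<pi> \<in> hom G (unitary_group H) \<and>
     finite (\<pi> ` carrier G) \<and> invariant_vectors G H \<pi> = {\<zero>\<^bsub>H\<^esub>}}"

text \<open>
  HOL cannot quantify over all Hilbert spaces at once, so the constants are relative to a
  universe: the type \<open>'h\<close>, on whose subsets the Hilbert spaces live. Every Hilbert space is
  isometrically isomorphic to an \<open>\<ell>\<^sup>2(I)\<close>, hence to one living on a type
  \<open>'i \<Rightarrow> complex\<close>. The values lie in \<^typ>\<open>ereal\<close> so that the infimum of the empty set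
  is \<open>\<infinity>\<close>.
\<close>

definition tau :: "'h itself \<Rightarrow> ('g, 'b) monoid_scheme \<Rightarrow> 'g set \<Rightarrow> ereal" where
  "tau U G S = (INF (H, \<pi>) \<in> finite_image_reps U G.
     INF \<xi> \<in> {\<xi> \<in> carrier H. hnorm H \<xi> = 1}.
       Max ((\<lambda>s. ereal (hnorm H (\<pi> s \<xi> \<ominus>\<^bsub>H\<^esub> \<xi>))) ` S))"

definition finite_generating_sets :: "('g, 'b) monoid_scheme \<Rightarrow> 'g set set" where
  "finite_generating_sets G = {S. finite S \<and> S \<subseteq> carrier G \<and> generate G S = carrier G}"

definition tau_u :: "'h itself \<Rightarrow> ('g, 'b) monoid_scheme \<Rightarrow> ereal" where
  "tau_u U G = (INF S \<in> finite_generating_sets G. tau U G S)"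

definition GL :: "nat \<Rightarrow> 'a::field mat monoid" where
  "GL n = units_of (ring_mat TYPE('a) n ())"

lemma group_GL: "group (GL n)"
  unfolding GL_def by (intro monoid.units_group ring.is_monoid ring_mat)

lemma carrier_GL: "carrier (GL n) = {A :: 'a::field mat. A \<in> carrier_mat n n \<and> det A \<noteq> 0}"
proof -
  have "det A \<noteq> 0" if "A \<in> Units (ring_mat TYPE('a) n ())" for A
    using unit_imp_det_non_zero[OF that] .
  moreover have "A \<in> Units (ring_mat TYPE('a) n ())" if "A \<in> carrier_mat n n" "det A \<noteq> 0" for A
    using det_non_zero_imp_unit[OF that] .
  moreover have "Units (ring_mat TYPE('a) n ()) \<subseteq> carrier_mat n n"
    by (auto simp: Units_def ring_mat_simps)
  ultimately show ?thesis
    unfolding GL_def units_of_carrier by blast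
qed

end

theory Submission
  imports Defs "HOL-Algebra.Algebraic_Closure_Type" "HOL-Algebra.Sylow" "HOL-Algebra.Group_Action"
    "HOL-Library.Function_Algebras"
begin

text \<open>
  Suppose that every finite-index normal subgroup \<open>N\<close> of \<open>\<Gamma>\<close> has a proper supplement of finite index.
  Then there are, for every \<open>k\<close>, proper finite-index subgroups \<open>L\<^sub>1, \<dots>, L\<^sub>k\<close> such that \<open>\<Gamma>\<close> is generated
  by elements each of which lies in all the \<open>L\<^sub>i\<close> but one. In the direct sum of the spaces
  \<open>\<ell>\<^sup>2\<^sub>0(L\<^sub>i \ \<Gamma>)\<close> such a generator moves only one of the \<open>k\<close> orthogonal components of the projection
  of \<open>\<Sum>\<^sub>i \<delta>\<^bsub>L\<^sub>i\<^esub>\<close>, so the displacement of the unit vector is \<open>O(k\<^sup>-\<^sup>1\<^sup>/\<^sup>2)\<close>.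

  Suppose that some \<open>N\<close> has no proper supplement. By a Frattini argument the image of \<open>N\<close> in every
  finite quotient of \<open>\<Gamma>\<close> is nilpotent. Elements of the ring generated by the matrix entries are
  separated by valuation rings with finite residues on that ring, and a group acting on a finite-dimensional
  space over the residue field through a finite nilpotent group is solvable, of derived length
  bounded in terms of \<open>n\<close> only (the eigenvalues, being roots of unity, lift to the valuation ring,
  so lattices can be used instead of the residue field). Hence \<open>N\<close> is solvable, \<open>\<Gamma>\<close> has an infinite
  virtually abelian quotient, and such a quotient supplies a proper supplement after all.
\<close>

hide_const (open) up_ring.coeff up_ring.monom Polynomials.degree Polynomials.lead_coeff
  Module.smult Coset.order Divisibility.prime

subsection \<open>Places of a field\<close>

text \<open>The freedom to vary the generating set is essential in the first case: the elements of a
  fixed set may move many blocks at once, whereas a set adapted to \<open>k\<close> independent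
  subgroups moves one block per generator. In the second case \<open>N\<close> is mapped into the
  Frattini subgroup of every finite quotient. The nilpotency class of its image there depends on the
  quotient, so the bound \<open>2 * n\<close> on the derived length must not depend on the class:
  the place is chosen after the element that is to be shown trivial, and one and the same term of
  the derived series of \<open>N\<close> has to be killed at all places. An algebraically closed
  field supplies all roots of \<open>X^e - 1\<close>, and the eigenvector argument survives when
  \<open>e\<close> is divisible by the residue characteristic, where operators of order
  \<open>e\<close> need not be diagonalizable. Dimensions are counted by pivots of modules between
  \<open>M^n\<close> and \<open>A^n\<close>, so no quotient space or residue field is ever
  formed.\<close>

definition subring_set :: "'a::comm_ring_1 set \<Rightarrow> bool" where
  "subring_set R \<longleftrightarrow> 1 \<in> R \<and> (\<forall>x\<in>R. \<forall>y\<in>R. x - y \<in> R \<and> x * y \<in> R)"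

definition ideal_in :: "'a::comm_ring_1 set \<Rightarrow> 'a set \<Rightarrow> bool" where
  "ideal_in R I \<longleftrightarrow> I \<subseteq> R \<and> 0 \<in> I \<and> (\<forall>x\<in>I. \<forall>y\<in>I. x + y \<in> I) \<and> (\<forall>r\<in>R. \<forall>x\<in>I. r * x \<in> I)"

text \<open>A valuation ring of a field together with its maximal ideal.\<close>

definition place :: "'a::field set \<Rightarrow> 'a set \<Rightarrow> bool" where
  "place A M \<longleftrightarrow> subring_set A \<and> ideal_in A M \<and> 1 \<notin> M \<and> (\<forall>x. x \<in> A \<or> inverse x \<in> M)"

text \<open>The coefficients range over a mere set: \<open>S\<close> is a subring in some uses and
  the ideal \<open>M\<close>, which lacks 1, in others.\<close>

definition polys_over :: "'a::comm_ring_1 set \<Rightarrow> 'a poly set" where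
  "polys_over S = {p. \<forall>i. coeff p i \<in> S}"

lemma subring_setD:
  assumes "subring_set R"
  shows "1 \<in> R" "0 \<in> R" "x \<in> R \<Longrightarrow> y \<in> R \<Longrightarrow> x - y \<in> R" "x \<in> R \<Longrightarrow> y \<in> R \<Longrightarrow> x * y \<in> R"
    "x \<in> R \<Longrightarrow> - x \<in> R" "x \<in> R \<Longrightarrow> y \<in> R \<Longrightarrow> x + y \<in> R"
proof -
  have R: "1 \<in> R" "\<And>x y. x \<in> R \<Longrightarrow> y \<in> R \<Longrightarrow> x - y \<in> R" "\<And>x y. x \<in> R \<Longrightarrow> y \<in> R \<Longrightarrow> x * y \<in> R"
    using assms by (auto simp: subring_set_def)
  have "1 - 1 \<in> R" by (intro R)
  then have Z: "0 \<in> R" by simp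
  have N: "- x \<in> R" if "x \<in> R" for x
    using R(2)[OF Z that] by simp
  have "x + y \<in> R" if "x \<in> R" "y \<in> R" for x y
    using R(2)[OF that(1) N[OF that(2)]] by simp
  then show "1 \<in> R" "0 \<in> R" "x \<in> R \<Longrightarrow> y \<in> R \<Longrightarrow> x - y \<in> R" "x \<in> R \<Longrightarrow> y \<in> R \<Longrightarrow> x * y \<in> R"
    "x \<in> R \<Longrightarrow> - x \<in> R" "x \<in> R \<Longrightarrow> y \<in> R \<Longrightarrow> x + y \<in> R"
    using R Z N by auto
qed

lemma sum_mem:
  assumes "(0::'a::comm_monoid_add) \<in> S" "\<And>x y. x \<in> S \<Longrightarrow> y \<in> S \<Longrightarrow> x + y \<in> S"
    and "\<And>i. i \<in> I \<Longrightarrow> f i \<in> S"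
  shows "(\<Sum>i\<in>I. f i) \<in> S"
  using assms(3) by (induction I rule: infinite_finite_induct) (auto intro: assms(1,2))

lemma subring_set_power: "subring_set R \<Longrightarrow> x \<in> R \<Longrightarrow> x ^ n \<in> R"
  by (induction n) (auto dest: subring_setD)

lemma poly_mem:
  assumes "(0::'a::comm_ring_1) \<in> S" "\<And>x y. x \<in> S \<Longrightarrow> y \<in> S \<Longrightarrow> x + y \<in> S"
    and "\<And>r y. r \<in> S \<Longrightarrow> y \<in> A \<Longrightarrow> y * r \<in> S" "subring_set A"
    and "p \<in> polys_over S" "x \<in> A"
  shows "poly p x \<in> S"
proof -
  have "(\<Sum>i\<le>degree p. coeff p i * x ^ i) \<in> S"
  proof (rule sum_mem[OF assms(1,2)])
    show "coeff p i * x ^ i \<in> S" for i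
      using assms(3)[of "coeff p i" "x ^ i"] assms(5) subring_set_power[OF assms(4,6)]
      by (simp add: polys_over_def mult.commute)
  qed auto
  then show ?thesis by (simp add: poly_altdef)
qed

lemma poly_subring: "subring_set R \<Longrightarrow> p \<in> polys_over R \<Longrightarrow> x \<in> R \<Longrightarrow> poly p x \<in> R"
  by (rule poly_mem[where S = R and A = R]) (auto dest: subring_setD)

lemma polys_over_mult:
  assumes "p \<in> polys_over S" "q \<in> polys_over T"
    and "0 \<in> U" "\<And>x y. x \<in> U \<Longrightarrow> y \<in> U \<Longrightarrow> x + y \<in> U"
    and "\<And>x y. x \<in> S \<Longrightarrow> y \<in> T \<Longrightarrow> x * y \<in> U"
  shows "p * q \<in> polys_over U"
  using assms by (auto simp: polys_over_def coeff_mult intro!: sum_mem)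

lemma polys_over_subring:
  assumes "subring_set R" "p \<in> polys_over R" "q \<in> polys_over R"
  shows "p + q \<in> polys_over R" "p - q \<in> polys_over R" "p * q \<in> polys_over R" "- p \<in> polys_over R"
  using assms subring_setD[OF assms(1)] polys_over_mult[of p R q R R] by (auto simp: polys_over_def)

lemma polys_over_const: "0 \<in> R \<Longrightarrow> c \<in> R \<Longrightarrow> [:c:] \<in> polys_over R"
  by (auto simp: polys_over_def coeff_pCons split: nat.splits)

lemma polys_over_smult: "subring_set R \<Longrightarrow> c \<in> R \<Longrightarrow> p \<in> polys_over R \<Longrightarrow> smult c p \<in> polys_over R"
  by (auto simp: polys_over_def dest: subring_setD)

lemma polys_over_monom: "0 \<in> R \<Longrightarrow> c \<in> R \<Longrightarrow> monom c n \<in> polys_over R"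
  by (auto simp: polys_over_def)

lemma polys_over_pCons: "c \<in> R \<Longrightarrow> p \<in> polys_over R \<Longrightarrow> pCons c p \<in> polys_over R"
  by (auto simp: polys_over_def coeff_pCons split: nat.splits)

text \<open>The exchange step in the construction of valuation rings. With \<open>y = 1/x\<close>,
  \<open>t = degree p\<close> and \<open>s = degree r\<close>, the relation \<open>r(y) = 1\<close>
  says that \<open>1 - r_0\<close> is the sum of the \<open>r_i y^i\<close> with
  \<open>i > 0\<close>. Multiplied by \<open>u x^t\<close> it expresses \<open>x^t\<close> through
  \<open>x^(t-s), ..., x^(t-1)\<close>. The new coefficients are displayed because the callers have
  to check that they stay in \<open>M\<close> or in \<open>A\<close>.\<close>

lemma reduce_top_degree:
  fixes x y :: "'a::field"
  assumes xy: "x * y = 1" and r: "poly r y = 1" "degree r > 0" "degree r \<le> degree p"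
    and u: "u * (1 - coeff r 0) = 1"
  obtains p' where "degree p' < degree p" "poly p' x = poly p x"
    "\<And>j. j < degree p \<Longrightarrow> coeff p' j = coeff p j +
       (if degree p - degree r \<le> j then lead_coeff p * u * coeff r (degree p - j) else 0)"
proof -
  define t where "t = degree p"
  define s where "s = degree r"
  have st: "0 < s" "s \<le> t" using r by (auto simp: t_def s_def)
  define g where "g j = (if t - s \<le> j then lead_coeff p * u * coeff r (t - j) else 0)" for j
  define f where "f j = coeff p j + g j" for j
  define p' where "p' = (\<Sum>j<t. monom (f j) j)"
  have c: "coeff p' j = (if j < t then f j else 0)" for j
    unfolding p'_def by (simp add: coeff_sum)
  have d: "degree p' < t"
    using st by (intro degree_lessI) (auto simp: c)
  have pw: "x ^ (t - i) = x ^ t * y ^ i" if "i \<le> t" for i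
  proof -
    have "x ^ t * y ^ i = x ^ (t - i) * (x ^ i * y ^ i)"
      using that by (simp flip: power_add mult.assoc)
    then show ?thesis by (simp flip: power_mult_distrib add: xy)
  qed
  have "(\<Sum>j<t. g j * x ^ j) = (\<Sum>j\<in>{t-s..<t}. lead_coeff p * u * coeff r (t - j) * x ^ j)"
    using st by (intro sum.mono_neutral_cong_right) (auto simp: g_def)
  also have "\<dots> = (\<Sum>i\<in>{1..s}. lead_coeff p * u * coeff r i * x ^ (t - i))"
    using st by (intro sum.reindex_bij_witness[of _ "\<lambda>i. t - i" "\<lambda>i. t - i"]) auto
  also have "\<dots> = lead_coeff p * u * x ^ t * (\<Sum>i\<in>{1..s}. coeff r i * y ^ i)"
    unfolding sum_distrib_left using st by (intro sum.cong) (auto simp: pw)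
  also have "(\<Sum>i\<in>{1..s}. coeff r i * y ^ i) = 1 - coeff r 0"
  proof -
    have "(\<Sum>i\<le>s. coeff r i * y ^ i) = 1" using r by (simp add: poly_altdef s_def)
    moreover have "{..s} = insert 0 {1..s}" by auto
    ultimately show ?thesis by (simp add: algebra_simps)
  qed
  also have "lead_coeff p * u * x ^ t * (1 - coeff r 0) = lead_coeff p * x ^ t * (u * (1 - coeff r 0))"
    by (simp add: algebra_simps)
  also have "\<dots> = coeff p t * x ^ t" using u by (simp add: t_def)
  finally have g: "(\<Sum>j<t. g j * x ^ j) = coeff p t * x ^ t" .
  have "poly p' x = (\<Sum>j<t. f j * x ^ j)"
    unfolding p'_def by (simp add: poly_sum poly_monom)
  also have "\<dots> = (\<Sum>j<t. coeff p j * x ^ j) + coeff p t * x ^ t"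
    unfolding f_def using g by (simp add: algebra_simps sum.distrib)
  also have "\<dots> = poly p x"
    unfolding poly_altdef t_def[symmetric] by (simp add: lessThan_Suc_atMost[symmetric])
  finally show ?thesis
    using that[of p'] d c by (simp add: t_def s_def f_def g_def)
qed

text \<open>Zorn's lemma is applied to the multiplicatively closed \<open>R\<close>-submodules \<open>J \<supseteq> I\<close> with \<open>1 \<notin> J\<close>;
  the valuation ring of a maximal such \<open>M\<close> is its multiplier ring.\<close>

theorem place_exists:
  fixes R :: "'a::field set"
  assumes R: "subring_set R" and I: "ideal_in R I" "1 \<notin> I"
  obtains A M where "place A M" "R \<subseteq> A" "I \<subseteq> M"
proof -
  define F where "F = {J. I \<subseteq> J \<and> 0 \<in> J \<and> (\<forall>x\<in>J. \<forall>y\<in>J. x + y \<in> J \<and> x * y \<in> J) \<and>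
     (\<forall>r\<in>R. \<forall>x\<in>J. r * x \<in> J) \<and> 1 \<notin> J}"
  have "I \<in> F" using I by (auto simp: F_def ideal_in_def)
  have "\<exists>M\<in>F. \<forall>W\<in>F. M \<subseteq> W \<longrightarrow> W = M"
  proof (rule subset_Zorn_nonempty)
    show "F \<noteq> {}" using \<open>I \<in> F\<close> by auto
    fix C assume C: "C \<noteq> {}" "subset.chain F C"
    have CF: "W \<in> F" if "W \<in> C" for W using C that by (auto simp: subset.chain_def)
    have "x + y \<in> (\<Union> C) \<and> x * y \<in> (\<Union> C)" if xy: "x \<in> W" "W \<in> C" "y \<in> Y" "Y \<in> C" for x y W Y
    proof -
      have "W \<subseteq> Y \<or> Y \<subseteq> W" using C xy by (auto simp: subset.chain_def)
      then obtain Z where "Z \<in> C" "x \<in> Z" "y \<in> Z" using xy by blast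
      then show ?thesis using CF[of Z] by (auto simp: F_def)
    qed
    moreover have "I \<subseteq> (\<Union> C)" "0 \<in> (\<Union> C)" using C(1) CF unfolding F_def by blast+
    moreover have "r * x \<in> (\<Union> C)" if "r \<in> R" "x \<in> (\<Union> C)" for r x
      using that CF by (auto simp: F_def)
    moreover have "1 \<notin> (\<Union> C)" using CF by (auto simp: F_def)
    ultimately show "(\<Union> C) \<in> F" unfolding F_def by blast
  qed
  then obtain M where MF: "M \<in> F" and max: "\<And>W. W \<in> F \<Longrightarrow> M \<subseteq> W \<Longrightarrow> W = M" by blast
  define A where "A = {x. \<forall>y\<in>M. x * y \<in> M}"
  have M: "I \<subseteq> M" "0 \<in> M" "1 \<notin> M" "\<And>x y. x \<in> M \<Longrightarrow> y \<in> M \<Longrightarrow> x + y \<in> M"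
    "\<And>x y. x \<in> M \<Longrightarrow> y \<in> M \<Longrightarrow> x * y \<in> M" "\<And>r y. r \<in> R \<Longrightarrow> y \<in> M \<Longrightarrow> r * y \<in> M"
    using MF by (auto simp: F_def)
  have "R \<subseteq> A" "M \<subseteq> A" using M by (auto simp: A_def)
  have AM: "x * y \<in> M" if "x \<in> A" "y \<in> M" for x y using that by (auto simp: A_def)
  have Mn: "- y \<in> M" if "y \<in> M" for y
    using M(6)[of "-1" y] that subring_setD[OF R] by auto
  have A: "subring_set A"
  proof -
    have "(x - z) * y \<in> M" if "x \<in> A" "z \<in> A" "y \<in> M" for x y z
      using M(4)[OF AM[OF that(1,3)] Mn[OF AM[OF that(2,3)]]] by (simp add: algebra_simps)
    moreover have "(x * z) * y \<in> M" if "x \<in> A" "z \<in> A" "y \<in> M" for x y z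
      using AM[OF that(1) AM[OF that(2,3)]] by (simp add: algebra_simps)
    ultimately show ?thesis by (auto simp: subring_set_def A_def)
  qed
  note A' = subring_setD[OF A]
  \<comment> \<open>The values at \<open>z\<close> of the polynomials in \<open>Q\<close> form a set
    \<open>J\<close> that contains \<open>M\<close> and has the closure properties required in
    \<open>F\<close>. If \<open>J\<close> is larger than \<open>M\<close>, maximality leaves only
    one requirement to fail, so \<open>1\<close> lies in \<open>J\<close>.\<close>
  have ext: "\<exists>p\<in>Q. poly p z = 1"
    if Q: "\<And>c. c \<in> M \<Longrightarrow> [:c:] \<in> Q" "\<And>p q. p \<in> Q \<Longrightarrow> q \<in> Q \<Longrightarrow> p + q \<in> Q"
        "\<And>p q. p \<in> Q \<Longrightarrow> q \<in> Q \<Longrightarrow> p * q \<in> Q" "\<And>c p. c \<in> A \<Longrightarrow> p \<in> Q \<Longrightarrow> smult c p \<in> Q"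
      and new: "r \<in> Q" "poly r z \<notin> M" for z :: 'a and Q r
  proof (rule ccontr)
    assume no: "\<not> ?thesis"
    define J where "J = (\<lambda>p. poly p z) ` Q"
    have "M \<subseteq> J"
    proof
      fix c assume "c \<in> M"
      then have "poly [:c:] z \<in> J" unfolding J_def by (intro imageI Q)
      then show "c \<in> J" by simp
    qed
    moreover have "x + y \<in> J \<and> x * y \<in> J" if "x \<in> J" "y \<in> J" for x y
      using that Q(2,3) by (auto simp: J_def simp flip: poly_add poly_mult)
    moreover have "c * x \<in> J" if "c \<in> R" "x \<in> J" for c x
      using that Q(4) \<open>R \<subseteq> A\<close> by (auto simp: J_def simp flip: poly_smult)
    moreover have "1 \<notin> J" using no by (auto simp: J_def)
    ultimately have "J = M" using max[of J] M(1,2) unfolding F_def by blast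
    then show False using new by (auto simp: J_def)
  qed
  have extM: "\<exists>p\<in>polys_over M. poly p z = 1" if "y \<in> M" "z * y \<notin> M" for y z
  proof (rule ext)
    show "monom y 1 \<in> polys_over M" using that M by (intro polys_over_monom)
    show "poly (monom y 1) z \<notin> M" using that by (simp add: poly_monom mult.commute)
    show "p * q \<in> polys_over M" if "p \<in> polys_over M" "q \<in> polys_over M" for p q
      using polys_over_mult[OF that] M by blast
  qed (use M AM in \<open>auto simp: polys_over_def coeff_pCons split: nat.splits\<close>)
  \<comment> \<open>If \<open>u = inverse (1 - a)\<close> were outside \<open>A\<close>, some
    \<open>p\<close> over \<open>M\<close> would satisfy \<open>p(u) = 1\<close>. Multiplied by
    \<open>(1 - a) ^ degree p\<close>, this puts a power of \<open>1 - a\<close> into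
    \<open>M\<close>, although all these powers are congruent to 1 modulo \<open>M\<close>.\<close>
  have unit: "inverse (1 - a) \<in> A" if "a \<in> M" for a
  proof (rule ccontr)
    define u where "u = inverse (1 - a)"
    have "1 - a \<noteq> 0" using that M by auto
    then have u: "u * (1 - a) = 1" by (simp add: u_def)
    have a: "1 - a \<in> A" using that \<open>M \<subseteq> A\<close> A' by auto
    assume "inverse (1 - a) \<notin> A"
    then obtain y where "y \<in> M" "u * y \<notin> M" by (auto simp: A_def u_def)
    then obtain p where p: "p \<in> polys_over M" "poly p u = 1" using extM by blast
    let ?d = "degree p"
    have "(1 - a) ^ ?d = (\<Sum>i\<le>?d. coeff p i * u ^ i) * (1 - a) ^ ?d"
      using p by (simp add: poly_altdef)
    also have "\<dots> = (\<Sum>i\<le>?d. (1 - a) ^ (?d - i) * coeff p i)"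
    proof (unfold sum_distrib_right, intro sum.cong refl)
      fix i assume "i \<in> {..?d}"
      then have "(1 - a) ^ ?d = (1 - a) ^ i * (1 - a) ^ (?d - i)" by (simp flip: power_add)
      moreover have "u ^ i * (1 - a) ^ i = 1" using u by (simp flip: power_mult_distrib)
      ultimately show "coeff p i * u ^ i * (1 - a) ^ ?d = (1 - a) ^ (?d - i) * coeff p i"
        by (simp add: algebra_simps)
    qed
    also have "\<dots> \<in> M"
      using p(1) a A by (intro sum_mem M AM subring_set_power) (auto simp: polys_over_def)
    finally have "(1 - a) ^ ?d \<in> M" .
    moreover have "1 - (1 - a) ^ n \<in> M" for n
    proof (induction n)
      case (Suc n)
      have "1 - (1 - a) ^ Suc n = (1 - (1 - a) ^ n) + (1 - a) ^ n * a" by (simp add: algebra_simps)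
      then show ?case using M(4) Suc AM[OF subring_set_power[OF A a] that] by metis
    qed (simp add: M)
    ultimately have "(1 - (1 - a) ^ ?d) + (1 - a) ^ ?d \<in> M" using M(4) by blast
    then show False using M by simp
  qed
  \<comment> \<open>A counterexample yields \<open>p(x) = 1\<close> with \<open>p\<close> over
    \<open>M\<close>, and \<open>q(inverse x) = 1\<close> with \<open>q\<close> over
    \<open>A\<close> and constant term in \<open>M\<close>; the second shape reflects that
    \<open>inverse x\<close> is only known to lie outside \<open>M\<close>. With both degrees least
    possible, the longer relation is shortened by the other one, and \<open>unit\<close> makes the
    factor \<open>u\<close> available in \<open>A\<close>.\<close>
  have "x \<in> A \<or> inverse x \<in> M" for x
  proof (rule ccontr)
    assume "\<not> (x \<in> A \<or> inverse x \<in> M)"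
    then have x: "x \<notin> A" "inverse x \<notin> M" by auto
    then have "x \<noteq> 0" using A' by auto
    define y where "y = inverse x"
    have xy: "x * y = 1" "y * x = 1" using \<open>x \<noteq> 0\<close> by (auto simp: y_def)
    obtain w where "w \<in> M" "x * w \<notin> M" using x by (auto simp: A_def)
    then have "\<exists>p. p \<in> polys_over M \<and> poly p x = 1" using extM by blast
    then obtain p where p: "p \<in> polys_over M" "poly p x = 1"
      and pmin: "\<And>p'. p' \<in> polys_over M \<Longrightarrow> poly p' x = 1 \<Longrightarrow> degree p \<le> degree p'"
      using ex_has_least_nat[of "\<lambda>p. p \<in> polys_over M \<and> poly p x = 1" _ degree] by blast
    have "\<exists>q. q \<in> polys_over A \<and> coeff q 0 \<in> M \<and> poly q y = 1"
    proof -
      have "\<exists>q\<in>{q. q \<in> polys_over A \<and> coeff q 0 \<in> M}. poly q y = 1"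
      proof (rule ext)
        show "monom 1 1 \<in> {q. q \<in> polys_over A \<and> coeff q 0 \<in> M}"
          using M A' by (auto intro: polys_over_monom)
        show "poly (monom 1 1) y \<notin> M" using x by (simp add: poly_monom y_def)
      qed (use M A A' AM \<open>M \<subseteq> A\<close> in \<open>auto simp: polys_over_subring polys_over_smult coeff_mult intro!: polys_over_const\<close>)
      then show ?thesis by blast
    qed
    then obtain q where q: "q \<in> polys_over A" "coeff q 0 \<in> M" "poly q y = 1"
      and qmin: "\<And>q'. q' \<in> polys_over A \<Longrightarrow> coeff q' 0 \<in> M \<Longrightarrow> poly q' y = 1 \<Longrightarrow> degree q \<le> degree q'"
      using ex_has_least_nat[of "\<lambda>q. q \<in> polys_over A \<and> coeff q 0 \<in> M \<and> poly q y = 1" _ degree] by blast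
    have p0: "coeff p i \<in> M" for i using p by (auto simp: polys_over_def)
    have q0: "coeff q i \<in> A" for i using q by (auto simp: polys_over_def)
    have dp: "degree p > 0" "degree q > 0"
    proof -
      show "degree p > 0"
      proof (rule ccontr)
        assume "\<not> degree p > 0"
        then have "poly p x = coeff p 0" by (simp add: poly_altdef)
        then show False using p p0[of 0] M by simp
      qed
      show "degree q > 0"
      proof (rule ccontr)
        assume "\<not> degree q > 0"
        then have "poly q y = coeff q 0" by (simp add: poly_altdef)
        then show False using q M by simp
      qed
    qed
    show False
    proof (cases "degree q \<le> degree p")
      case True
      define u where "u = inverse (1 - coeff q 0)"
      have "u \<in> A" using unit[OF q(2)] by (simp add: u_def)
      have "1 - coeff q 0 \<noteq> 0" using q(2) M by auto
      then have "u * (1 - coeff q 0) = 1" by (simp add: u_def)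
      from reduce_top_degree[OF xy(1) q(3) dp(2) True this] obtain p' where
        p': "degree p' < degree p" "poly p' x = poly p x" "\<And>j. j < degree p \<Longrightarrow> coeff p' j = coeff p j +
       (if degree p - degree q \<le> j then lead_coeff p * u * coeff q (degree p - j) else 0)" by blast
      have "coeff p' j \<in> M" for j
      proof (cases "j < degree p")
        case True
        have "u * coeff q (degree p - j) * lead_coeff p \<in> M"
          by (intro AM A' \<open>u \<in> A\<close> q0 p0)
        then show ?thesis unfolding p'(3)[OF True] using p0[of j] M by (auto simp: ac_simps intro: M(4))
      qed (use p'(1) M in \<open>auto simp: coeff_eq_0\<close>)
      then show False using pmin[of p'] p' p by (auto simp: polys_over_def)
    next
      case False
      then have le: "degree p \<le> degree q" by simp
      define u where "u = inverse (1 - coeff p 0)"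
      have "u \<in> A" using unit[OF p0[of 0]] by (simp add: u_def)
      have "1 - coeff p 0 \<noteq> 0" using p0[of 0] M by auto
      then have "u * (1 - coeff p 0) = 1" by (simp add: u_def)
      from reduce_top_degree[OF xy(2) p(2) dp(1) le this] obtain q' where
        q': "degree q' < degree q" "poly q' y = poly q y" "\<And>j. j < degree q \<Longrightarrow> coeff q' j = coeff q j +
       (if degree q - degree p \<le> j then lead_coeff q * u * coeff p (degree q - j) else 0)" by blast
      have "coeff q' j \<in> A" for j
      proof (cases "j < degree q")
        case True
        have "lead_coeff q * u * coeff p (degree q - j) \<in> A"
          using p0 q0 \<open>u \<in> A\<close> \<open>M \<subseteq> A\<close> by (intro A') auto
        then show ?thesis unfolding q'(3)[OF True] using q0[of j] A' by auto
      qed (use q'(1) A' in \<open>auto simp: coeff_eq_0\<close>)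
      \<comment> \<open>Strictness matters here: since \<open>degree p < degree q\<close>, the
        correction does not reach the constant term.\<close>
      moreover have "coeff q' 0 \<in> M"
        using q'(3)[of 0] dp False q by auto
      ultimately show False using qmin[of q'] q' q by (auto simp: polys_over_def)
    qed
  qed
  then have "place A M"
    using A M AM \<open>M \<subseteq> A\<close> by (auto simp: place_def ideal_in_def)
  then show ?thesis using that \<open>R \<subseteq> A\<close> M(1) by blast
qed

section \<open>Arithmetic of a place\<close>

lemma placeD:
  assumes "place A M"
  shows "subring_set A" "M \<subseteq> A" "0 \<in> M" "1 \<notin> M" "x \<in> M \<Longrightarrow> y \<in> M \<Longrightarrow> x + y \<in> M"
    "x \<in> A \<Longrightarrow> y \<in> M \<Longrightarrow> x * y \<in> M" "x \<notin> A \<Longrightarrow> inverse x \<in> M"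
  using assms by (auto simp: place_def ideal_in_def)

lemma place_diff:
  assumes "place A M" "x \<in> M" "y \<in> M"
  shows "x - y \<in> M" "- y \<in> M"
proof -
  have "-1 * y \<in> M"
    by (intro placeD(6)[OF assms(1)] assms subring_setD(5,1)[OF placeD(1)[OF assms(1)]])
  then show "- y \<in> M" by simp
  then show "x - y \<in> M" using placeD(5)[OF assms(1), of x "- y"] assms by simp
qed

lemma place_inverse:
  assumes "place A M" "x \<notin> M"
  shows "inverse x \<in> A"
  using placeD(7)[OF assms(1), of "inverse x"] assms by auto

lemma place_prime:
  assumes "place A M" "x * y \<in> M" "x \<notin> M"
  shows "y \<in> M"
proof -
  have "x \<noteq> 0" using assms placeD(3) by blast
  then have "inverse x * (x * y) = y" by (simp add: field_simps)
  then show ?thesis using placeD(6)[OF assms(1) place_inverse[OF assms(1,3)] assms(2)] by metis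
qed

lemma place_power_notin: "place A M \<Longrightarrow> x \<notin> M \<Longrightarrow> x ^ n \<notin> M"
  by (induction n) (auto dest: placeD(4) place_prime)

lemma place_power_in:
  assumes "place A M" "x \<in> M" "n > 0"
  shows "x ^ n \<in> M"
proof -
  have "x \<in> A" using placeD(2)[OF assms(1)] assms(2) by auto
  then have "x ^ (n - 1) * x \<in> M"
    by (intro placeD(6)[OF assms(1)] subring_set_power placeD(1)[OF assms(1)] assms(2))
  then show ?thesis using assms(3) by (simp flip: power_Suc2)
qed

text \<open>An instance of the integral closedness of valuation rings, meant for the eigenvalues of
  operators of finite order modulo \<open>M\<close>: were \<open>x\<close> outside \<open>A\<close>,
  its inverse would lie in \<open>M\<close>, and with it \<open>1 = inverse x ^ n\<close>.\<close>

lemma place_root_of_unity: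
  assumes "place A M" "x ^ n = 1" "n > 0"
  shows "x \<in> A"
proof (rule ccontr)
  assume "x \<notin> A"
  then have "inverse x ^ n \<in> M" using placeD(7)[OF assms(1)] place_power_in[OF assms(1)] assms(3) by blast
  then show False using assms placeD(4)[OF assms(1)] by (simp add: power_inverse)
qed

text \<open>Finiteness is asked of the image of \<open>R\<close> only. Over an algebraically closed
  field the residue field of a valuation ring is itself algebraically closed, hence
  infinite.\<close>

definition finite_residues :: "'a::comm_ring_1 set \<Rightarrow> 'a set \<Rightarrow> bool" where
  "finite_residues R M \<longleftrightarrow> (\<exists>T. finite T \<and> (\<forall>r\<in>R. \<exists>t\<in>T. r - t \<in> M))"

text \<open>Pigeonhole on the powers of \<open>r\<close>. The point is that
  \<open>r ^ (e - 1)\<close> inverts \<open>r\<close> modulo \<open>M\<close> without leaving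
  \<open>R\<close>.\<close>

lemma finite_residues_unit:
  assumes pl: "place A M" and R: "subring_set R" "finite_residues R M" and r: "r \<in> R" "r \<notin> M"
  obtains e where "e > 0" "r ^ e - 1 \<in> M"
proof -
  obtain T where T: "finite T" "\<And>r. r \<in> R \<Longrightarrow> \<exists>t\<in>T. r - t \<in> M"
    using R by (auto simp: finite_residues_def)
  define f where "f i = (SOME t. t \<in> T \<and> r ^ i - t \<in> M)" for i :: nat
  have f: "f i \<in> T" "r ^ i - f i \<in> M" for i
    using someI_ex[of "\<lambda>t. t \<in> T \<and> r ^ i - t \<in> M"] T(2)[OF subring_set_power[OF R(1) r(1)], of i]
    by (auto simp: f_def Bex_def)
  have "\<not> inj f"
  proof
    assume "inj f"
    moreover have "finite (range f)" using f T(1) by (meson finite_subset image_subsetI)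
    ultimately show False using finite_imageD by fastforce
  qed
  then obtain i j where "f i = f j" "i \<noteq> j" by (auto simp: inj_def)
  then have "\<exists>i j. f i = f j \<and> i < j" by (metis linorder_neqE_nat)
  then obtain i j where ij: "f i = f j" "i < j" by blast
  have "(r ^ j - f j) - (r ^ i - f i) \<in> M" by (intro place_diff[OF pl] f)
  then have "r ^ i * (r ^ (j - i) - 1) \<in> M" using ij by (simp add: algebra_simps flip: power_add)
  then have "r ^ (j - i) - 1 \<in> M" using place_prime[OF pl] place_power_notin[OF pl r(2)] by blast
  then show ?thesis using that[of "j - i"] ij by auto
qed

text \<open>Modulo \<open>M\<close> the powers of \<open>x\<close> from the \<open>d\<close>-th on
  reduce to lower ones, so the sums of \<open>t_i x^i\<close> with \<open>i < d\<close> and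
  \<open>t_i\<close> in \<open>T\<close> represent all residues.\<close>

lemma finite_residues_adjoin:
  assumes pl: "place A M" and R: "subring_set R" "R \<subseteq> A" "finite_residues R M"
    and x: "x \<in> A" and q: "q \<in> polys_over R" "x ^ d - poly q x \<in> M" "\<And>i. i \<ge> d \<Longrightarrow> coeff q i = 0"
  shows "finite_residues ((\<lambda>p. poly p x) ` polys_over R) M"
proof -
  note A = placeD(1)[OF pl]
  note A' = subring_setD[OF A]
  obtain T where T: "finite T" "\<And>r. r \<in> R \<Longrightarrow> \<exists>t\<in>T. r - t \<in> M"
    using R by (auto simp: finite_residues_def)
  have inA: "poly p x \<in> A" if "p \<in> polys_over R" for p
    by (rule poly_subring[OF A _ x]) (use that R in \<open>auto simp: polys_over_def\<close>)
  have red: "\<exists>p'\<in>polys_over R. (\<forall>i\<ge>d. coeff p' i = 0) \<and> poly p x - poly p' x \<in> M"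
    if "p \<in> polys_over R" for p
    using that
  proof (induction p)
    case 0
    then show ?case using placeD[OF pl] by (intro bexI[of _ 0]) auto
  next
    case (pCons a p)
    have R0: "a \<in> R" "p \<in> polys_over R"
    proof -
      have *: "coeff (pCons a p) i \<in> R" for i using pCons.prems by (auto simp: polys_over_def)
      show "a \<in> R" using *[of 0] by simp
      show "p \<in> polys_over R" using *[of "Suc i" for i] by (auto simp: polys_over_def)
    qed
    then obtain p' where p': "p' \<in> polys_over R" "\<And>i. i \<ge> d \<Longrightarrow> coeff p' i = 0" "poly p x - poly p' x \<in> M"
      using pCons.IH by blast
    have "poly (pCons a p) x - poly (pCons a p') x = x * (poly p x - poly p' x)" by (simp add: algebra_simps)
    then have 1: "poly (pCons a p) x - poly (pCons a p') x \<in> M" using placeD(6)[OF pl x p'(3)] by simp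
    \<comment> \<open>Multiplication by \<open>x\<close> raises the degree by at most one, so only
      the coefficient at \<open>d\<close> has to be removed.\<close>
    define c where "c = coeff (pCons a p') d"
    define p'' where "p'' = pCons a p' - monom c d + smult c q"
    have o: "pCons a p' \<in> polys_over R" using R0 p' by (intro polys_over_pCons)
    have c: "c \<in> R" using o by (auto simp: c_def polys_over_def)
    have "p'' \<in> polys_over R" unfolding p''_def using o c q(1) subring_setD(2)[OF R(1)]
      by (intro polys_over_subring[OF R(1)] polys_over_smult[OF R(1)] polys_over_monom)
    moreover have "coeff p'' i = 0" if "i \<ge> d" for i
      using that q(3)[of i] p'(2)[of "i - 1"] by (cases "i = d") (auto simp: p''_def c_def coeff_pCons split: nat.split)
    moreover have e: "poly (pCons a p) x - poly p'' x = (poly (pCons a p) x - poly (pCons a p') x) + c * (x ^ d - poly q x)"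
      by (simp add: p''_def poly_monom algebra_simps)
    have "c \<in> A" using c R by auto
    then have "poly (pCons a p) x - poly p'' x \<in> M"
      unfolding e by (intro placeD(5)[OF pl 1] placeD(6)[OF pl _ q(2)])
    ultimately show ?case by blast
  qed
  define T' where "T' = (\<lambda>f. \<Sum>i<d. f i * x ^ i) ` ({..<d} \<rightarrow>\<^sub>E T)"
  have "finite T'" unfolding T'_def using T(1) by (intro finite_imageI finite_PiE) auto
  moreover have "\<exists>t\<in>T'. r - t \<in> M" if r: "r \<in> (\<lambda>p. poly p x) ` polys_over R" for r
  proof -
    obtain p where p: "p \<in> polys_over R" "r = poly p x" using r by auto
    obtain p' where p': "p' \<in> polys_over R" "\<And>i. i \<ge> d \<Longrightarrow> coeff p' i = 0" "poly p x - poly p' x \<in> M"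
      using red[OF p(1)] by blast
    have "\<forall>i. \<exists>t. t \<in> T \<and> coeff p' i - t \<in> M" using T(2) p'(1) by (auto simp: polys_over_def Bex_def)
    then obtain f where f: "\<And>i. f i \<in> T" "\<And>i. coeff p' i - f i \<in> M" by metis
    have "poly p' x = (\<Sum>i<d. coeff p' i * x ^ i)"
    proof -
      have "poly p' x = (\<Sum>i\<le>degree p'. coeff p' i * x ^ i)" by (simp add: poly_altdef)
      also have "\<dots> = (\<Sum>i<d. coeff p' i * x ^ i)"
      proof (rule sum.mono_neutral_cong)
        show "coeff p' i * x ^ i = 0" if "i \<in> {..<d} - {..degree p'}" for i
          using that by (auto simp: coeff_eq_0)
      qed (use p'(2) in auto)
      finally show ?thesis .
    qed
    then have "poly p' x - (\<Sum>i<d. f i * x ^ i) = (\<Sum>i<d. x ^ i * (coeff p' i - f i))"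
      by (simp add: algebra_simps flip: sum_subtractf)
    also have "\<dots> \<in> M"
      by (intro sum_mem placeD[OF pl] subring_set_power f x)
    finally have "(poly p x - poly p' x) + (poly p' x - (\<Sum>i<d. f i * x ^ i)) \<in> M"
      using placeD(5)[OF pl p'(3)] by blast
    then have "r - (\<Sum>i<d. f i * x ^ i) \<in> M" using p by simp
    moreover have "(\<Sum>i<d. f i * x ^ i) \<in> T'"
      unfolding T'_def by (rule image_eqI[of _ _ "restrict f {..<d}"]) (auto simp: f)
    ultimately show ?thesis by blast
  qed
  ultimately show ?thesis unfolding finite_residues_def by blast
qed

text \<open>The form taken here by the fact that in a finitely generated domain every nonzero
  element avoids some maximal ideal of finite index. A place of the whole field is used instead of
  an ideal of \<open>R\<close> so that every element outside \<open>M\<close> has its inverse in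
  \<open>A\<close>.\<close>

definition place_separated :: "'a::field set \<Rightarrow> bool" where
  "place_separated R \<longleftrightarrow> (\<forall>b\<in>R. b \<noteq> 0 \<longrightarrow>
     (\<exists>A M. place A M \<and> R \<subseteq> A \<and> b \<notin> M \<and> finite_residues R M))"

section \<open>Adjoining one element to a ring\<close>

lemma subring_adjoin:
  assumes "subring_set R"
  shows "subring_set ((\<lambda>p. poly p x) ` polys_over R)" "R \<subseteq> (\<lambda>p. poly p x) ` polys_over R"
    "x \<in> (\<lambda>p. poly p x) ` polys_over R"
proof -
  have 1: "[:c:] \<in> polys_over R" if "c \<in> R" for c
    using that subring_setD[OF assms] by (intro polys_over_const)
  have c: "c \<in> (\<lambda>p. poly p x) ` polys_over R" if "c \<in> R" for c
    by (rule image_eqI[OF _ 1[OF that]]) simp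
  then show "R \<subseteq> (\<lambda>p. poly p x) ` polys_over R" by blast
  show "subring_set ((\<lambda>p. poly p x) ` polys_over R)"
    unfolding subring_set_def using c[of 1] subring_setD(1)[OF assms] polys_over_subring[OF assms]
    by (auto simp flip: poly_diff poly_mult)
  show "x \<in> (\<lambda>p. poly p x) ` polys_over R"
    by (rule image_eqI[of _ _ "[:0, 1:]"]) (use subring_setD[OF assms] in \<open>auto intro!: polys_over_pCons polys_over_const\<close>)
qed

text \<open>Division with remainder costs a power of the leading coefficient of \<open>p\<close>,
  which need not be invertible in \<open>R\<close>.\<close>

lemma pseudo_division:
  fixes p :: "'a::idom poly"
  assumes R: "subring_set R" and p: "p \<in> polys_over R" "p \<noteq> 0" and f: "f \<in> polys_over R"
  obtains k q r where "q \<in> polys_over R" "r \<in> polys_over R" "smult (lead_coeff p ^ k) f = q * p + r"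
    "r = 0 \<or> degree r < degree p"
proof -
  have "\<exists>k q r. q \<in> polys_over R \<and> r \<in> polys_over R \<and> smult (lead_coeff p ^ k) f = q * p + r \<and>
    (r = 0 \<or> degree r < degree p)"
    using f
  proof (induction "degree f" arbitrary: f rule: less_induct)
    case less
    show ?case
    proof (cases "f = 0 \<or> degree f < degree p")
      case True
      then show ?thesis using less.prems subring_setD(2)[OF R]
        by (intro exI[of _ 0] exI[of _ "0 :: 'a poly"] exI[of _ f]) (auto simp: polys_over_def)
    next
      case False
      define m where "m = monom (lead_coeff f) (degree f - degree p)"
      define g where "g = smult (lead_coeff p) f - m * p"
      have lc: "lead_coeff f \<in> R" "lead_coeff p \<in> R" using less.prems p by (auto simp: polys_over_def)
      have m: "m \<in> polys_over R" using lc subring_setD(2)[OF R] by (auto simp: m_def intro!: polys_over_monom)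
      have g: "g \<in> polys_over R"
        unfolding g_def using m lc less.prems p by (intro polys_over_subring[OF R] polys_over_smult[OF R])
      have m0: "m \<noteq> 0" "degree m = degree f - degree p" "lead_coeff m = lead_coeff f"
        using False by (auto simp: m_def degree_monom_eq)
      have dm: "degree (m * p) = degree f" using m0 False p by (simp add: degree_mult_eq)
      show ?thesis
      proof (cases "g = 0")
        case True
        then have "smult (lead_coeff p ^ 1) f = m * p + 0" by (simp add: g_def)
        then show ?thesis using m subring_setD(2)[OF R] 
          by (intro exI[of _ 1] exI[of _ m] exI[of _ "0 :: 'a poly"]) (auto simp: polys_over_def)
      next
        case gn: False
        have "coeff g (degree f) = 0"
        proof -
          have "coeff (m * p) (degree f) = lead_coeff (m * p)" using dm by simp
          also have "\<dots> = lead_coeff m * lead_coeff p" by (rule lead_coeff_mult)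
          also have "\<dots> = lead_coeff f * lead_coeff p" unfolding m0(3) ..
          finally show ?thesis by (simp add: g_def)
        qed
        moreover have "degree g \<le> degree f"
          unfolding g_def using dm by (intro degree_diff_le) (auto intro: degree_smult_le)
        ultimately have "degree g < degree f" using gn by (metis leading_coeff_0_iff le_neq_implies_less)
        then obtain k q r where kqr: "q \<in> polys_over R" "r \<in> polys_over R"
          "smult (lead_coeff p ^ k) g = q * p + r" "r = 0 \<or> degree r < degree p"
          using less.hyps g by blast
        have "smult (lead_coeff p ^ Suc k) f = smult (lead_coeff p ^ k) (g + m * p)"
          by (simp add: g_def mult.commute)
        also have "\<dots> = (q + smult (lead_coeff p ^ k) m) * p + r"
          using kqr(3) by (simp add: smult_add_right algebra_simps)
        finally have e: "smult (lead_coeff p ^ Suc k) f = (q + smult (lead_coeff p ^ k) m) * p + r" .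
        have "q + smult (lead_coeff p ^ k) m \<in> polys_over R"
          using kqr m lc by (intro polys_over_subring[OF R] polys_over_smult[OF R] subring_set_power[OF R])
        then show ?thesis using e kqr by blast
      qed
    qed
  qed
  then show ?thesis using that by blast
qed

text \<open>A place whose ring contains \<open>R[x]\<close> avoids \<open>f(x)\<close> as soon as it
  avoids a multiple of it, and a multiple inside \<open>R\<close> brings the question back to
  \<open>R\<close>. The multiple comes from the Euclidean algorithm: divide \<open>p\<close> by
  \<open>f\<close> and pass to the remainder. By minimality of \<open>p\<close> the remainder cannot
  vanish at \<open>x\<close> as long as \<open>f\<close> has positive degree.\<close>

lemma algebraic_divides:
  fixes x :: "'a::idom"
  assumes R: "subring_set R" and p: "p \<in> polys_over R" "p \<noteq> 0" "poly p x = 0"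
    and min: "\<And>p'. p' \<in> polys_over R \<Longrightarrow> p' \<noteq> 0 \<Longrightarrow> poly p' x = 0 \<Longrightarrow> degree p \<le> degree p'"
    and f: "f \<in> polys_over R" "poly f x \<noteq> 0"
  obtains v where "v \<in> polys_over R" "poly v x * poly f x \<in> R" "poly v x * poly f x \<noteq> 0"
proof -
  have main: "\<exists>v\<in>polys_over R. poly v x * poly f x \<in> R \<and> poly v x * poly f x \<noteq> 0"
    if "f \<in> polys_over R" "poly f x \<noteq> 0" "degree f < degree p" for f
    using that
  proof (induction "degree f" arbitrary: f rule: less_induct)
    case less
    show ?case
    proof (cases "degree f = 0")
      case True
      then obtain c where "f = [:c:]" by (rule degree_eq_zeroE)
      moreover from this have "c \<in> R" using less.prems by (auto simp: polys_over_def dest: spec[of _ 0])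
      moreover have "1 \<in> polys_over R"
        using subring_setD[OF R] by (auto simp: polys_over_def coeff_1)
      ultimately show ?thesis using less.prems by (intro bexI[of _ 1]) auto
    next
      case False
      then have "f \<noteq> 0" by auto
      obtain k q r where kqr: "q \<in> polys_over R" "r \<in> polys_over R" "smult (lead_coeff f ^ k) p = q * f + r"
        "r = 0 \<or> degree r < degree f"
        using pseudo_division[OF R less.prems(1) \<open>f \<noteq> 0\<close> p(1)] .
      have e: "poly q x * poly f x = - poly r x"
        using arg_cong[OF kqr(3), of "\<lambda>p. poly p x"] p(3) by (simp add: eq_neg_iff_add_eq_0)
      have "poly r x \<noteq> 0"
      proof
        assume r0: "poly r x = 0"
        have "r = 0"
          using min[OF kqr(2) _ r0] kqr(4) less.prems(3) by (cases "r = 0") auto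
        have "poly q x = 0" using e r0 less.prems by simp
        have qf: "smult (lead_coeff f ^ k) p = q * f" using kqr \<open>r = 0\<close> by simp
        have "q \<noteq> 0" using qf p(2) \<open>f \<noteq> 0\<close> by auto
        then have "degree p = degree q + degree f"
          using arg_cong[OF qf, of degree] \<open>f \<noteq> 0\<close> by (simp add: degree_mult_eq)
        then show False using min[OF kqr(1) \<open>q \<noteq> 0\<close> \<open>poly q x = 0\<close>] False by simp
      qed
      moreover from this have "degree r < degree f" using kqr(4) by auto
      ultimately obtain v where v: "v \<in> polys_over R" "poly v x * poly r x \<in> R" "poly v x * poly r x \<noteq> 0"
        using less.hyps[of r] kqr(2) less.prems by auto
      have "poly (- (v * q)) x * poly f x = poly v x * poly r x"
        using e by (simp add: mult.assoc)
      then show ?thesis using v kqr polys_over_subring[OF R] by metis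
    qed
  qed
  obtain k q r where kqr: "q \<in> polys_over R" "r \<in> polys_over R" "smult (lead_coeff p ^ k) f = q * p + r"
    "r = 0 \<or> degree r < degree p"
    using pseudo_division[OF R p(1,2) f(1)] .
  have e: "lead_coeff p ^ k * poly f x = poly r x"
    using arg_cong[OF kqr(3), of "\<lambda>p. poly p x"] p(3) by simp
  then have "poly r x \<noteq> 0" using f p by auto
  then obtain v where v: "v \<in> polys_over R" "poly v x * poly r x \<in> R" "poly v x * poly r x \<noteq> 0"
    using main[of r] kqr by auto
  have "poly (smult (lead_coeff p ^ k) v) x * poly f x = poly v x * poly r x"
    by (simp flip: e add: algebra_simps)
  moreover have "smult (lead_coeff p ^ k) v \<in> polys_over R"
    using v p by (intro polys_over_smult subring_set_power R) (auto simp: polys_over_def)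
  ultimately show ?thesis using that v by metis
qed

text \<open>The place is chosen to avoid, besides a multiple of \<open>b\<close>, the leading
  coefficient \<open>a\<close> of a minimal relation for \<open>x\<close>. This forces
  \<open>x\<close> into \<open>A\<close>, since otherwise dividing the relation by
  \<open>x^d\<close> would write \<open>a\<close> as a combination of powers of
  \<open>inverse x\<close>, which lie in \<open>M\<close>. It also makes the relation monic modulo
  \<open>M\<close> up to a unit, which keeps the residues finite.\<close>

lemma place_separated_algebraic:
  fixes x :: "'a::field"
  assumes R: "subring_set R" "place_separated R" and alg: "p \<in> polys_over R" "p \<noteq> 0" "poly p x = 0"
  shows "place_separated ((\<lambda>p. poly p x) ` polys_over R)"
  unfolding place_separated_def
proof (intro ballI impI)
  fix b assume "b \<in> (\<lambda>p. poly p x) ` polys_over R" "b \<noteq> 0"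
  then obtain f where f: "f \<in> polys_over R" "b = poly f x" "poly f x \<noteq> 0" by auto
  obtain p where p: "p \<in> polys_over R" "p \<noteq> 0" "poly p x = 0"
    and min: "\<And>p'. p' \<in> polys_over R \<Longrightarrow> p' \<noteq> 0 \<Longrightarrow> poly p' x = 0 \<Longrightarrow> degree p \<le> degree p'"
    using ex_has_least_nat[of "\<lambda>p. p \<in> polys_over R \<and> p \<noteq> 0 \<and> poly p x = 0" _ degree] alg by blast
  obtain v where v: "v \<in> polys_over R" "poly v x * poly f x \<in> R" "poly v x * poly f x \<noteq> 0"
    using algebraic_divides[OF R(1) p min f(1,3)] by blast
  define a where "a = lead_coeff p"
  have a: "a \<in> R" "a \<noteq> 0" using p by (auto simp: a_def polys_over_def)
  have "a * (poly v x * poly f x) \<in> R" "a * (poly v x * poly f x) \<noteq> 0"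
    using a v subring_setD(4)[OF R(1)] by auto
  then obtain A M where AM: "place A M" "R \<subseteq> A" "a * (poly v x * poly f x) \<notin> M" "finite_residues R M"
    using R(2) unfolding place_separated_def by blast
  note A = subring_setD[OF placeD(1)[OF AM(1)]]
  have "a \<notin> M"
    using AM(2,3) v(2) placeD(6)[OF AM(1), of "poly v x * poly f x" a] by (auto simp: mult.commute)
  define d where "d = degree p"
  have d0: "d > 0"
  proof (rule ccontr)
    assume "\<not> d > 0"
    then show False using p by (auto simp: d_def elim!: degree_eq_zeroE)
  qed
  have psum: "(\<Sum>i<d. coeff p i * x ^ i) + a * x ^ d = 0"
    using p(3) by (simp add: poly_altdef a_def d_def lessThan_Suc_atMost[symmetric])
  have x: "x \<in> A"
  proof (rule ccontr)
    assume "x \<notin> A"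
    then have y: "inverse x \<in> M" and "x \<noteq> 0" using placeD(7)[OF AM(1)] A by auto
    have "a = - (\<Sum>i<d. coeff p i * inverse x ^ (d - i))"
    proof -
      have "0 = inverse x ^ d * ((\<Sum>i<d. coeff p i * x ^ i) + a * x ^ d)" by (simp add: psum)
      also have "\<dots> = (\<Sum>i<d. coeff p i * (inverse x ^ d * x ^ i)) + a * (inverse x ^ d * x ^ d)"
        by (simp add: algebra_simps sum_distrib_left)
      also have "inverse x ^ d * x ^ d = 1" using \<open>x \<noteq> 0\<close> by (simp flip: power_mult_distrib)
      also have "(\<Sum>i<d. coeff p i * (inverse x ^ d * x ^ i)) = (\<Sum>i<d. coeff p i * inverse x ^ (d - i))"
      proof (intro sum.cong refl)
        fix i assume "i \<in> {..<d}"
        then have "inverse x ^ d = inverse x ^ (d - i) * inverse x ^ i" by (simp flip: power_add)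
        moreover have "inverse x ^ i * x ^ i = 1" using \<open>x \<noteq> 0\<close> by (simp flip: power_mult_distrib)
        ultimately show "coeff p i * (inverse x ^ d * x ^ i) = coeff p i * inverse x ^ (d - i)"
          by (simp add: mult.assoc)
      qed
      finally show ?thesis by (simp add: eq_neg_iff_add_eq_0 add.commute)
    qed
    moreover have "(\<Sum>i<d. coeff p i * inverse x ^ (d - i)) \<in> M"
      using p AM(2) by (intro sum_mem placeD[OF AM(1)] place_power_in[OF AM(1) y]) (auto simp: polys_over_def)
    ultimately show False using \<open>a \<notin> M\<close> place_diff(2)[OF AM(1), of 0] placeD(3)[OF AM(1)] by metis
  qed
  have inA: "poly g x \<in> A" if "g \<in> polys_over R" for g
    by (rule poly_subring[OF placeD(1)[OF AM(1)] _ x]) (use that AM in \<open>auto simp: polys_over_def\<close>)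
  have "b \<notin> M"
  proof
    assume "b \<in> M"
    then have "(a * poly v x) * poly f x \<in> M"
      using f a AM inA[OF v(1)] A by (intro placeD(6)[OF AM(1)]) auto
    then show False using AM(3) by (simp add: mult.assoc)
  qed
  moreover have "finite_residues ((\<lambda>p. poly p x) ` polys_over R) M"
  proof -
    obtain e where e: "e > 0" "a ^ e - 1 \<in> M"
      using finite_residues_unit[OF AM(1) R(1) AM(4) a(1) \<open>a \<notin> M\<close>] .
    \<comment> \<open>The relation for \<open>x\<close> solved for \<open>x^d\<close> modulo
      \<open>M\<close>, with \<open>a ^ (e - 1)\<close> in the place of the inverse of
      \<open>a\<close>.\<close>
    define q where "q = smult (- (a ^ (e - 1))) (p - monom a d)"
    have "q \<in> polys_over R" unfolding q_def
      using a p subring_setD[OF R(1)]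
      by (intro polys_over_smult[OF R(1)] polys_over_subring[OF R(1)] polys_over_monom subring_setD(5)[OF R(1)]
          subring_set_power[OF R(1)]) auto
    moreover have "coeff q i = 0" if "i \<ge> d" for i
      using that by (cases "i = d") (auto simp: q_def a_def d_def coeff_eq_0)
    moreover have "x ^ d - poly q x = (-1) * x ^ d * (a ^ e - 1)"
    proof -
      have "a ^ e = a ^ (e - 1) * a" using e by (simp flip: power_Suc2)
      then show ?thesis using p(3) by (simp add: q_def poly_monom algebra_simps)
    qed
    then have "x ^ d - poly q x \<in> M"
      using placeD(6)[OF AM(1) _ e(2), of "(-1) * x ^ d"] A x subring_set_power[OF placeD(1)[OF AM(1)] x] by auto
    ultimately show ?thesis using finite_residues_adjoin[OF AM(1) R(1) AM(2,4) x] by blast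
  qed
  ultimately show "\<exists>A M. place A M \<and> (\<lambda>p. poly p x) ` polys_over R \<subseteq> A \<and> b \<notin> M \<and>
     finite_residues ((\<lambda>p. poly p x) ` polys_over R) M"
    using AM(1) inA by blast
qed

text \<open>If \<open>x\<close> is transcendental over \<open>R\<close> and \<open>b = f(x)\<close>, then a root \<open>c\<close> of \<open>X f(X) + 1\<close> satisfies
  \<open>f(c) \<noteq> 0\<close>, and specialising \<open>x\<close> to \<open>c\<close> reduces the claim to the algebraic extension \<open>R[c]\<close>.\<close>

lemma place_separated_adjoin:
  fixes x :: "'a::alg_closed_field"
  assumes R: "subring_set R" "place_separated R"
  shows "place_separated ((\<lambda>p. poly p x) ` polys_over R)"
proof (cases "\<exists>p\<in>polys_over R. p \<noteq> 0 \<and> poly p x = 0")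
  case True
  then show ?thesis using place_separated_algebraic[OF R] by blast
next
  case False
  have inj: "p = q" if "p \<in> polys_over R" "q \<in> polys_over R" "poly p x = poly q x" for p q
  proof -
    have "p - q \<in> polys_over R" "poly (p - q) x = 0" using that polys_over_subring[OF R(1)] by auto
    then have "p - q = 0" using False by blast
    then show ?thesis by simp
  qed
  let ?S = "(\<lambda>p. poly p x) ` polys_over R"
  show ?thesis
    unfolding place_separated_def
  proof (intro ballI impI)
    fix b assume "b \<in> ?S" "b \<noteq> 0"
    then obtain f where f: "f \<in> polys_over R" "b = poly f x" by auto
    then have "f \<noteq> 0" using \<open>b \<noteq> 0\<close> by auto
    define h where "h = pCons 1 f"
    have "degree h > 0" using \<open>f \<noteq> 0\<close> by (simp add: h_def)
    then obtain c where c: "poly h c = 0" using alg_closed_imp_poly_has_root by blast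
    have h: "h \<in> polys_over R" "h \<noteq> 0"
      using f subring_setD[OF R(1)] by (auto simp: h_def intro!: polys_over_pCons)
    let ?C = "(\<lambda>p. poly p c) ` polys_over R"
    note C = subring_adjoin[OF R(1), of c]
    have "poly f c \<in> ?C" "poly f c \<noteq> 0" using f c by (auto simp: h_def)
    moreover have "place_separated ?C" using place_separated_algebraic[OF R h c] .
    ultimately obtain A M where AM: "place A M" "?C \<subseteq> A" "poly f c \<notin> M" "finite_residues ?C M"
      unfolding place_separated_def by blast
    \<comment> \<open>The preimage of \<open>M\<close> under the specialisation of \<open>x\<close>
      to \<open>c\<close>, which is well defined because evaluation at \<open>x\<close> is injective
      on polynomials over \<open>R\<close>. The pair \<open>A\<close>, \<open>M\<close> itself
      cannot serve \<open>?S\<close>, as \<open>x\<close> may lie outside \<open>A\<close>; a new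
      place is built over \<open>J\<close>.\<close>
    define J where "J = (\<lambda>g. poly g x) ` {g \<in> polys_over R. poly g c \<in> M}"
    have J: "g \<in> polys_over R \<Longrightarrow> poly g x \<in> J \<longleftrightarrow> poly g c \<in> M" for g
      using inj by (auto simp: J_def)
    have "ideal_in ?S J"
      unfolding ideal_in_def
    proof (intro conjI ballI)
      show "J \<subseteq> ?S" by (auto simp: J_def)
      have "0 \<in> polys_over R" using subring_setD[OF R(1)] by (auto simp: polys_over_def)
      then show "0 \<in> J" using J[of 0] placeD(3)[OF AM(1)] by auto
      show "u + v \<in> J" if uv: "u \<in> J" "v \<in> J" for u v
      proof -
        obtain g k where "g \<in> polys_over R" "u = poly g x" "poly g c \<in> M"
          "k \<in> polys_over R" "v = poly k x" "poly k c \<in> M"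
          using uv by (auto simp: J_def)
        moreover from this have "poly g c + poly k c \<in> M" by (intro placeD(5)[OF AM(1)])
        ultimately show ?thesis using J[of "g + k"] polys_over_subring[OF R(1)] by simp
      qed
      show "u * v \<in> J" if uv: "u \<in> ?S" "v \<in> J" for u v
      proof -
        obtain g k where "g \<in> polys_over R" "u = poly g x" "k \<in> polys_over R" "v = poly k x" "poly k c \<in> M"
          using uv by (auto simp: J_def)
        moreover from this have "poly g c * poly k c \<in> M"
          using AM(2) by (intro placeD(6)[OF AM(1)]) auto
        ultimately show ?thesis using J[of "g * k"] polys_over_subring[OF R(1)] by simp
      qed
    qed
    moreover have o: "1 \<in> polys_over R" using subring_setD[OF R(1)] by (auto simp: polys_over_def coeff_1)
    have "1 \<notin> J" using J[OF o] placeD(4)[OF AM(1)] by simp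
    ultimately obtain A' M' where AM': "place A' M'" "?S \<subseteq> A'" "J \<subseteq> M'"
      using place_exists[OF subring_adjoin(1)[OF R(1)]] by metis
    \<comment> \<open>\<open>M'\<close> might meet \<open>?S\<close> in more than \<open>J\<close>,
      so non-membership is not inherited directly. What carries over is the membership of
      \<open>poly f c ^ e - 1\<close> in \<open>M\<close>.\<close>
    have "b \<notin> M'"
    proof
      assume b: "b \<in> M'"
      obtain e where e: "e > 0" "poly f c ^ e - 1 \<in> M"
        using finite_residues_unit[OF AM(1) C(1) AM(4) _ AM(3)] f by blast
      have fe: "f ^ e \<in> polys_over R" for e
        using polys_over_subring[OF R(1)] f(1) o by (induction e) auto
      have "poly (f ^ e - 1) x \<in> J"
        using J[of "f ^ e - 1"] e polys_over_subring[OF R(1) fe o] by simp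
      then have "b ^ e - 1 \<in> M'" using AM'(3) f(2) by auto
      moreover have "b ^ e \<in> M'" using place_power_in[OF AM'(1) b e(1)] .
      ultimately have "b ^ e - (b ^ e - 1) \<in> M'" using place_diff(1)[OF AM'(1)] by blast
      then show False using placeD(4)[OF AM'(1)] by simp
    qed
    moreover have "finite_residues ?S M'"
    proof -
      obtain T where T: "finite T" "\<And>r. r \<in> ?C \<Longrightarrow> \<exists>t\<in>T. r - t \<in> M"
        using AM(4) by (auto simp: finite_residues_def)
      define g where "g t = (SOME g. g \<in> polys_over R \<and> poly g c - t \<in> M)" for t
      have "\<exists>t\<in>(\<lambda>t. poly (g t) x) ` T. r - t \<in> M'" if r: "r \<in> ?S" for r
      proof -
        obtain k where k: "k \<in> polys_over R" "r = poly k x" using r by auto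
        then obtain t where t: "t \<in> T" "poly k c - t \<in> M" using T(2) by blast
        have g: "g t \<in> polys_over R" "poly (g t) c - t \<in> M"
          using someI[of "\<lambda>g. g \<in> polys_over R \<and> poly g c - t \<in> M" k] k t by (auto simp: g_def)
        have "(poly k c - t) - (poly (g t) c - t) \<in> M" by (intro place_diff[OF AM(1)] t g)
        then have "poly (k - g t) x \<in> J"
          using J[OF polys_over_subring(2)[OF R(1) k(1) g(1)]] by simp
        then show ?thesis using k t AM'(3) by auto
      qed
      then show ?thesis unfolding finite_residues_def using T(1) by (intro exI[of _ "(\<lambda>t. poly (g t) x) ` T"]) auto
    qed
    ultimately show "\<exists>A M. place A M \<and> ?S \<subseteq> A \<and> b \<notin> M \<and> finite_residues ?S M"
      using AM' by blast
  qed
qed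

lemma place_separated_Ints: "place_separated (\<int> :: 'a::field set)"
  unfolding place_separated_def
proof (intro ballI impI)
  fix b :: 'a assume "b \<in> \<int>" "b \<noteq> 0"
  then obtain k where k: "b = of_int k" "of_int k \<noteq> (0 :: 'a)" by (auto elim: Ints_cases)
  \<comment> \<open>The multiples of \<open>p\<close> must form a proper ideal that avoids
    \<open>b\<close>. In positive characteristic every other prime is a unit, so \<open>p\<close> is
    the characteristic and the ideal is zero.\<close>
  have "\<exists>p. prime p \<and> \<not> int p dvd k \<and> (\<forall>j. of_int (int p * j) \<noteq> (1 :: 'a))"
  proof (cases "CHAR('a) = 0")
    case True
    have "k \<noteq> 0" using k by auto
    obtain p where p: "prime p" "p > nat \<bar>k\<bar>" using bigger_prime by blast
    have "\<not> int p dvd k"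
    proof
      assume "int p dvd k"
      then have "int p \<le> \<bar>k\<bar>" using \<open>k \<noteq> 0\<close> dvd_imp_le_int[of k "int p"] by simp
      then show False using p by linarith
    qed
    moreover have "of_int (int p * j) \<noteq> (1 :: 'a)" for j
    proof
      assume "of_int (int p * j) = (1 :: 'a)"
      then have "of_int (int p * j - 1) = (0 :: 'a)" by simp
      then have "int p * j - 1 = 0" using True by (simp only: of_int_eq_0_iff_char_dvd) simp
      then have "1 = int p * j" by simp
      then have "int p dvd 1" by (rule dvdI)
      then show False using p by (simp add: prime_nat_iff)
    qed
    ultimately show ?thesis using p by blast
  next
    case False
    then have "prime CHAR('a)" by (simp add: prime_CHAR_semidom)
    moreover have "\<not> int CHAR('a) dvd k" using k by (simp add: of_int_eq_0_iff_char_dvd)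
    moreover have "of_int (int CHAR('a) * j) \<noteq> (1 :: 'a)" for j by simp
    ultimately show ?thesis by blast
  qed
  then obtain p where p': "prime p \<and> \<not> int p dvd k \<and> (\<forall>j. of_int (int p * j) \<noteq> (1 :: 'a))" ..
  then have p: "prime p" "\<not> int p dvd k" "of_int (int p * j) \<noteq> (1 :: 'a)" for j
    by auto
  define I where "I = range (\<lambda>j. of_int (int p * j) :: 'a)"
  have Z: "subring_set (\<int> :: 'a set)" by (auto simp: subring_set_def)
  have "ideal_in \<int> I"
    unfolding ideal_in_def
  proof (intro conjI ballI)
    show "0 \<in> I" unfolding I_def by (rule image_eqI[of _ _ 0]) auto
    show "x + y \<in> I" if xy: "x \<in> I" "y \<in> I" for x y
    proof -
      obtain i j where "x = of_int (int p * i)" "y = of_int (int p * j)"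
        using xy unfolding I_def by (elim rangeE)
      then have "x + y = of_int (int p * (i + j))" by (simp add: algebra_simps)
      then show ?thesis unfolding I_def by (rule range_eqI)
    qed
    show "r * x \<in> I" if rx: "r \<in> \<int>" "x \<in> I" for r x
    proof -
      obtain i where "r = of_int i" using rx by (auto elim: Ints_cases)
      moreover obtain j where "x = of_int (int p * j)" using rx(2) unfolding I_def by (rule rangeE)
      ultimately have "r * x = of_int (int p * (i * j))" by (simp add: algebra_simps)
      then show ?thesis unfolding I_def by (rule range_eqI)
    qed
  qed (auto simp: I_def)
  moreover have "1 \<notin> I" using p(3) by (auto simp: I_def)
  ultimately obtain A M where AM: "place A M" "\<int> \<subseteq> A" "I \<subseteq> M" using place_exists[OF Z] by metis
  have pM: "of_int (int p * j) \<in> M" for j using AM(3) by (auto simp: I_def)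
  have "b \<notin> M"
  proof
    assume b: "b \<in> M"
    have "coprime (int p) k" using p by (simp add: prime_imp_coprime)
    then obtain u v where "u * int p + v * k = 1" using bezout_int[of "int p" k] by (auto simp: coprime_iff_gcd_eq_1)
    then have "of_int (u * int p + v * k) = (1 :: 'a)" by simp
    then have "(1 :: 'a) = of_int (int p * u) + of_int v * b"
      unfolding k(1) by (simp add: mult.commute)
    also have "\<dots> \<in> M" using AM(2) by (intro placeD(5,6)[OF AM(1)] pM b) auto
    finally show False using placeD(4)[OF AM(1)] by simp
  qed
  moreover have "finite_residues \<int> M"
    unfolding finite_residues_def
  proof (intro exI[of _ "of_int ` {0..<int p}"] conjI ballI)
    fix r :: 'a assume "r \<in> \<int>"
    then obtain i where i: "r = of_int i" by (auto elim: Ints_cases)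
    have "r - of_int (i mod int p) = of_int (int p * (i div int p))"
      unfolding i by (simp flip: of_int_diff add: minus_mod_eq_mult_div)
    then have "r - of_int (i mod int p) \<in> M" by (simp only: pM)
    moreover have "i mod int p \<in> {0..<int p}" using p(1) by (simp add: prime_gt_0_nat)
    ultimately show "\<exists>t\<in>of_int ` {0..<int p}. r - t \<in> M" by blast
  qed auto
  ultimately show "\<exists>A M. place A M \<and> \<int> \<subseteq> A \<and> b \<notin> M \<and> finite_residues \<int> M" using AM by blast
qed

theorem finite_set_in_place_separated:
  fixes E :: "'a::alg_closed_field set"
  assumes "finite E"
  obtains R where "subring_set R" "E \<subseteq> R" "place_separated R"
proof -
  have "\<exists>R. subring_set R \<and> E \<subseteq> R \<and> place_separated R"
    using assms
  proof (induction E)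
    case empty
    then show ?case using place_separated_Ints by (intro exI[of _ \<int>]) (auto simp: subring_set_def)
  next
    case (insert x E)
    then obtain R where "subring_set R" "E \<subseteq> R" "place_separated R" by blast
    then show ?case using subring_adjoin[of R x] place_separated_adjoin[of R x] by blast
  qed
  then show ?thesis using that by blast
qed

subsection \<open>Subgroups of finite index\<close>

abbreviation finite_index :: "('a, 'b) monoid_scheme \<Rightarrow> 'a set \<Rightarrow> bool" where
  "finite_index G H \<equiv> finite (rcosets\<^bsub>G\<^esub> H)"

lemma finite_image_factor:
  assumes "finite (f ` A)" "\<And>x y. x \<in> A \<Longrightarrow> y \<in> A \<Longrightarrow> f x = f y \<Longrightarrow> g x = g y"
  shows "finite (g ` A)"
proof (rule finite_subset)
  show "g ` A \<subseteq> (\<lambda>z. g (SOME x. x \<in> A \<and> f x = z)) ` f ` A"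
  proof
    fix w assume "w \<in> g ` A"
    then obtain x where x: "x \<in> A" "w = g x" by auto
    define y where "y = (SOME y. y \<in> A \<and> f y = f x)"
    have "y \<in> A \<and> f y = f x" unfolding y_def by (rule someI[of _ x]) (use x in auto)
    then have "w = g y" using x assms(2)[of x y] by auto
    then show "w \<in> (\<lambda>z. g (SOME x. x \<in> A \<and> f x = z)) ` f ` A" using x by (auto simp: y_def)
  qed
qed (use assms(1) in auto)

lemma (in group) rcosets_image: "rcosets H = (\<lambda>g. H #> g) ` carrier G"
  by (auto simp: RCOSETS_def)

lemma (in group) coset_eq_iff:
  assumes "subgroup H G" "g \<in> carrier G" "h \<in> carrier G"
  shows "H #> g = H #> h \<longleftrightarrow> g \<otimes> inv h \<in> H"
proof
  assume "H #> g = H #> h"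
  then have "g \<in> H #> h" using rcos_self[OF assms(2,1)] by simp
  then show "g \<otimes> inv h \<in> H" using subgroup.rcos_module[OF assms(1) group_axioms assms(3,2)] by simp
next
  assume "g \<otimes> inv h \<in> H"
  then have "g \<in> H #> h" using subgroup.rcos_module[OF assms(1) group_axioms assms(3,2)] by simp
  then show "H #> g = H #> h" using repr_independence[OF _ assms(3,1)] by simp
qed

lemma (in group) finite_indexI:
  assumes "subgroup H G" "finite (f ` carrier G)"
    and "\<And>g h. g \<in> carrier G \<Longrightarrow> h \<in> carrier G \<Longrightarrow> f g = f h \<Longrightarrow> g \<otimes> inv h \<in> H"
  shows "finite_index G H"
  unfolding rcosets_image
  by (rule finite_image_factor[OF assms(2)]) (use assms coset_eq_iff in auto)

lemma (in group) finite_index_mono: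
  assumes "subgroup H G" "subgroup L G" "H \<subseteq> L" "finite_index G H"
  shows "finite_index G L"
proof (rule finite_indexI[OF assms(2)])
  show "finite ((\<lambda>g. H #> g) ` carrier G)" using assms(4) by (simp add: rcosets_image)
qed (use assms coset_eq_iff in auto)

lemma (in group) finite_index_carrier: "finite_index G (carrier G)"
  by (rule finite_indexI[OF subgroup_self, of "\<lambda>_. ()"]) auto

text \<open>\<open>K\<close> is the kernel of right translation on the finite set \<open>E\<close>
  of all cosets of all the \<open>L j\<close>. It lies in \<open>L j\<close> because it fixes the
  coset \<open>L j\<close> itself.\<close>

lemma (in group) normal_core:
  assumes "finite J" and L: "\<And>j. j \<in> J \<Longrightarrow> subgroup (L j) G" "\<And>j. j \<in> J \<Longrightarrow> finite_index G (L j)"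
  obtains K where "K \<lhd> G" "finite_index G K" "\<And>j. j \<in> J \<Longrightarrow> K \<subseteq> L j"
proof -
  define E where "E = (\<Union>j\<in>J. rcosets (L j))"
  have E: "C \<subseteq> carrier G" "C #> g \<in> E" if C: "C \<in> E" "g \<in> carrier G" for C g
  proof -
    obtain j where j: "j \<in> J" "C \<in> rcosets (L j)" using C by (auto simp: E_def)
    then obtain h where h: "h \<in> carrier G" "C = L j #> h" by (auto simp: RCOSETS_def)
    have Lj: "L j \<subseteq> carrier G" using subgroup.subset[OF L(1)[OF j(1)]] .
    show "C \<subseteq> carrier G" using r_coset_subset_G[OF Lj h(1)] h(2) by simp
    have "C #> g = L j #> (h \<otimes> g)" using coset_mult_assoc[OF Lj h(1) C(2)] h(2) by simp
    moreover have "L j #> (h \<otimes> g) \<in> rcosets (L j)" using rcosetsI[OF Lj] h(1) C(2) by simp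
    ultimately show "C #> g \<in> E" using j(1) unfolding E_def by auto
  qed
  have finE: "finite E" using assms by (auto simp: E_def)
  define K where "K = {g \<in> carrier G. \<forall>C\<in>E. C #> g = C}"
  have conj: "x \<otimes> g \<otimes> inv x \<in> K" if xg: "x \<in> carrier G" "g \<in> K" for x g
  proof -
    have g: "g \<in> carrier G" using xg by (auto simp: K_def)
    have "C #> (x \<otimes> g \<otimes> inv x) = C" if C: "C \<in> E" for C
    proof -
      have sub: "C \<subseteq> carrier G" "C #> x \<subseteq> carrier G"
        using E(1)[OF C xg(1)] E(1)[OF E(2)[OF C xg(1)] xg(1)] by auto
      have "C #> (x \<otimes> g \<otimes> inv x) = ((C #> x) #> g) #> inv x"
        using sub xg(1) g by (simp add: coset_mult_assoc m_assoc)
      also have "(C #> x) #> g = C #> x" using xg(2) E(2)[OF C xg(1)] by (auto simp: K_def)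
      also have "(C #> x) #> inv x = C" using sub xg(1) by (simp add: coset_mult_assoc)
      finally show ?thesis .
    qed
    then show ?thesis using xg g by (auto simp: K_def)
  qed
  have K: "subgroup K G"
  proof (rule subgroupI)
    show "K \<subseteq> carrier G" by (auto simp: K_def)
    have "\<one> \<in> K" using E(1)[of _ \<one>] by (auto simp: K_def)
    then show "K \<noteq> {}" by auto
    fix a assume a: "a \<in> K"
    then have ac: "a \<in> carrier G" by (auto simp: K_def)
    have "C #> inv a = C" if C: "C \<in> E" for C
    proof -
      have "C #> inv a = (C #> a) #> inv a" using a C by (auto simp: K_def)
      then show ?thesis using E(1)[OF C ac] ac by (simp add: coset_mult_assoc)
    qed
    then show "inv a \<in> K" using ac by (auto simp: K_def)
    fix b assume b: "b \<in> K"
    have "C #> (a \<otimes> b) = C" if C: "C \<in> E" for C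
    proof -
      have "C #> (a \<otimes> b) = (C #> a) #> b" using E(1)[OF C ac] ac b by (simp add: coset_mult_assoc K_def)
      then show ?thesis using a b C by (auto simp: K_def)
    qed
    then show "a \<otimes> b \<in> K" using a b by (auto simp: K_def)
  qed
  have "K \<lhd> G" using K conj by (auto simp: normal_inv_iff)
  moreover have "finite_index G K"
  proof (rule finite_indexI[OF K])
    show "finite ((\<lambda>g. \<lambda>C\<in>E. C #> g) ` carrier G)"
    proof (rule finite_subset)
      show "(\<lambda>g. \<lambda>C\<in>E. C #> g) ` carrier G \<subseteq> E \<rightarrow>\<^sub>E E" using E(2) by auto
      show "finite (E \<rightarrow>\<^sub>E E)" using finE by (intro finite_PiE) auto
    qed
    fix g h assume gh: "g \<in> carrier G" "h \<in> carrier G" and eq: "(\<lambda>C\<in>E. C #> g) = (\<lambda>C\<in>E. C #> h)"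
    have "C #> (g \<otimes> inv h) = C" if C: "C \<in> E" for C
    proof -
      have "C #> (g \<otimes> inv h) = (C #> g) #> inv h" using E(1)[OF C gh(1)] gh by (simp add: coset_mult_assoc)
      also have "C #> g = C #> h" using fun_cong[OF eq, of C] C by simp
      also have "(C #> h) #> inv h = C" using E(1)[OF C gh(1)] gh by (simp add: coset_mult_assoc)
      finally show ?thesis .
    qed
    then show "g \<otimes> inv h \<in> K" using gh by (auto simp: K_def)
  qed
  moreover have "K \<subseteq> L j" if j: "j \<in> J" for j
  proof
    fix g assume g: "g \<in> K"
    have "L j \<in> E" using subgroup.subgroup_in_rcosets[OF L(1)[OF j] group_axioms] j by (auto simp: E_def)
    then have "L j #> g = L j" "g \<in> carrier G" using g by (auto simp: K_def)
    then show "g \<in> L j" using coset_join1 L(1)[OF j] by blast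
  qed
  ultimately show ?thesis using that by blast
qed

text \<open>With the whole group as \<open>N\<close> this already provides a proper subgroup of
  finite index, the start of the induction below.\<close>

definition has_supplements :: "('a, 'b) monoid_scheme \<Rightarrow> bool" where
  "has_supplements G \<longleftrightarrow> (\<forall>N. N \<lhd> G \<longrightarrow> finite_index G N \<longrightarrow>
     (\<exists>L. subgroup L G \<and> finite_index G L \<and> L \<noteq> carrier G \<and> L <#>\<^bsub>G\<^esub> N = carrier G))"

text \<open>Each step adds a supplement \<open>M\<close> of a normal subgroup \<open>K\<close>
  contained in all earlier subgroups. An old generator splits as \<open>g = m h\<close> with
  \<open>m\<close> in \<open>M\<close> and \<open>h\<close> in \<open>K\<close>: \<open>h\<close>
  lies in all the old subgroups, and \<open>m\<close> lies in \<open>M\<close> and in every old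
  subgroup that contains \<open>g\<close>. For a single subgroup the condition on the generators is
  vacuous, hence the count \<open>Suc k\<close>.\<close>

lemma (in group) independent_subgroups:
  assumes FA: "has_supplements G"
  shows "\<exists>L::nat \<Rightarrow> 'a set. (\<forall>i<Suc k. subgroup (L i) G \<and> finite_index G (L i) \<and> L i \<noteq> carrier G) \<and>
    generate G (\<Union>i<Suc k. {g \<in> carrier G. \<forall>j<Suc k. j \<noteq> i \<longrightarrow> g \<in> L j}) = carrier G"
proof (induction k)
  case 0
  have "carrier G \<lhd> G" by (rule normal_self)
  then obtain L where "subgroup L G" "finite_index G L" "L \<noteq> carrier G"
    using FA finite_index_carrier unfolding has_supplements_def by blast
  moreover have "generate G (carrier G) = carrier G"
    using generate_incl[of "carrier G"] generate.incl[of _ "carrier G" G] by auto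
  ultimately show ?case by (intro exI[of _ "\<lambda>_. L"]) (auto simp: lessThan_Suc)
next
  case (Suc k)
  then obtain L where L: "\<And>i. i < Suc k \<Longrightarrow> subgroup (L i) G" "\<And>i. i < Suc k \<Longrightarrow> finite_index G (L i)"
    "\<And>i. i < Suc k \<Longrightarrow> L i \<noteq> carrier G"
    and gen: "generate G (\<Union>i<Suc k. {g \<in> carrier G. \<forall>j<Suc k. j \<noteq> i \<longrightarrow> g \<in> L j}) = carrier G"
    by blast
  obtain K where K: "K \<lhd> G" "finite_index G K" "\<And>j. j \<in> {..<Suc k} \<Longrightarrow> K \<subseteq> L j"
    using normal_core[of "{..<Suc k}" L] L by auto
  obtain M where M: "subgroup M G" "finite_index G M" "M \<noteq> carrier G" "M <#> K = carrier G"
    using FA K unfolding has_supplements_def by blast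
  define L' where "L' = L(Suc k := M)"
  define D where "D i = {g \<in> carrier G. \<forall>j<Suc k. j \<noteq> i \<longrightarrow> g \<in> L j}" for i
  define D' where "D' i = {g \<in> carrier G. \<forall>j<Suc (Suc k). j \<noteq> i \<longrightarrow> g \<in> L' j}" for i
  have D'c: "(\<Union>i<Suc (Suc k). D' i) \<subseteq> carrier G" by (auto simp: D'_def)
  have "D i \<subseteq> generate G (\<Union>i<Suc (Suc k). D' i)" if i: "i < Suc k" for i
  proof
    fix g assume g: "g \<in> D i"
    then have "g \<in> M <#> K" using M(4) by (auto simp: D_def)
    then obtain m h where mh: "m \<in> M" "h \<in> K" "g = m \<otimes> h" by (auto simp: set_mult_def)
    have c: "m \<in> carrier G" "h \<in> carrier G"
      using mh subgroup.subset[OF M(1)] subgroup.subset[OF normal_imp_subgroup[OF K(1)]] by auto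
    have "h \<in> D' (Suc k)" using c mh(2) K(3) by (auto simp: D'_def L'_def less_Suc_eq)
    moreover have "m \<in> D' i"
    proof -
      have "m \<in> L' j" if j: "j < Suc (Suc k)" "j \<noteq> i" for j
      proof (cases "j = Suc k")
        case False
        then have "j < Suc k" using j by simp
        then have "g \<in> L j" "h \<in> L j" "subgroup (L j) G" using g j mh(2) K(3) L(1) by (auto simp: D_def)
        then have "g \<otimes> inv h \<in> L j" by (simp add: subgroup.m_closed subgroup.m_inv_closed)
        moreover have "g \<otimes> inv h = m" using c mh(3) by (simp add: m_assoc)
        ultimately show ?thesis using False by (simp add: L'_def)
      qed (simp add: L'_def mh)
      then show ?thesis using c by (simp add: D'_def)
    qed
    ultimately have "m \<in> (\<Union>i<Suc (Suc k). D' i)" "h \<in> (\<Union>i<Suc (Suc k). D' i)"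
      using i by (auto intro: UN_I[of i] UN_I[of "Suc k"])
    then have "m \<in> generate G (\<Union>i<Suc (Suc k). D' i)" "h \<in> generate G (\<Union>i<Suc (Suc k). D' i)"
      by (auto intro!: generate.incl simp del: UN_iff)
    then show "g \<in> generate G (\<Union>i<Suc (Suc k). D' i)" unfolding mh(3) by (rule generate.eng)
  qed
  then have "generate G (\<Union>i<Suc k. D i) \<subseteq> generate G (\<Union>i<Suc (Suc k). D' i)"
    by (intro generate_subgroup_incl generate_is_subgroup D'c) auto
  then have "generate G (\<Union>i<Suc (Suc k). D' i) = carrier G"
    using gen generate_incl[OF D'c] unfolding D_def[symmetric] by auto
  moreover have "subgroup (L' i) G \<and> finite_index G (L' i) \<and> L' i \<noteq> carrier G" if "i < Suc (Suc k)" for i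
    using that L M by (cases "i = Suc k") (auto simp: L'_def)
  ultimately show ?case unfolding D'_def by (intro exI[of _ L']) auto
qed

lemma generate_finite_subset:
  assumes "x \<in> generate G A"
  obtains F where "finite F" "F \<subseteq> A" "x \<in> generate G F"
proof -
  have mono: "generate G F \<subseteq> generate G F'" if "F \<subseteq> F'" for F F'
  proof
    fix x assume "x \<in> generate G F"
    then show "x \<in> generate G F'"
      by induction (use that in \<open>auto intro: generate.intros\<close>)
  qed
  have "\<exists>F. finite F \<and> F \<subseteq> A \<and> x \<in> generate G F"
    using assms
  proof induction
    case one
    show ?case by (intro exI[of _ "{}"]) (auto intro: generate.one)
  next
    case (incl h)
    then show ?case by (intro exI[of _ "{h}"]) (auto intro: generate.incl)
  next
    case (inv h)
    then show ?case by (intro exI[of _ "{h}"]) (auto intro: generate.inv)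
  next
    case (eng h1 h2)
    then obtain F1 F2 where F: "finite F1" "F1 \<subseteq> A" "h1 \<in> generate G F1" "finite F2" "F2 \<subseteq> A" "h2 \<in> generate G F2"
      by blast
    have "h1 \<otimes>\<^bsub>G\<^esub> h2 \<in> generate G (F1 \<union> F2)"
      using F mono[of F1 "F1 \<union> F2"] mono[of F2 "F1 \<union> F2"] by (intro generate.eng) auto
    then show ?case using F by (intro exI[of _ "F1 \<union> F2"]) auto
  qed
  then show ?thesis using that by blast
qed

text \<open>\<open>independent_subgroups\<close> produces generating sets that are infinite in
  general, whereas \<open>tau_u\<close> ranges over finite ones.\<close>

lemma (in group) finite_generating_subset:
  assumes "finite S" "generate G S = carrier G" and A: "A \<subseteq> carrier G" "generate G A = carrier G"
  obtains F where "finite F" "F \<subseteq> A" "generate G F = carrier G"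
proof -
  have "\<exists>F. finite F \<and> F \<subseteq> A \<and> s \<in> generate G F" if "s \<in> S" for s
  proof -
    have "s \<in> generate G A" using that assms generate.incl[of s S G] by simp
    then show ?thesis by (rule generate_finite_subset) auto
  qed
  then obtain F where F: "\<And>s. s \<in> S \<Longrightarrow> finite (F s)" "\<And>s. s \<in> S \<Longrightarrow> F s \<subseteq> A" "\<And>s. s \<in> S \<Longrightarrow> s \<in> generate G (F s)"
    by metis
  let ?F = "\<Union>s\<in>S. F s"
  have FA: "?F \<subseteq> A" using F by auto
  have "S \<subseteq> generate G ?F" using F(3) mono_generate[of "F s" ?F for s] by blast
  then have "generate G S \<subseteq> generate G ?F"
    using FA A by (intro generate_subgroup_incl generate_is_subgroup) auto
  then have "generate G ?F = carrier G" using assms(2) generate_incl[of ?F] FA A by auto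
  then show ?thesis using that[of ?F] FA F(1) assms(1) by auto
qed

lemma (in group_hom) pullback_supplement:
  assumes surj: "h ` carrier G = carrier H" and L: "subgroup L H"
    and N: "N \<subseteq> carrier G" "L <#>\<^bsub>H\<^esub> h ` N = carrier H"
  shows "subgroup {g \<in> carrier G. h g \<in> L} G" "{g \<in> carrier G. h g \<in> L} <#>\<^bsub>G\<^esub> N = carrier G"
    "finite_index H L \<Longrightarrow> finite_index G {g \<in> carrier G. h g \<in> L}"
proof -
  let ?L = "{g \<in> carrier G. h g \<in> L}"
  show sub: "subgroup ?L G"
  proof (rule G.subgroupI)
    have "\<one> \<in> ?L" using subgroup.one_closed[OF L] by simp
    then show "?L \<noteq> {}" by blast
  qed (auto simp: subgroup.m_closed[OF L] subgroup.m_inv_closed[OF L])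
  show "?L <#> N = carrier G"
  proof
    show "?L <#> N \<subseteq> carrier G" using N(1) by (intro G.setmult_subset_G) auto
    show "carrier G \<subseteq> ?L <#> N"
    proof
      fix g assume g: "g \<in> carrier G"
      then have "h g \<in> L <#>\<^bsub>H\<^esub> h ` N" using N(2) by simp
      then obtain l n where ln: "l \<in> L" "n \<in> N" "h g = l \<otimes>\<^bsub>H\<^esub> h n" by (auto simp: set_mult_def)
      have lc: "l \<in> carrier H" "n \<in> carrier G" using ln subgroup.subset[OF L] N(1) by auto
      have "h (g \<otimes> inv n) = l" using g lc ln(3) by (simp add: H.m_assoc)
      then have "g \<otimes> inv n \<in> ?L" using g lc ln by simp
      then have "(g \<otimes> inv n) \<otimes> n \<in> ?L <#> N" using ln(2) unfolding set_mult_def by blast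
      moreover have "(g \<otimes> inv n) \<otimes> n = g" using g lc by (simp add: G.m_assoc)
      ultimately show "g \<in> ?L <#> N" by (simp only:)
    qed
  qed
  assume fin: "finite_index H L"
  show "finite_index G ?L"
  proof (rule G.finite_indexI[OF sub])
    show "finite ((\<lambda>g. L #>\<^bsub>H\<^esub> h g) ` carrier G)"
      by (rule finite_subset[OF _ fin]) (auto simp: H.rcosets_image)
    fix a b assume ab: "a \<in> carrier G" "b \<in> carrier G" "L #>\<^bsub>H\<^esub> h a = L #>\<^bsub>H\<^esub> h b"
    then show "a \<otimes> inv b \<in> ?L" using H.coset_eq_iff[OF L, of "h a" "h b"] by simp
  qed
qed

subsection \<open>A Frattini argument\<close>

lemma (in group) inv_cancel_assoc:
  assumes "x \<in> carrier G" "y \<in> carrier G"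
  shows "inv x \<otimes> (x \<otimes> y) = y" "x \<otimes> (inv x \<otimes> y) = y"
  using assms by (simp_all flip: m_assoc)

abbreviation commutator :: "('a, 'b) monoid_scheme \<Rightarrow> 'a \<Rightarrow> 'a \<Rightarrow> 'a" where
  "commutator G x y \<equiv> x \<otimes>\<^bsub>G\<^esub> y \<otimes>\<^bsub>G\<^esub> inv\<^bsub>G\<^esub> x \<otimes>\<^bsub>G\<^esub> inv\<^bsub>G\<^esub> y"

text \<open>Sets of left-normed commutators, not the subgroups of the lower central series:
  nilpotency is only used as containment of these sets in a subgroup, and bare sets commute with
  homomorphisms without any argument about generation.\<close>

primrec iter_comm :: "('a, 'b) monoid_scheme \<Rightarrow> 'a set \<Rightarrow> 'a set \<Rightarrow> nat \<Rightarrow> 'a set" where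
  "iter_comm G N Z 0 = Z"
| "iter_comm G N Z (Suc c) = (\<lambda>(x, y). commutator G x y) ` (iter_comm G N Z c \<times> N)"

lemma iter_comm_mono:
  "Z \<subseteq> Z' \<Longrightarrow> N \<subseteq> N' \<Longrightarrow> iter_comm G N Z c \<subseteq> iter_comm G N' Z' c"
  by (induction c) (simp_all add: image_mono Sigma_mono)

lemma iter_comm_Suc_shift: "iter_comm G N Z (Suc c) = iter_comm G N (iter_comm G N Z 1) c"
proof (induction c)
  case (Suc c)
  have "iter_comm G N Z (Suc (Suc c)) = (\<lambda>(x, y). commutator G x y) ` (iter_comm G N Z (Suc c) \<times> N)"
    by simp
  also have "\<dots> = iter_comm G N (iter_comm G N Z 1) (Suc c)" unfolding Suc by simp
  finally show ?case .
qed simp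

lemma (in group) iter_comm_subgroup:
  assumes "subgroup H G"
  shows "iter_comm G H H c \<subseteq> H"
  by (induction c) (auto intro!: subgroup.m_closed[OF assms] subgroup.m_inv_closed[OF assms])

lemma (in group) iter_comm_consistent:
  assumes "subgroup N G"
  shows "iter_comm (G\<lparr>carrier := N\<rparr>) N N c = iter_comm G N N c"
proof (induction c)
  case (Suc c)
  have "iter_comm G N N c \<subseteq> N" using iter_comm_subgroup[OF assms] .
  then have "commutator (G\<lparr>carrier := N\<rparr>) x y = commutator G x y" if "x \<in> iter_comm G N N c" "y \<in> N" for x y
    using that m_inv_consistent[OF assms] by auto
  then show ?case using Suc by (auto intro!: image_cong)
qed simp

lemma (in group_hom) iter_comm_image:
  assumes "N \<subseteq> carrier G" "Z \<subseteq> carrier G"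
  shows "h ` iter_comm G N Z c = iter_comm H (h ` N) (h ` Z) c"
proof (induction c)
  case (Suc c)
  have sub: "iter_comm G N Z c \<subseteq> carrier G"
    by (induction c) (use assms in \<open>auto simp: subset_iff\<close>)
  have e: "h (commutator G x y) = commutator H (h x) (h y)" if "x \<in> iter_comm G N Z c" "y \<in> N" for x y
    using that sub assms by (auto simp: subset_iff)
  have "h ` iter_comm G N Z (Suc c) = (\<lambda>(x, y). commutator H (h x) (h y)) ` (iter_comm G N Z c \<times> N)"
    unfolding iter_comm.simps image_image by (intro image_cong refl) (use e in auto)
  also have "\<dots> = (\<lambda>(x, y). commutator H x y) ` (h ` iter_comm G N Z c \<times> h ` N)"
    by (auto simp: image_iff)
  also have "\<dots> = iter_comm H (h ` N) (h ` Z) (Suc c)" unfolding Suc by simp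
  finally show ?case .
qed simp

section \<open>Actions of p-groups and Sylow subgroups\<close>

lemma (in group) group_actionI:
  assumes "\<And>g x. g \<in> carrier G \<Longrightarrow> x \<in> E \<Longrightarrow> a g x \<in> E" "\<And>x. x \<in> E \<Longrightarrow> a \<one> x = x"
    and "\<And>g h x. g \<in> carrier G \<Longrightarrow> h \<in> carrier G \<Longrightarrow> x \<in> E \<Longrightarrow> a (g \<otimes> h) x = a g (a h x)"
  shows "group_action G E (\<lambda>g. \<lambda>x\<in>E. a g x)"
proof -
  have bij: "(\<lambda>x\<in>E. a g x) \<in> Bij E" if g: "g \<in> carrier G" for g
  proof -
    have 1: "a (inv g) (a g x) = x" "a g (a (inv g) x) = x" if "x \<in> E" for x
      using assms(2)[OF that] assms(3)[of "inv g" g x] assms(3)[of g "inv g" x] g that by auto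
    have "bij_betw (\<lambda>x\<in>E. a g x) E E"
      by (rule bij_betw_byWitness[where f' = "a (inv g)"]) (use 1 assms(1) g in auto)
    then show ?thesis by (simp add: Bij_def)
  qed
  have "(\<lambda>g. \<lambda>x\<in>E. a g x) \<in> hom G (BijGroup E)"
  proof (rule homI)
    show "(\<lambda>x\<in>E. a g x) \<in> carrier (BijGroup E)" if "g \<in> carrier G" for g
      using bij[OF that] by (simp add: BijGroup_def)
    fix g h assume gh: "g \<in> carrier G" "h \<in> carrier G"
    show "(\<lambda>x\<in>E. a (g \<otimes> h) x) = (\<lambda>x\<in>E. a g x) \<otimes>\<^bsub>BijGroup E\<^esub> (\<lambda>x\<in>E. a h x)"
      using bij gh assms(1,3) by (auto simp: BijGroup_def compose_def restrict_def fun_eq_iff)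
  qed
  then show ?thesis
    unfolding group_action_def group_hom_def group_hom_axioms_def using group_BijGroup by auto
qed

text \<open>An orbit without fixed points has size a power of \<open>p\<close> greater than 1. The
  function \<open>f\<close> marks the points that are not fixed, so that the orbit decomposition
  becomes a sum of multiples of \<open>p\<close>.\<close>

lemma (in group_action) prime_power_fixed_points:
  assumes "prime (p::nat)" "card (carrier G) = p ^ a" "finite E"
  shows "p dvd card E \<longleftrightarrow> p dvd card {x \<in> E. \<forall>g\<in>carrier G. \<phi> g x = x}"
proof -
  let ?F = "{x \<in> E. \<forall>g\<in>carrier G. \<phi> g x = x}"
  define f where "f x = (if x \<in> ?F then 0 else 1 :: nat)" for x
  have "p dvd (\<Sum>x\<in>B. f x)" if B: "B \<in> orbits G E \<phi>" for B
  proof -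
    obtain x where x: "x \<in> E" "B = orbit G \<phi> x" using B by (auto simp: orbits_def)
    have BE: "B \<subseteq> E" using orbits_coverture B by auto
    then have finB: "finite B" using assms(3) finite_subset by blast
    show ?thesis
    proof (cases "\<exists>y\<in>B. y \<in> ?F")
      case True
      then obtain y where y: "y \<in> B" "y \<in> ?F" by blast
      then obtain g where g: "g \<in> carrier G" "y = \<phi> g x" using x by (auto simp: orbit_def)
      have "B = orbit G \<phi> y"
        using disjoint_union[OF B, of "orbit G \<phi> y"] y orbit_refl[of y] by (auto simp: orbits_def)
      moreover have "orbit G \<phi> y = {y}"
      proof -
        have "\<one>\<^bsub>G\<^esub> \<in> carrier G"
          using group_hom by (simp add: group_hom_def group.is_monoid monoid.one_closed)
        then show ?thesis using y by (force simp: orbit_def)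
      qed
      ultimately show ?thesis using y by (simp add: f_def)
    next
      case False
      then have "(\<Sum>x\<in>B. f x) = (\<Sum>x\<in>B. 1)" by (intro sum.cong) (auto simp: f_def)
      then have "(\<Sum>x\<in>B. f x) = card B" by simp
      moreover have "p dvd card B"
      proof -
        have "card B * card (stabilizer G \<phi> x) = p ^ a"
          using orbit_stabilizer_theorem[OF x(1)] x(2) assms(2) by (simp add: Coset.order_def)
        then have "card B dvd p ^ a" by (metis dvd_triv_left)
        then obtain i where i: "card B = p ^ i" using divides_primepow_nat[OF assms(1)] by blast
        have "card B \<noteq> 1"
        proof
          assume "card B = 1"
          then obtain y where y: "B = {y}" by (rule card_1_singletonE)
          have "\<phi> g y = y" if g: "g \<in> carrier G" for g
          proof -
            have "B = orbit G \<phi> y"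
              using disjoint_union[OF B, of "orbit G \<phi> y"] y orbit_refl[of y] BE by (auto simp: orbits_def)
            then show ?thesis using g y by (auto simp: orbit_def)
          qed
          then show False using False y BE by auto
        qed
        then show ?thesis using i by (cases i) auto
      qed
      ultimately show ?thesis by simp
    qed
  qed
  then have "p dvd (\<Sum>B\<in>orbits G E \<phi>. \<Sum>x\<in>B. f x)" by (rule dvd_sum)
  then have 1: "p dvd (\<Sum>x\<in>E. f x)" using disjoint_sum[OF assms(3)] by metis
  have s: "(\<Sum>x\<in>E. f x) + card ?F = card E"
  proof -
    have "card ?F = (\<Sum>x\<in>?F. 1)" by (rule card_eq_sum)
    also have "\<dots> = (\<Sum>x\<in>E. if \<forall>g\<in>carrier G. \<phi> g x = x then 1 else 0)"
      by (rule sum.inter_filter[OF assms(3)])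
    finally have "(\<Sum>x\<in>E. f x) + card ?F =
      (\<Sum>x\<in>E. f x) + (\<Sum>x\<in>E. if \<forall>g\<in>carrier G. \<phi> g x = x then 1 else 0)" by (rule arg_cong)
    also have "\<dots> = (\<Sum>x\<in>E. 1)"
      unfolding sum.distrib[symmetric] by (intro sum.cong) (auto simp: f_def)
    finally show ?thesis by simp
  qed
  show ?thesis using dvd_add_right_iff[OF 1, of "card ?F"] unfolding s .
qed

text \<open>\<open>R\<close> acts on the cosets of \<open>P\<close> by translation. Their number is
  prime to \<open>p\<close>, so some coset \<open>P x\<close> is fixed, which says exactly that
  \<open>x\<close> conjugates \<open>R\<close> into \<open>P\<close>. The inverse in
  \<open>act\<close> turns right translation into a left action.\<close>

lemma (in group) conjugate_into_sylow:
  assumes fin: "finite (carrier G)" and P: "subgroup P G" "\<not> p dvd card (rcosets P)"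
    and R: "subgroup R G" "card R = p ^ a" and p: "prime (p::nat)"
  obtains x where "x \<in> carrier G" "\<And>r. r \<in> R \<Longrightarrow> x \<otimes> r \<otimes> inv x \<in> P"
proof -
  have RG: "R \<subseteq> carrier G" and PG: "P \<subseteq> carrier G" using R P subgroup.subset by auto
  interpret R: group "G\<lparr>carrier := R\<rparr>" using subgroup_imp_group[OF R(1)] .
  define act where "act r C = C #> inv r" for r C
  have Cc: "C \<subseteq> carrier G" if "C \<in> rcosets P" for C
    using that subgroup.rcosets_carrier[OF P(1) group_axioms] by auto
  have "group_action (G\<lparr>carrier := R\<rparr>) (rcosets P) (\<lambda>r. \<lambda>C\<in>rcosets P. act r C)"
  proof (rule R.group_actionI)
    show "act g C \<in> rcosets P" if gC: "g \<in> carrier (G\<lparr>carrier := R\<rparr>)" "C \<in> rcosets P" for g C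
    proof -
      obtain h where h: "h \<in> carrier G" "C = P #> h" using gC by (auto simp: RCOSETS_def)
      have "act g C = P #> (h \<otimes> inv g)"
        using gC RG PG h by (auto simp: act_def coset_mult_assoc)
      then show ?thesis using gC RG PG h by (auto intro!: rcosetsI)
    qed
    show "act \<one>\<^bsub>G\<lparr>carrier := R\<rparr>\<^esub> C = C" if "C \<in> rcosets P" for C
      using Cc[OF that] by (simp add: act_def)
    show "act (g \<otimes>\<^bsub>G\<lparr>carrier := R\<rparr>\<^esub> h) C = act g (act h C)"
      if "g \<in> carrier (G\<lparr>carrier := R\<rparr>)" "h \<in> carrier (G\<lparr>carrier := R\<rparr>)" "C \<in> rcosets P" for g h C
      using that RG Cc[OF that(3)] by (auto simp: act_def coset_mult_assoc inv_mult_group subset_iff)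
  qed
  then interpret A: group_action "G\<lparr>carrier := R\<rparr>" "rcosets P" "\<lambda>r. \<lambda>C\<in>rcosets P. act r C" .
  have "finite (rcosets P)" using fin by (simp add: RCOSETS_def)
  then have "\<not> p dvd card {C \<in> rcosets P. \<forall>g\<in>R. (\<lambda>C\<in>rcosets P. act g C) C = C}"
    using A.prime_power_fixed_points[OF p] P(2) R(2) by simp
  then have "{C \<in> rcosets P. \<forall>g\<in>R. (\<lambda>C\<in>rcosets P. act g C) C = C} \<noteq> {}" by (metis card.empty dvd_0_right)
  then obtain C where C: "C \<in> rcosets P" "\<And>g. g \<in> R \<Longrightarrow> C #> inv g = C" by (auto simp: act_def)
  obtain x where x: "x \<in> carrier G" "C = P #> x" using C(1) by (auto simp: RCOSETS_def)
  have "x \<otimes> r \<otimes> inv x \<in> P" if r: "r \<in> R" for r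
  proof -
    have rc: "r \<in> carrier G" "inv r \<in> R" using r RG subgroup.m_inv_closed[OF R(1)] by auto
    then have "P #> (x \<otimes> r) = P #> x" using C(2)[of "inv r"] x PG by (simp add: coset_mult_assoc)
    then show ?thesis using coset_eq_iff[OF P(1)] x rc by simp
  qed
  then show ?thesis using that x by blast
qed

lemma (in group) subgroup_card_dvd:
  assumes "subgroup H G"
  shows "card H dvd card (carrier G)" "card (rcosets H) * card H = card (carrier G)"
proof -
  show "card (rcosets H) * card H = card (carrier G)" using lagrange[OF assms] by (simp add: Coset.order_def)
  then show "card H dvd card (carrier G)" by (metis dvd_triv_right)
qed

text \<open>The Frattini argument: all conjugates of a Sylow subgroup \<open>P\<close> of
  \<open>N\<close> lie in \<open>N\<close> and are conjugate to \<open>P\<close> already under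
  \<open>N\<close>, so the normalizer \<open>L\<close> of \<open>P\<close> supplements
  \<open>N\<close>. By assumption it is then the whole group.\<close>

lemma (in group) frattini_sylow_normal:
  assumes fin: "finite (carrier G)" and N: "N \<lhd> G"
    and frat: "\<And>L. subgroup L G \<Longrightarrow> L <#> N = carrier G \<Longrightarrow> L = carrier G"
    and p: "prime (p::nat)"
  obtains P where "subgroup P G" "P \<subseteq> N" "card P = p ^ multiplicity p (card N)"
    "\<And>g h. g \<in> carrier G \<Longrightarrow> h \<in> P \<Longrightarrow> g \<otimes> h \<otimes> inv g \<in> P"
proof -
  have Ns: "subgroup N G" using N by (rule normal_imp_subgroup)
  have NG: "N \<subseteq> carrier G" using subgroup.subset[OF Ns] .
  have finN: "finite N" using NG fin finite_subset by blast
  interpret N: group "G\<lparr>carrier := N\<rparr>" using subgroup_imp_group[OF Ns] .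
  define a where "a = multiplicity p (card N)"
  have "card N \<noteq> 0" using finN subgroup.one_closed[OF Ns] by auto
  have Nne: "\<not> is_unit p" using prime_gt_1_nat[OF p] by simp
  obtain m where m: "card N = p ^ a * m" "\<not> p dvd m"
    using multiplicity_decompose'[of "card N" p] \<open>card N \<noteq> 0\<close> Nne by (auto simp: a_def)
  have "\<exists>P. subgroup P (G\<lparr>carrier := N\<rparr>) \<and> card P = p ^ a"
    by (rule sylow_thm[OF p N.group_axioms, of a m]) (use m finN in \<open>auto simp: Coset.order_def\<close>)
  then obtain P where P: "subgroup P (G\<lparr>carrier := N\<rparr>)" "card P = p ^ a" by blast
  have PN: "P \<subseteq> N" using subgroup.subset[OF P(1)] by simp
  have PG: "subgroup P G" using incl_subgroup[OF Ns P(1)] .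
  have finP: "finite P" using PN finN finite_subset by blast
  have idx: "\<not> p dvd card (rcosets\<^bsub>G\<lparr>carrier := N\<rparr>\<^esub> P)"
  proof -
    have "card (rcosets\<^bsub>G\<lparr>carrier := N\<rparr>\<^esub> P) * p ^ a = p ^ a * m"
      using N.subgroup_card_dvd(2)[OF P(1)] P(2) m by simp
    then have "card (rcosets\<^bsub>G\<lparr>carrier := N\<rparr>\<^esub> P) = m" using prime_gt_0_nat[OF p] by (simp add: mult.commute)
    then show ?thesis using m by simp
  qed
  define cj where "cj g = (\<lambda>h. g \<otimes> h \<otimes> inv g) ` P" for g
  have inj: "inj_on (\<lambda>h. g \<otimes> h \<otimes> inv g) P" if "g \<in> carrier G" for g
    using that PN NG by (auto simp: inj_on_def subset_iff)
  define L where "L = {g \<in> carrier G. cj g = P}"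
  have cjm: "cj (g \<otimes> h) = (\<lambda>x. g \<otimes> x \<otimes> inv g) ` cj h" if "g \<in> carrier G" "h \<in> carrier G" for g h
    unfolding cj_def image_image using that PN NG
    by (intro image_cong refl) (auto simp: subset_iff m_assoc inv_mult_group)
  have L: "subgroup L G"
  proof (rule subgroupI)
    have one: "cj \<one> = P" using PN NG by (auto simp: cj_def subset_iff image_def)
    then show "L \<noteq> {}" by (auto simp: L_def)
    fix g assume g: "g \<in> L"
    then have gc: "g \<in> carrier G" "cj g = P" by (auto simp: L_def)
    have "cj (inv g) = (\<lambda>x. inv g \<otimes> x \<otimes> inv (inv g)) ` cj g" unfolding gc(2) by (simp add: cj_def)
    also have "\<dots> = cj (inv g \<otimes> g)" by (rule cjm[symmetric]) (use gc in auto)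
    finally show "inv g \<in> L" using gc one by (simp add: L_def)
    fix h assume h: "h \<in> L"
    then have hc: "h \<in> carrier G" "cj h = P" by (auto simp: L_def)
    have "cj (g \<otimes> h) = cj g" using cjm[OF gc(1) hc(1)] hc(2) by (simp add: cj_def)
    then show "g \<otimes> h \<in> L" using gc hc by (simp add: L_def)
  qed (auto simp: L_def)
  have "carrier G \<subseteq> L <#> N"
  proof
    fix g assume g: "g \<in> carrier G"
    have cg: "cj g \<subseteq> N"
      using normal.inv_op_closed2[OF N g] PN by (auto simp: cj_def)
    have sub: "subgroup (cj g) (G\<lparr>carrier := N\<rparr>)"
    proof (rule N.subgroupI)
      show "cj g \<subseteq> carrier (G\<lparr>carrier := N\<rparr>)" using cg by simp
      show "cj g \<noteq> {}" using subgroup.one_closed[OF PG] by (auto simp: cj_def)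
      fix x assume x: "x \<in> cj g"
      then obtain h where h: "h \<in> P" "x = g \<otimes> h \<otimes> inv g" by (auto simp: cj_def)
      have hc: "h \<in> carrier G" using h PN NG by auto
      have "inv\<^bsub>G\<lparr>carrier := N\<rparr>\<^esub> x = inv x" using m_inv_consistent[OF Ns] x cg by auto
      also have "\<dots> = g \<otimes> inv h \<otimes> inv g" using h g hc by (simp add: inv_mult_group m_assoc)
      finally show "inv\<^bsub>G\<lparr>carrier := N\<rparr>\<^esub> x \<in> cj g"
        using subgroup.m_inv_closed[OF PG h(1)] by (auto simp: cj_def)
      fix y assume y: "y \<in> cj g"
      then obtain k where k: "k \<in> P" "y = g \<otimes> k \<otimes> inv g" by (auto simp: cj_def)
      have kc: "k \<in> carrier G" using k PN NG by auto
      have "x \<otimes> y = g \<otimes> (h \<otimes> k) \<otimes> inv g"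
        using h k g hc kc by (simp add: m_assoc inv_cancel_assoc)
      then show "x \<otimes>\<^bsub>G\<lparr>carrier := N\<rparr>\<^esub> y \<in> cj g"
        using subgroup.m_closed[OF PG h(1) k(1)] by (auto simp: cj_def)
    qed
    have card_cg: "card (cj g) = p ^ a" using card_image[OF inj[OF g]] P(2) by (simp add: cj_def)
    obtain n where n: "n \<in> N" "\<And>r. r \<in> cj g \<Longrightarrow> n \<otimes> r \<otimes> inv n \<in> P"
    proof -
      obtain n where "n \<in> carrier (G\<lparr>carrier := N\<rparr>)"
        "\<And>r. r \<in> cj g \<Longrightarrow> n \<otimes>\<^bsub>G\<lparr>carrier := N\<rparr>\<^esub> r \<otimes>\<^bsub>G\<lparr>carrier := N\<rparr>\<^esub> inv\<^bsub>G\<lparr>carrier := N\<rparr>\<^esub> n \<in> P"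
        by (rule N.conjugate_into_sylow[OF _ P(1) idx sub card_cg p]) (use finN in auto)
      then show ?thesis using that m_inv_consistent[OF Ns] by simp
    qed
    have nc: "n \<in> carrier G" using n NG by auto
    have "cj (n \<otimes> g) \<subseteq> P" using n(2) cjm[OF nc g] by auto
    moreover have "card (cj (n \<otimes> g)) = card P" unfolding cj_def using inj nc g by (intro card_image) auto
    ultimately have "cj (n \<otimes> g) = P" using finP by (simp add: card_subset_eq)
    then have ng: "n \<otimes> g \<in> L" using nc g by (simp add: L_def)
    \<comment> \<open>The natural factorisation \<open>g = inv n (n g)\<close> has its factor from
      \<open>N\<close> on the left; conjugating that factor by \<open>n g\<close> moves it to the
      right.\<close>
    define w where "w = inv (n \<otimes> g) \<otimes> inv n \<otimes> (n \<otimes> g)"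
    have wN: "w \<in> N" unfolding w_def
      using normal.inv_op_closed1[OF N, of "n \<otimes> g" "inv n"] nc g n(1) subgroup.m_inv_closed[OF Ns] by auto
    have eq: "(n \<otimes> g) \<otimes> w = g" unfolding w_def using nc g by (simp add: m_assoc[symmetric])
    have "(n \<otimes> g) \<otimes> w \<in> L <#> N" using ng wN unfolding set_mult_def by blast
    then show "g \<in> L <#> N" by (simp only: eq)
  qed
  moreover have "L <#> N \<subseteq> carrier G" using setmult_subset_G subgroup.subset[OF L] NG by simp
  ultimately have "L = carrier G" using frat[OF L] by blast
  then have "g \<otimes> h \<otimes> inv g \<in> P" if "g \<in> carrier G" "h \<in> P" for g h
    using that by (auto simp: L_def cj_def)
  then show ?thesis using that[of P] PG PN P(2) by (simp add: a_def)
qed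

section \<open>Nilpotency from normal Sylow subgroups\<close>

lemma (in group) commutator_mem_iff:
  assumes "Z \<lhd> G" "x \<in> carrier G" "y \<in> carrier G"
  shows "commutator G x y \<in> Z \<longleftrightarrow> Z #> (x \<otimes> y) = Z #> (y \<otimes> x)"
  using coset_eq_iff[OF normal_imp_subgroup[OF assms(1)], of "x \<otimes> y" "y \<otimes> x"] assms
  by (simp add: inv_mult_group m_assoc)

text \<open>\<open>G/Z\<close> has a nontrivial central element. If \<open>p\<close> divides its
  order, the Sylow subgroup \<open>P\<close> is not inside \<open>Z\<close>, and some
  \<open>x\<close> in \<open>P\<close> outside \<open>Z\<close> commutes with \<open>P\<close>
  modulo \<open>Z\<close>. For another prime, commutators of \<open>x\<close> with the Sylow
  subgroup \<open>R\<close> lie in both \<open>P\<close> and \<open>R\<close> by normality, hence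
  are trivial.\<close>

lemma (in group) normal_sylows_central_step:
  assumes fin: "finite (carrier G)"
    and syl: "\<And>p::nat. prime p \<Longrightarrow> \<exists>P. P \<lhd> G \<and> card P = p ^ multiplicity p (card (carrier G))"
    and Z: "Z \<lhd> G" "Z \<noteq> carrier G"
  obtains x where "x \<in> carrier G" "x \<notin> Z" "\<And>y. y \<in> carrier G \<Longrightarrow> commutator G x y \<in> Z"
proof -
  have Zs: "subgroup Z G" using Z by (simp add: normal_imp_subgroup)
  have ZG: "Z \<subseteq> carrier G" using subgroup.subset[OF Zs] .
  have G0: "card (carrier G) \<noteq> 0" using fin by auto
  have idx: "card (rcosets Z) * card Z = card (carrier G)" using subgroup_card_dvd(2)[OF Zs] .
  have "card (rcosets Z) \<noteq> 1"
    using idx Z ZG fin card_subset_eq[OF fin ZG] by auto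
  then obtain p where p: "prime p" "p dvd card (rcosets Z)" using prime_factor_nat by blast
  obtain P where P: "P \<lhd> G" "card P = p ^ multiplicity p (card (carrier G))" using syl[OF p(1)] by blast
  have Ps: "subgroup P G" using P by (simp add: normal_imp_subgroup)
  have PG: "P \<subseteq> carrier G" using subgroup.subset[OF Ps] .
  have finP: "finite P" using PG fin finite_subset by blast
  have "\<not> P \<subseteq> Z"
  proof
    assume PZ: "P \<subseteq> Z"
    interpret Z: group "G\<lparr>carrier := Z\<rparr>" using subgroup_imp_group[OF Zs] .
    have "subgroup P (G\<lparr>carrier := Z\<rparr>)" using subgroup_incl[OF Ps Zs PZ] .
    then have "card P dvd card Z" using Z.subgroup_card_dvd(1) by auto
    then have "p * card P dvd card (carrier G)" unfolding idx[symmetric] using p(2) by (rule mult_dvd_mono[rotated])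
    then have "p ^ Suc (multiplicity p (card (carrier G))) dvd card (carrier G)" by (simp add: P)
    moreover have "\<not> is_unit p" using prime_gt_1_nat[OF p(1)] by simp
    ultimately show False using power_dvd_iff_le_multiplicity[OF G0, of p "Suc (multiplicity p (card (carrier G)))"]
      by (simp del: power_Suc)
  qed
  interpret PP: group "G\<lparr>carrier := P\<rparr>" using subgroup_imp_group[OF Ps] .
  define E where "E = (\<lambda>x. Z #> x) ` P"
  have finE: "finite E" using finP by (simp add: E_def)
  text \<open>\<open>P\<close> acts on its image \<open>E\<close> in \<open>G/Z\<close> by translation, which shows that \<open>p\<close> divides \<open>|E|\<close>,
    and by conjugation, which then has a fixed point other than \<open>Z\<close>.\<close>
  have "group_action (G\<lparr>carrier := P\<rparr>) E (\<lambda>g. \<lambda>C\<in>E. C #> inv g)"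
  proof (rule PP.group_actionI)
    show "C #> inv g \<in> E" if gC: "g \<in> carrier (G\<lparr>carrier := P\<rparr>)" "C \<in> E" for g C
    proof -
      obtain h where h: "h \<in> P" "C = Z #> h" using gC by (auto simp: E_def)
      have "C #> inv g = Z #> (h \<otimes> inv g)" using gC PG ZG h by (auto simp: coset_mult_assoc subset_iff)
      moreover have "h \<otimes> inv g \<in> P"
        using h gC subgroup.m_closed[OF Ps] subgroup.m_inv_closed[OF Ps] by simp
      ultimately show ?thesis by (auto simp: E_def)
    qed
    have Cc: "C \<subseteq> carrier G" if "C \<in> E" for C
      using that PG r_coset_subset_G[OF ZG] by (auto simp: E_def subset_iff)
    show "C #> inv \<one>\<^bsub>G\<lparr>carrier := P\<rparr>\<^esub> = C" if "C \<in> E" for C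
      using Cc[OF that] by simp
    show "C #> inv (g \<otimes>\<^bsub>G\<lparr>carrier := P\<rparr>\<^esub> h) = C #> inv h #> inv g"
      if "g \<in> carrier (G\<lparr>carrier := P\<rparr>)" "h \<in> carrier (G\<lparr>carrier := P\<rparr>)" "C \<in> E" for g h C
      using that PG Cc[OF that(3)] by (auto simp: coset_mult_assoc inv_mult_group subset_iff)
  qed
  then interpret T: group_action "G\<lparr>carrier := P\<rparr>" E "\<lambda>g. \<lambda>C\<in>E. C #> inv g" .
  have ZE: "Z \<in> E"
    unfolding E_def by (rule image_eqI[of _ _ \<one>]) (use ZG subgroup.one_closed[OF Ps] in auto)
  have "orbit (G\<lparr>carrier := P\<rparr>) (\<lambda>g. \<lambda>C\<in>E. C #> inv g) Z = E"
  proof -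
    have "E \<subseteq> (\<lambda>g. Z #> inv g) ` P"
    proof
      fix C assume "C \<in> E"
      then obtain h where h: "h \<in> P" "C = Z #> h" by (auto simp: E_def)
      then have "C = Z #> inv (inv h)" using PG by auto
      then show "C \<in> (\<lambda>g. Z #> inv g) ` P" using subgroup.m_inv_closed[OF Ps h(1)] by blast
    qed
    moreover have "(\<lambda>g. Z #> inv g) ` P \<subseteq> E" using subgroup.m_inv_closed[OF Ps] by (auto simp: E_def)
    ultimately show ?thesis using ZE by (auto simp: orbit_def)
  qed
  then have "card E * card (stabilizer (G\<lparr>carrier := P\<rparr>) (\<lambda>g. \<lambda>C\<in>E. C #> inv g) Z) = card P"
    using T.orbit_stabilizer_theorem[OF ZE] by (simp add: Coset.order_def)
  then have "card E dvd p ^ multiplicity p (card (carrier G))" using P(2) by (metis dvd_triv_left)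
  then obtain i where i: "card E = p ^ i" using divides_primepow_nat[OF p(1)] by blast
  have "card E \<noteq> 1"
  proof
    assume "card E = 1"
    then obtain D where "E = {D}" by (rule card_1_singletonE)
    then have EZ: "E = {Z}" using ZE by simp
    obtain h where h: "h \<in> P" "h \<notin> Z" using \<open>\<not> P \<subseteq> Z\<close> by blast
    have "Z #> h \<in> E" using h by (auto simp: E_def)
    then have "Z #> h = Z" using EZ by simp
    then show False using h coset_join1[OF _ _ Zs] PG by auto
  qed
  then have pE: "p dvd card E" using i by (cases i) auto
  define cj where "cj g C = (\<lambda>x. g \<otimes> x \<otimes> inv g) ` C" for g C
  have cj: "cj g (Z #> h) = Z #> (g \<otimes> h \<otimes> inv g)" if gh: "g \<in> carrier G" "h \<in> carrier G" for g h
  proof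
    show "cj g (Z #> h) \<subseteq> Z #> (g \<otimes> h \<otimes> inv g)"
    proof
      fix w assume "w \<in> cj g (Z #> h)"
      then obtain z where z: "z \<in> Z" "w = g \<otimes> (z \<otimes> h) \<otimes> inv g" by (auto simp: cj_def r_coset_def)
      have zc: "z \<in> carrier G" using z ZG by auto
      have "w = (g \<otimes> z \<otimes> inv g) \<otimes> (g \<otimes> h \<otimes> inv g)" using z gh zc by (simp add: m_assoc inv_cancel_assoc)
      then show "w \<in> Z #> (g \<otimes> h \<otimes> inv g)"
        using normal.inv_op_closed2[OF Z(1) gh(1) z(1)] by (auto simp: r_coset_def)
    qed
    show "Z #> (g \<otimes> h \<otimes> inv g) \<subseteq> cj g (Z #> h)"
    proof
      fix w assume "w \<in> Z #> (g \<otimes> h \<otimes> inv g)"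
      then obtain z where z: "z \<in> Z" "w = z \<otimes> (g \<otimes> h \<otimes> inv g)" by (auto simp: r_coset_def)
      have zc: "z \<in> carrier G" using z ZG by auto
      have "w = g \<otimes> ((inv g \<otimes> z \<otimes> g) \<otimes> h) \<otimes> inv g" using z gh zc by (simp add: m_assoc inv_cancel_assoc)
      moreover have "(inv g \<otimes> z \<otimes> g) \<otimes> h \<in> Z #> h"
        using normal.inv_op_closed1[OF Z(1) gh(1) z(1)] by (auto simp: r_coset_def)
      ultimately show "w \<in> cj g (Z #> h)" unfolding cj_def by (rule image_eqI)
    qed
  qed
  have "group_action (G\<lparr>carrier := P\<rparr>) E (\<lambda>g. \<lambda>C\<in>E. cj g C)"
  proof (rule PP.group_actionI)
    show "cj g C \<in> E" if gC: "g \<in> carrier (G\<lparr>carrier := P\<rparr>)" "C \<in> E" for g C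
    proof -
      obtain h where h: "h \<in> P" "C = Z #> h" using gC by (auto simp: E_def)
      have "cj g C = Z #> (g \<otimes> h \<otimes> inv g)" using gC PG h cj[of g h] by auto
      moreover have "g \<otimes> h \<otimes> inv g \<in> P"
        using h gC subgroup.m_closed[OF Ps] subgroup.m_inv_closed[OF Ps] by simp
      ultimately show ?thesis by (auto simp: E_def)
    qed
    have Cc: "C \<subseteq> carrier G" if "C \<in> E" for C
      using that PG r_coset_subset_G[OF ZG] by (auto simp: E_def subset_iff)
    show "cj \<one>\<^bsub>G\<lparr>carrier := P\<rparr>\<^esub> C = C" if "C \<in> E" for C
      using Cc[OF that] by (force simp: cj_def subset_iff)
    show "cj (g \<otimes>\<^bsub>G\<lparr>carrier := P\<rparr>\<^esub> h) C = cj g (cj h C)"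
      if gh: "g \<in> carrier (G\<lparr>carrier := P\<rparr>)" "h \<in> carrier (G\<lparr>carrier := P\<rparr>)" "C \<in> E" for g h C
      unfolding cj_def image_image using gh PG Cc[OF gh(3)]
      by (intro image_cong refl) (auto simp: m_assoc inv_mult_group subset_iff)
  qed
  then interpret C: group_action "G\<lparr>carrier := P\<rparr>" E "\<lambda>g. \<lambda>C\<in>E. cj g C" .
  let ?F = "{C \<in> E. \<forall>g\<in>P. (\<lambda>C\<in>E. cj g C) C = C}"
  have pF: "p dvd card ?F" using C.prime_power_fixed_points[OF p(1) _ finE] pE P(2) by simp
  have ZF: "Z \<in> ?F"
  proof -
    have "cj g Z = Z" if "g \<in> P" for g using cj[of g \<one>] that PG ZG by auto
    then show ?thesis using ZE by simp
  qed
  have "?F \<noteq> {Z}"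
  proof
    assume "?F = {Z}"
    then have "card ?F = card {Z}" by (rule arg_cong)
    then show False using pF p(1) by (simp del: mem_Collect_eq)
  qed
  then have "\<exists>C\<in>?F. C \<noteq> Z" using ZF by blast
  then obtain C where CF: "C \<in> ?F" "C \<noteq> Z" by blast
  then have C: "C \<in> E" "C \<noteq> Z" "\<And>g. g \<in> P \<Longrightarrow> cj g C = C" by auto
  obtain x where x: "x \<in> P" "C = Z #> x" using C(1) by (auto simp: E_def)
  have xc: "x \<in> carrier G" using x PG by auto
  have xZ: "x \<notin> Z" using x C(2) coset_join2[OF xc Zs] by auto
  \<comment> \<open>The centralizer of \<open>x\<close> modulo \<open>Z\<close>. It turns out to
    contain a Sylow subgroup for every prime, so its order is a multiple of the group order.\<close>
  define B where "B = {y \<in> carrier G. commutator G x y \<in> Z}"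
  have Beq: "y \<in> B \<longleftrightarrow> Z #> (x \<otimes> y) = Z #> (y \<otimes> x)" if "y \<in> carrier G" for y
    using commutator_mem_iff[OF Z(1) xc that] that by (simp add: B_def)
  have hom: "Z #> (g \<otimes> h) = (Z #> g) <#> (Z #> h)" if "g \<in> carrier G" "h \<in> carrier G" for g h
    using normal.rcos_sum[OF Z(1) that] by simp
  have Bs: "subgroup B G"
  proof (rule subgroupI)
    show "B \<subseteq> carrier G" by (auto simp: B_def)
    have "\<one> \<in> B" using subgroup.one_closed[OF Zs] xc by (simp add: B_def)
    then show "B \<noteq> {}" by blast
    fix a assume a: "a \<in> B"
    then have ac: "a \<in> carrier G" "Z #> (x \<otimes> a) = Z #> (a \<otimes> x)" using Beq by (auto simp: B_def)
    have "Z #> (x \<otimes> inv a) = Z #> (inv a \<otimes> ((a \<otimes> x) \<otimes> inv a))" using ac xc by (simp add: m_assoc[symmetric])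
    also have "\<dots> = Z #> (inv a \<otimes> ((x \<otimes> a) \<otimes> inv a))" using ac xc hom by simp
    also have "\<dots> = Z #> (inv a \<otimes> x)" using ac xc by (simp add: m_assoc)
    finally have "Z #> (x \<otimes> inv a) = Z #> (inv a \<otimes> x)" .
    then show "inv a \<in> B" using Beq ac by simp
    fix b assume b: "b \<in> B"
    then have bc: "b \<in> carrier G" "Z #> (x \<otimes> b) = Z #> (b \<otimes> x)" using Beq by (auto simp: B_def)
    have "Z #> (x \<otimes> (a \<otimes> b)) = Z #> ((x \<otimes> a) \<otimes> b)" using ac bc xc by (simp add: m_assoc)
    also have "\<dots> = Z #> ((a \<otimes> x) \<otimes> b)" using ac bc xc hom by simp
    also have "\<dots> = Z #> (a \<otimes> (x \<otimes> b))" using ac bc xc by (simp add: m_assoc)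
    also have "\<dots> = Z #> (a \<otimes> (b \<otimes> x))" using ac bc xc hom by simp
    also have "\<dots> = Z #> ((a \<otimes> b) \<otimes> x)" using ac bc xc by (simp add: m_assoc)
    finally show "a \<otimes> b \<in> B" using Beq ac bc by simp
  qed
  have sylB: "q ^ multiplicity q (card (carrier G)) dvd card B" if q: "prime q" for q
  proof -
    \<comment> \<open>The assumption \<open>syl\<close> grants only some Sylow subgroup; for
      \<open>q = p\<close> it has to be the \<open>P\<close> from which \<open>x\<close> was
      taken.\<close>
    have "\<exists>R. R \<lhd> G \<and> card R = q ^ multiplicity q (card (carrier G)) \<and> (q = p \<longrightarrow> R = P)"
      using syl[OF q] P by (cases "q = p") auto
    then obtain R where R: "R \<lhd> G" "card R = q ^ multiplicity q (card (carrier G))" "q = p \<Longrightarrow> R = P"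
      by blast
    have Rs: "subgroup R G" using R by (simp add: normal_imp_subgroup)
    have RG: "R \<subseteq> carrier G" using subgroup.subset[OF Rs] .
    have "R \<subseteq> B"
    proof
      fix y assume y: "y \<in> R"
      have yc: "y \<in> carrier G" using y RG by auto
      show "y \<in> B"
      proof (cases "q = p")
        case True
        then have "cj y (Z #> x) = Z #> x" using R(3) y C(3) x by auto
        then have "Z #> (y \<otimes> x \<otimes> inv y) = Z #> x" using cj[OF yc xc] by simp
        then have "Z #> (y \<otimes> x \<otimes> inv y) <#> (Z #> y) = (Z #> x) <#> (Z #> y)" by simp
        then have "Z #> (y \<otimes> x \<otimes> inv y \<otimes> y) = Z #> (x \<otimes> y)" using hom yc xc by simp
        then show ?thesis using Beq[OF yc] yc xc by (simp add: m_assoc)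
      next
        case False
        have "commutator G x y = x \<otimes> (y \<otimes> inv x \<otimes> inv y)" using xc yc by (simp add: m_assoc)
        moreover have "x \<otimes> (y \<otimes> inv x \<otimes> inv y) \<in> P"
          using normal.inv_op_closed2[OF P(1) yc] x(1) subgroup.m_inv_closed[OF Ps] subgroup.m_closed[OF Ps] by blast
        moreover have "commutator G x y \<in> R"
          using normal.inv_op_closed2[OF R(1) xc y] subgroup.m_inv_closed[OF Rs y] subgroup.m_closed[OF Rs] by blast
        moreover have "P \<inter> R = {\<one>}"
        proof -
          have PR: "subgroup (P \<inter> R) G" using subgroups_Inter_pair[OF Ps Rs] .
          interpret RR: group "G\<lparr>carrier := R\<rparr>" using subgroup_imp_group[OF Rs] .
          have "card (P \<inter> R) dvd card P"
            using PP.subgroup_card_dvd(1)[OF subgroup_incl[OF PR Ps]] by auto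
          moreover have "card (P \<inter> R) dvd card R"
            using RR.subgroup_card_dvd(1)[OF subgroup_incl[OF PR Rs]] by auto
          moreover have "coprime (card P) (card R)" unfolding P(2) R(2)
            using False p(1) q by (simp add: primes_coprime)
          ultimately have "card (P \<inter> R) = 1" using coprime_common_divisor[of "card P" "card R" "card (P \<inter> R)"] by simp
          then obtain w where "P \<inter> R = {w}" by (rule card_1_singletonE)
          then show ?thesis using subgroup.one_closed[OF PR] by simp
        qed
        ultimately have "commutator G x y = \<one>" by auto
        then show ?thesis using subgroup.one_closed[OF Zs] yc by (simp add: B_def)
      qed
    qed
    then have RB: "subgroup R (G\<lparr>carrier := B\<rparr>)" by (rule subgroup_incl[OF Rs Bs])
    interpret BB: group "G\<lparr>carrier := B\<rparr>" using subgroup_imp_group[OF Bs] .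
    show ?thesis using BB.subgroup_card_dvd(1)[OF RB] R(2) by simp
  qed
  have finB: "finite B" using fin by (auto simp: B_def)
  have B0: "card B \<noteq> 0" using finB subgroup.one_closed[OF Bs] by auto
  have "card (carrier G) dvd card B"
  proof (rule multiplicity_le_imp_dvd)
    show "card (carrier G) \<noteq> 0" using G0 .
    show "multiplicity q (card (carrier G)) \<le> multiplicity q (card B)" if "prime q" for q
      using sylB[OF that] power_dvd_iff_le_multiplicity[OF B0] prime_gt_1_nat[OF that] by simp
  qed
  then have "card (carrier G) \<le> card B" using B0 by (simp add: dvd_imp_le)
  then have "B = carrier G" using fin by (intro card_seteq) (auto simp: B_def)
  then show ?thesis using that[of x] xc xZ by (auto simp: B_def)
qed

text \<open>This climbs the upper central series: among the normal subgroups killed by some iterated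
  commutator take a largest one, \<open>Z\<close>. The preimage \<open>W\<close> of the centre of
  \<open>G/Z\<close> is killed one step later and is strictly larger unless \<open>Z\<close> is
  everything.\<close>

lemma (in group) normal_sylows_nilpotent:
  assumes fin: "finite (carrier G)"
    and syl: "\<And>p::nat. prime p \<Longrightarrow> \<exists>P. P \<lhd> G \<and> card P = p ^ multiplicity p (card (carrier G))"
  shows "\<exists>c. iter_comm G (carrier G) (carrier G) c \<subseteq> {\<one>}"
proof -
  define good where "good Z \<longleftrightarrow> Z \<lhd> G \<and> (\<exists>c. iter_comm G (carrier G) Z c \<subseteq> {\<one>})" for Z
  have "iter_comm G (carrier G) {\<one>} 0 \<subseteq> {\<one>}" by simp
  then have "good {\<one>}" unfolding good_def using one_is_normal by blast
  moreover have "card Z \<le> card (carrier G)" if "good Z" for Z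
    using that subgroup.subset[OF normal_imp_subgroup] fin by (auto simp: good_def intro: card_mono)
  ultimately obtain Z where Z: "good Z" and max: "\<And>Z'. good Z' \<Longrightarrow> card Z' \<le> card Z"
    using ex_has_greatest_nat[of good "{\<one>}" card "Suc (card (carrier G))"] by (auto simp: le_imp_less_Suc less_Suc_eq_le)
  have Zn: "Z \<lhd> G" using Z by (simp add: good_def)
  have Zs: "subgroup Z G" using Zn by (rule normal_imp_subgroup)
  have ZG: "Z \<subseteq> carrier G" using subgroup.subset[OF Zs] .
  have "Z = carrier G"
  proof (rule ccontr)
    assume "Z \<noteq> carrier G"
    then obtain x where x: "x \<in> carrier G" "x \<notin> Z" "\<And>y. y \<in> carrier G \<Longrightarrow> commutator G x y \<in> Z"
      using normal_sylows_central_step[OF fin syl Zn] by blast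
    define W where "W = {x \<in> carrier G. \<forall>y\<in>carrier G. commutator G x y \<in> Z}"
    have Weq: "a \<in> W \<longleftrightarrow> (\<forall>y\<in>carrier G. Z #> (a \<otimes> y) = Z #> (y \<otimes> a))" if "a \<in> carrier G" for a
      using commutator_mem_iff[OF Zn that] that by (auto simp: W_def)
    have hom: "Z #> (g \<otimes> h) = (Z #> g) <#> (Z #> h)" if "g \<in> carrier G" "h \<in> carrier G" for g h
      using normal.rcos_sum[OF Zn that] by simp
    have WG: "W \<subseteq> carrier G" by (auto simp: W_def)
    have Ws: "subgroup W G"
    proof (rule subgroupI[OF WG])
      have "\<one> \<in> W" using Weq[of \<one>] by simp
      then show "W \<noteq> {}" by blast
      fix a assume a: "a \<in> W"
      then have ac: "a \<in> carrier G" "\<And>y. y \<in> carrier G \<Longrightarrow> Z #> (a \<otimes> y) = Z #> (y \<otimes> a)"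
        using Weq WG by auto
      have "Z #> (inv a \<otimes> y) = Z #> (y \<otimes> inv a)" if y: "y \<in> carrier G" for y
      proof -
        have "Z #> (inv a \<otimes> y) = Z #> (inv a \<otimes> ((y \<otimes> a) \<otimes> inv a))" using ac y by (simp add: m_assoc)
        also have "\<dots> = Z #> (inv a \<otimes> ((a \<otimes> y) \<otimes> inv a))" using ac y hom by simp
        also have "\<dots> = Z #> (y \<otimes> inv a)" using ac y by (simp add: m_assoc[symmetric])
        finally show ?thesis .
      qed
      then show "inv a \<in> W" using Weq ac by simp
      fix b assume b: "b \<in> W"
      then have bc: "b \<in> carrier G" "\<And>y. y \<in> carrier G \<Longrightarrow> Z #> (b \<otimes> y) = Z #> (y \<otimes> b)"
        using Weq WG by auto
      have "Z #> (a \<otimes> b \<otimes> y) = Z #> (y \<otimes> (a \<otimes> b))" if y: "y \<in> carrier G" for y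
      proof -
        have "Z #> (a \<otimes> b \<otimes> y) = Z #> (a \<otimes> (b \<otimes> y))" using ac bc y by (simp add: m_assoc)
        also have "\<dots> = Z #> (a \<otimes> (y \<otimes> b))" using ac bc y hom by simp
        also have "\<dots> = Z #> ((a \<otimes> y) \<otimes> b)" using ac bc y by (simp add: m_assoc)
        also have "\<dots> = Z #> ((y \<otimes> a) \<otimes> b)" using ac bc y hom by simp
        also have "\<dots> = Z #> (y \<otimes> (a \<otimes> b))" using ac bc y by (simp add: m_assoc)
        finally show ?thesis .
      qed
      then show "a \<otimes> b \<in> W" using Weq ac bc by simp
    qed
    have "g \<otimes> a \<otimes> inv g \<in> W" if ga: "g \<in> carrier G" "a \<in> W" for g a
    proof -
      have ac: "a \<in> carrier G" "\<And>y. y \<in> carrier G \<Longrightarrow> Z #> (a \<otimes> y) = Z #> (y \<otimes> a)"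
        using Weq WG ga by auto
      have "Z #> (g \<otimes> a \<otimes> inv g) = Z #> (a \<otimes> g \<otimes> inv g)" using ac ga hom by simp
      then have 1: "Z #> (g \<otimes> a \<otimes> inv g) = Z #> a" using ac ga by (simp add: m_assoc)
      have "Z #> (g \<otimes> a \<otimes> inv g \<otimes> y) = Z #> (y \<otimes> (g \<otimes> a \<otimes> inv g))" if y: "y \<in> carrier G" for y
        using hom[of "g \<otimes> a \<otimes> inv g" y] hom[of y "g \<otimes> a \<otimes> inv g"] hom[of a y] hom[of y a] ac ga y 1 by simp
      then show ?thesis using Weq ac ga by simp
    qed
    then have Wn: "W \<lhd> G" using Ws by (auto simp: normal_inv_iff)
    obtain c where c: "iter_comm G (carrier G) Z c \<subseteq> {\<one>}" using Z by (auto simp: good_def)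
    have "iter_comm G (carrier G) W 1 \<subseteq> Z" by (auto simp: W_def)
    then have "iter_comm G (carrier G) W (Suc c) \<subseteq> {\<one>}"
      unfolding iter_comm_Suc_shift using iter_comm_mono[of _ Z "carrier G" "carrier G" G c] c by blast
    then have "good W" using Wn unfolding good_def by blast
    then have "card W \<le> card Z" by (rule max)
    moreover have "Z \<subseteq> W"
    proof
      fix z assume z: "z \<in> Z"
      have "commutator G z y \<in> Z" if y: "y \<in> carrier G" for y
      proof -
        have "commutator G z y = z \<otimes> (y \<otimes> inv z \<otimes> inv y)" using z ZG y by (auto simp: m_assoc)
        moreover have "z \<otimes> (y \<otimes> inv z \<otimes> inv y) \<in> Z"
          using normal.inv_op_closed2[OF Zn y] z subgroup.m_inv_closed[OF Zs] subgroup.m_closed[OF Zs] by simp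
        ultimately show ?thesis by simp
      qed
      then show "z \<in> W" using z ZG by (auto simp: W_def)
    qed
    moreover have "finite W" using WG fin finite_subset by blast
    ultimately have "Z = W" by (intro card_seteq) auto
    then show False using x by (auto simp: W_def)
  qed
  then show ?thesis using Z by (auto simp: good_def)
qed

text \<open>Supplements in the finite group \<open>G/K\<close> pull back to supplements of finite
  index, so the Frattini argument applies there and makes all Sylow subgroups of the image of
  \<open>N\<close> normal. The class \<open>c\<close> depends on \<open>K\<close>.\<close>

theorem (in group) frattini_nilpotent:
  assumes N: "N \<lhd> G"
    and frat: "\<And>L. subgroup L G \<Longrightarrow> finite_index G L \<Longrightarrow> L <#> N = carrier G \<Longrightarrow> L = carrier G"
    and K: "K \<lhd> G" "finite_index G K"
  shows "\<exists>c. iter_comm G N N c \<subseteq> K"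
proof -
  define Q where "Q = G Mod K"
  define r where "r g = K #> g" for g
  have Ks: "subgroup K G" and Ns: "subgroup N G" using K N by (auto simp: normal_imp_subgroup)
  have KG: "K \<subseteq> carrier G" and NG: "N \<subseteq> carrier G" using Ks Ns subgroup.subset by auto
  interpret Q: group Q unfolding Q_def using normal.factorgroup_is_group[OF K(1)] .
  have "r \<in> hom G Q" using normal.r_coset_hom_Mod[OF K(1)] by (simp add: r_def[abs_def] Q_def)
  then interpret r: group_hom G Q r
    by (intro group_hom.intro group_hom_axioms.intro group_axioms Q.group_axioms)
  have cQ: "carrier Q = r ` carrier G" by (simp add: Q_def r_def carrier_FactGroup)
  have finQ: "finite (carrier Q)" using K(2) by (simp add: cQ r_def rcosets_image)
  have rK: "r g = \<one>\<^bsub>Q\<^esub> \<longleftrightarrow> g \<in> K" if "g \<in> carrier G" for g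
    using that coset_join1[OF _ that Ks] coset_join2[OF that Ks] by (auto simp: r_def Q_def)
  have NQ: "subgroup (r ` N) Q" using r.subgroup_img_is_subgroup[OF Ns] .
  have NQn: "r ` N \<lhd> Q"
    unfolding Q.normal_inv_iff
  proof (intro conjI NQ ballI)
    fix x h assume "x \<in> carrier Q" "h \<in> r ` N"
    then obtain g n where gn: "g \<in> carrier G" "x = r g" "n \<in> N" "h = r n" by (auto simp: cQ)
    then have "x \<otimes>\<^bsub>Q\<^esub> h \<otimes>\<^bsub>Q\<^esub> inv\<^bsub>Q\<^esub> x = r (g \<otimes> n \<otimes> inv g)" using NG by (auto simp: subset_iff)
    then show "x \<otimes>\<^bsub>Q\<^esub> h \<otimes>\<^bsub>Q\<^esub> inv\<^bsub>Q\<^esub> x \<in> r ` N" using normal.inv_op_closed2[OF N gn(1,3)] by simp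
  qed
  have LQ: "L = carrier Q" if L: "subgroup L Q" "L <#>\<^bsub>Q\<^esub> r ` N = carrier Q" for L
  proof -
    define L' where "L' = {g \<in> carrier G. r g \<in> L}"
    note pb = r.pullback_supplement[OF cQ[symmetric] L(1) NG L(2), folded L'_def]
    have "k \<in> L'" if "k \<in> K" for k
    proof -
      have "k \<in> carrier G" "r k = \<one>\<^bsub>Q\<^esub>" using that rK KG by auto
      then show ?thesis using subgroup.one_closed[OF L(1)] by (simp add: L'_def)
    qed
    then have "K \<subseteq> L'" by blast
    then have "finite_index G L'" by (rule finite_index_mono[OF Ks pb(1) _ K(2)])
    then have "L' = carrier G" by (rule frat[OF pb(1) _ pb(2)])
    then have "carrier Q \<subseteq> L" by (auto simp: cQ L'_def)
    then show ?thesis using subgroup.subset[OF L(1)] by blast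
  qed
  interpret N': group "Q\<lparr>carrier := r ` N\<rparr>" using Q.subgroup_imp_group[OF NQ] .
  have "\<exists>c. iter_comm (Q\<lparr>carrier := r ` N\<rparr>) (carrier (Q\<lparr>carrier := r ` N\<rparr>)) (carrier (Q\<lparr>carrier := r ` N\<rparr>)) c \<subseteq> {\<one>\<^bsub>Q\<lparr>carrier := r ` N\<rparr>\<^esub>}"
  proof (rule N'.normal_sylows_nilpotent)
    have rN: "r ` N \<subseteq> carrier Q" using subgroup.subset[OF NQ] .
    then show "finite (carrier (Q\<lparr>carrier := r ` N\<rparr>))" using finQ finite_subset by auto
    fix p :: nat assume p: "prime p"
    obtain P where P: "subgroup P Q" "P \<subseteq> r ` N" "card P = p ^ multiplicity p (card (r ` N))"
      "\<And>g h. g \<in> carrier Q \<Longrightarrow> h \<in> P \<Longrightarrow> g \<otimes>\<^bsub>Q\<^esub> h \<otimes>\<^bsub>Q\<^esub> inv\<^bsub>Q\<^esub> g \<in> P"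
      by (rule Q.frattini_sylow_normal[OF finQ NQn _ p]) (erule (1) LQ, rule that)
    have "P \<lhd> Q\<lparr>carrier := r ` N\<rparr>"
      unfolding N'.normal_inv_iff
      using P rN Q.subgroup_incl[OF P(1) NQ P(2)] Q.m_inv_consistent[OF NQ] by auto
    then show "\<exists>P. P \<lhd> Q\<lparr>carrier := r ` N\<rparr> \<and> card P = p ^ multiplicity p (card (carrier (Q\<lparr>carrier := r ` N\<rparr>)))"
      using P(3) by auto
  qed
  then obtain c where c: "iter_comm Q (r ` N) (r ` N) c \<subseteq> {\<one>\<^bsub>Q\<^esub>}"
    using Q.iter_comm_consistent[OF NQ] by auto
  have "iter_comm G N N c \<subseteq> K"
  proof
    fix x assume x: "x \<in> iter_comm G N N c"
    then have "x \<in> carrier G" using iter_comm_subgroup[OF Ns] NG by blast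
    moreover have "r x \<in> {\<one>\<^bsub>Q\<^esub>}" using c imageI[OF x, of r]
      unfolding r.iter_comm_image[OF NG NG] by (rule subsetD)
    ultimately show "x \<in> K" using rK by simp
  qed
  then show ?thesis by blast
qed

subsection \<open>Virtually abelian quotients\<close>

lemma (in group) finite_index_trans:
  assumes V: "subgroup V G" "finite_index G V" and U: "subgroup U G" "U \<subseteq> V"
    and fin: "finite_index (G\<lparr>carrier := V\<rparr>) U"
  shows "finite_index G U"
proof -
  have VG: "V \<subseteq> carrier G" and UG: "U \<subseteq> carrier G" using V U subgroup.subset by auto
  define t where "t C = (SOME g. g \<in> carrier G \<and> V #> g = C)" for C
  have t: "t C \<in> carrier G" "V #> t C = C" if "C \<in> rcosets V" for C
    using someI_ex[of "\<lambda>g. g \<in> carrier G \<and> V #> g = C"] that by (auto simp: t_def RCOSETS_def)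
  have "rcosets U \<subseteq> (\<lambda>(D, C). D #> t C) ` ((rcosets\<^bsub>G\<lparr>carrier := V\<rparr>\<^esub> U) \<times> (rcosets V))"
  proof
    fix E assume "E \<in> rcosets U"
    then obtain g where g: "g \<in> carrier G" "E = U #> g" by (auto simp: RCOSETS_def)
    have C: "V #> g \<in> rcosets V" using g VG by (intro rcosetsI)
    have "g \<otimes> inv (t (V #> g)) \<in> V" using coset_eq_iff[OF V(1) g(1) t(1)[OF C]] t(2)[OF C] by simp
    then obtain v where v: "v \<in> V" "v = g \<otimes> inv (t (V #> g))" by blast
    have vt: "v \<otimes> t (V #> g) = g" using v(2) g t(1)[OF C] by (simp add: m_assoc)
    have "E = (U #> v) #> t (V #> g)"
      using g(2) coset_mult_assoc[OF UG _ t(1)[OF C], of v] v(1) VG vt by auto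
    moreover have "U #> v \<in> rcosets\<^bsub>G\<lparr>carrier := V\<rparr>\<^esub> U" using v(1) by (auto simp: RCOSETS_def)
    ultimately show "E \<in> (\<lambda>(D, C). D #> t C) ` ((rcosets\<^bsub>G\<lparr>carrier := V\<rparr>\<^esub> U) \<times> (rcosets V))"
      using C by (intro image_eqI[of _ _ "(U #> v, V #> g)"]) auto
  qed
  then show ?thesis using fin V(2) finite_subset by blast
qed

text \<open>Schreier's lemma. \<open>Y\<close> consists of the products \<open>a s b^-1\<close> in
  \<open>H\<close> with \<open>a\<close>, \<open>b\<close> coset representatives and
  \<open>s\<close> a generator or an inverse of one. With it, \<open>generate G Y <#> T\<close> is
  stable under right multiplication by generators, hence is the whole group.\<close>

theorem (in group) finite_index_finitely_generated:
  assumes S: "finite S" "S \<subseteq> carrier G" "generate G S = carrier G"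
    and H: "subgroup H G" "finite_index G H"
  obtains Y where "finite Y" "Y \<subseteq> H" "generate G Y = H"
proof -
  have HG: "H \<subseteq> carrier G" using subgroup.subset[OF H(1)] .
  define t where "t C = (SOME g. g \<in> carrier G \<and> H #> g = C)" for C
  have t: "t C \<in> carrier G" "H #> t C = C" if "C \<in> rcosets H" for C
    using someI_ex[of "\<lambda>g. g \<in> carrier G \<and> H #> g = C"] that by (auto simp: t_def RCOSETS_def)
  \<comment> \<open>\<open>t\<close> need not pick 1 as the representative of \<open>H\<close>, so 1
    is added; with 1 in \<open>S'\<close> too, the representatives that lie in \<open>H\<close> are
    themselves elements of \<open>Y\<close>.\<close>
  define T where "T = insert \<one> (t ` (rcosets H))"
  have TG: "T \<subseteq> carrier G" using t by (auto simp: T_def)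
  define S' where "S' = insert \<one> (S \<union> m_inv G ` S)"
  have S'G: "S' \<subseteq> carrier G" using S by (auto simp: S'_def)
  define Y where "Y = H \<inter> (\<lambda>(a, s, b). a \<otimes> s \<otimes> inv b) ` (T \<times> S' \<times> T)"
  have finY: "finite Y" using S(1) H(2) by (auto simp: Y_def T_def S'_def)
  have YI: "a \<otimes> s \<otimes> inv b \<in> Y" if "a \<in> T" "s \<in> S'" "b \<in> T" "a \<otimes> s \<otimes> inv b \<in> H" for a s b
    using that unfolding Y_def by (intro IntI image_eqI[of _ _ "(a, s, b)"]) auto
  have YG: "Y \<subseteq> carrier G" using HG by (auto simp: Y_def)
  have gY: "generate G Y \<subseteq> H" by (rule generate_subgroup_incl[OF _ H(1)]) (auto simp: Y_def)
  define U where "U = generate G Y <#> T"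
  have UI: "y \<otimes> a \<in> U" if "y \<in> generate G Y" "a \<in> T" for y a
    using that unfolding U_def set_mult_def by blast
  have step: "u \<otimes> s \<in> U" if us: "u \<in> U" "s \<in> S'" for u s
  proof -
    obtain y a where ya: "y \<in> generate G Y" "a \<in> T" "u = y \<otimes> a"
      using us by (auto simp: U_def set_mult_def)
    have c: "y \<in> carrier G" "a \<in> carrier G" "s \<in> carrier G"
      using ya us gY HG TG S'G by auto
    have C: "H #> (a \<otimes> s) \<in> rcosets H" using c HG by (intro rcosetsI) auto
    define b where "b = t (H #> (a \<otimes> s))"
    have b: "b \<in> T" "b \<in> carrier G" "H #> b = H #> (a \<otimes> s)" using t[OF C] C by (auto simp: b_def T_def)
    have "a \<otimes> s \<otimes> inv b \<in> H" using coset_eq_iff[OF H(1), of "a \<otimes> s" b] b c by simp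
    then have "a \<otimes> s \<otimes> inv b \<in> Y" using ya us b by (intro YI)
    then have "y \<otimes> (a \<otimes> s \<otimes> inv b) \<in> generate G Y" 
      using generate.eng[OF ya(1) generate.incl] by simp
    then have "(y \<otimes> (a \<otimes> s \<otimes> inv b)) \<otimes> b \<in> U" using b by (intro UI)
    moreover have "(y \<otimes> (a \<otimes> s \<otimes> inv b)) \<otimes> b = u \<otimes> s" using c b ya(3) by (simp add: m_assoc)
    ultimately show ?thesis by simp
  qed
  have UG: "U \<subseteq> carrier G" using setmult_subset_G[of "generate G Y" T] gY HG TG by (auto simp: U_def)
  have closed: "\<forall>u\<in>U. u \<otimes> g \<in> U" if "g \<in> generate G S" for g
    using that
  proof induction
    case one
    then show ?case using UG by auto
  next
    case (incl h)
    then show ?case using step by (auto simp: S'_def)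
  next
    case (inv h)
    then show ?case using step by (auto simp: S'_def)
  next
    case (eng h1 h2)
    have c: "h1 \<in> carrier G" "h2 \<in> carrier G" using eng S(3) by auto
    show ?case
    proof
      fix u assume u: "u \<in> U"
      then have "(u \<otimes> h1) \<otimes> h2 \<in> U" using eng by blast
      then show "u \<otimes> (h1 \<otimes> h2) \<in> U" using c u UG by (auto simp: m_assoc subset_iff)
    qed
  qed
  have one_U: "\<one> \<otimes> \<one> \<in> U" by (rule UI) (auto simp: T_def intro: generate.one)
  have all: "g \<in> U" if "g \<in> carrier G" for g
  proof -
    have "(\<one> \<otimes> \<one>) \<otimes> g \<in> U" using closed[of g] one_U that S(3) by blast
    then show ?thesis using that by simp
  qed
  have "H \<subseteq> generate G Y"
  proof
    fix h assume h: "h \<in> H"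
    then have "h \<in> U" using all HG by auto
    then obtain y a where ya: "y \<in> generate G Y" "a \<in> T" "h = y \<otimes> a" by (auto simp: U_def set_mult_def)
    have c: "y \<in> carrier G" "a \<in> carrier G" "y \<in> H" using ya gY HG TG by auto
    have "inv y \<otimes> h \<in> H" using c h subgroup.m_closed[OF H(1)] subgroup.m_inv_closed[OF H(1)] by simp
    then have "a \<in> H" using ya(3) c by (simp add: m_assoc[symmetric])
    then have "a \<otimes> \<one> \<otimes> inv \<one> \<in> Y" using ya c by (intro YI) (auto simp: S'_def T_def)
    then have "a \<in> generate G Y" using c by (simp add: generate.incl)
    then show "h \<in> generate G Y" unfolding ya(3) using ya(1) by (intro generate.eng)
  qed
  then show ?thesis using that finY gY by (auto simp: Y_def)
qed

section \<open>Abelian groups finitely generated over a subgroup\<close>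

lemma (in comm_group) subgroup_adjoin_powers:
  assumes C: "subgroup C G" and s: "s \<in> carrier G"
  defines "D \<equiv> (\<lambda>(a, j). a \<otimes> s [^] (j::int)) ` (C \<times> UNIV)"
  shows "subgroup D G" "C \<subseteq> D" "s \<in> D"
proof -
  have CG: "C \<subseteq> carrier G" using subgroup.subset[OF C] .
  have I: "a \<otimes> s [^] (j::int) \<in> D" if "a \<in> C" for a j
    unfolding D_def by (rule image_eqI[of _ _ "(a, j)"]) (use that in auto)
  have E: "\<exists>a\<in>C. \<exists>j::int. x = a \<otimes> s [^] j" if "x \<in> D" for x
    using that unfolding D_def by auto
  show "C \<subseteq> D"
  proof
    fix a assume a: "a \<in> C"
    have "a \<otimes> s [^] (0::int) = a" using a CG by auto
    then show "a \<in> D" using I[OF a, of 0] by (simp only:)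
  qed
  have "\<one> \<otimes> s [^] (1::int) = s" using s by (simp add: int_pow_1)
  then show "s \<in> D" using I[OF subgroup.one_closed[OF C], of 1] by (simp only:)
  show "subgroup D G"
  proof (rule subgroupI)
    show "D \<subseteq> carrier G" using CG s by (auto simp: D_def)
    show "D \<noteq> {}" using I[OF subgroup.one_closed[OF C]] by blast
    fix x assume "x \<in> D"
    then obtain a j where x: "a \<in> C" "x = a \<otimes> s [^] (j::int)" using E by blast
    have ac: "a \<in> carrier G" using x CG by auto
    have "inv x = inv a \<otimes> s [^] (- j)" using x ac s by (simp add: inv_mult int_pow_neg)
    then show "inv x \<in> D" using I[OF subgroup.m_inv_closed[OF C x(1)], of "- j"] by (simp only:)
    fix y assume "y \<in> D"
    then obtain b k where y: "b \<in> C" "y = b \<otimes> s [^] (k::int)" using E by blast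
    have bc: "b \<in> carrier G" using y CG by auto
    have "x \<otimes> y = (a \<otimes> b) \<otimes> s [^] (j + k)" using x y ac bc s by (simp add: int_pow_mult m_ac)
    then show "x \<otimes> y \<in> D" using I[OF subgroup.m_closed[OF C x(1) y(1)], of "j + k"] by (simp only:)
  qed
qed

text \<open>Generators are absorbed into \<open>C\<close> one at a time. If \<open>s = w^p\<close>
  and \<open>w^c = a s^j\<close> with \<open>a\<close> in \<open>C\<close>, then
  \<open>s^c = a^p s^(jp)\<close>, so \<open>s^(c - jp)\<close> lies in \<open>C\<close>. The
  exponent \<open>c - jp\<close> is prime to \<open>p\<close> because \<open>c\<close> is; in
  particular it is nonzero. With trivial \<open>C\<close> this bounds the exponent of a finitely
  generated \<open>p\<close>-divisible group.\<close>

lemma (in comm_group) divisible_finitely_generated: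
  assumes p: "prime (p::nat)" and div: "\<And>x. x \<in> carrier G \<Longrightarrow> \<exists>y\<in>carrier G. x = y [^] p"
    and "finite S" "S \<subseteq> carrier G" "subgroup C G" "generate G (S \<union> C) = carrier G"
  shows "\<exists>c::nat. c > 0 \<and> coprime c p \<and> (\<forall>x\<in>carrier G. x [^] c \<in> C)"
  using assms(3-)
proof (induction S arbitrary: C)
  case empty
  then have "C = carrier G" using generate_subgroup_incl[of C C] subgroup.subset[of C G] by auto
  then show ?case by (intro exI[of _ 1]) auto
next
  case (insert s S)
  define D where "D = (\<lambda>(a, j). a \<otimes> s [^] (j::int)) ` (C \<times> UNIV)"
  have s: "s \<in> carrier G" using insert by auto
  note D = subgroup_adjoin_powers[OF insert.prems(2) s, folded D_def]
  have DG: "D \<subseteq> carrier G" and CG: "C \<subseteq> carrier G" using D(1) insert.prems(2) subgroup.subset by auto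
  have "generate G (insert s S \<union> C) \<subseteq> generate G (S \<union> D)"
    using D by (intro mono_generate) auto
  then have "generate G (S \<union> D) = carrier G"
    using insert.prems generate_incl[of "S \<union> D"] DG by auto
  then obtain c :: nat where c: "c > 0" "coprime c p" "\<And>x. x \<in> carrier G \<Longrightarrow> x [^] c \<in> D"
    using insert.IH[of D] D(1) insert.prems by auto
  obtain w where w: "w \<in> carrier G" "s = w [^] p" using div[OF s] by blast
  obtain a j where aj: "a \<in> C" "w [^] c = a \<otimes> s [^] (j::int)" using c(3)[OF w(1)] by (auto simp: D_def)
  have ac: "a \<in> carrier G" using aj CG by auto
  have "s [^] int c = (w [^] c) [^] p"
    using w by (simp add: nat_pow_pow int_pow_int mult.commute)
  also have "\<dots> = a [^] p \<otimes> s [^] (j * int p)"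
    using aj ac s by (simp add: int_pow_distrib int_pow_pow flip: int_pow_int)
  finally have e: "s [^] int c = a [^] p \<otimes> s [^] (j * int p)" .
  have pw: "x [^] n \<in> C" if "x \<in> C" for x and n :: nat
    using subgroup_int_pow_closed[OF insert.prems(2) that, of "int n"] by (simp add: int_pow_int)
  have "s [^] (int c - j * int p) = s [^] int c \<otimes> inv (s [^] (j * int p))"
    using s by (simp add: int_pow_diff)
  also have "\<dots> = a [^] p" unfolding e using s ac by (simp add: m_assoc)
  finally have "s [^] (int c - j * int p) \<in> C" using pw[OF aj(1)] by simp
  define d where "d = nat \<bar>int c - j * int p\<bar>"
  have sd: "s [^] d \<in> C"
  proof (cases "int c - j * int p \<ge> 0")
    case True
    then have "s [^] d = s [^] (int c - j * int p)" by (simp add: d_def flip: int_pow_int)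
    then show ?thesis using \<open>s [^] (int c - j * int p) \<in> C\<close> by simp
  next
    case False
    then have "s [^] d = inv (s [^] (int c - j * int p))"
      using s by (simp add: d_def int_pow_neg[symmetric] flip: int_pow_int)
    then show ?thesis using \<open>s [^] (int c - j * int p) \<in> C\<close> subgroup.m_inv_closed[OF insert.prems(2)] by simp
  qed
  have npc: "\<not> int p dvd int c"
  proof
    assume "int p dvd int c"
    then have "p dvd 1" using c(2) by (metis coprime_common_divisor_nat dvd_refl int_dvd_int_iff nat_dvd_1_iff_1)
    then show False using prime_gt_1_nat[OF p] by simp
  qed
  have npd: "\<not> int p dvd int c - j * int p"
    using npc by (simp add: dvd_diff_left_iff)
  have "d > 0" using npd by (cases "int c - j * int p = 0") (auto simp: d_def)
  have "\<not> p dvd d" using npd by (simp add: d_def flip: int_dvd_int_iff)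
  then have "coprime d p" using p prime_imp_coprime coprime_commute by blast
  have "x [^] (c * d) \<in> C" if x: "x \<in> carrier G" for x
  proof -
    obtain b k where bk: "b \<in> C" "x [^] c = b \<otimes> s [^] (k::int)" using c(3)[OF x] by (auto simp: D_def)
    have bc: "b \<in> carrier G" using bk CG by auto
    have "x [^] (c * d) = (x [^] c) [^] d" using x by (simp add: nat_pow_pow)
    also have "\<dots> = b [^] d \<otimes> (s [^] d) [^] k"
      using bk bc s by (simp add: int_pow_distrib int_pow_pow mult.commute flip: int_pow_int)
    also have "\<dots> \<in> C"
      using subgroup.m_closed[OF insert.prems(2) pw[OF bk(1)] subgroup_int_pow_closed[OF insert.prems(2) sd]] .
    finally show ?thesis .
  qed
  then show ?case using c \<open>d > 0\<close> \<open>coprime d p\<close> by (intro exI[of _ "c * d"]) auto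
qed

text \<open>Adjoining \<open>s\<close> to \<open>C\<close> multiplies the index by at most
  \<open>c\<close>, since the cosets are those of \<open>s^r\<close> with
  \<open>r < c\<close>.\<close>

lemma (in comm_group) finite_index_finite_exponent:
  assumes "(c::nat) > 0"
    and "finite S" "S \<subseteq> carrier G" "subgroup C G" "generate G (S \<union> C) = carrier G"
    and "\<And>x. x \<in> carrier G \<Longrightarrow> x [^] c \<in> C"
  shows "finite_index G C"
  using assms(2-)
proof (induction S arbitrary: C)
  case empty
  then have "C = carrier G" using generate_subgroup_incl[of C C] subgroup.subset[of C G] by auto
  then show ?case using finite_index_carrier by simp
next
  case (insert s S)
  define D where "D = (\<lambda>(a, j). a \<otimes> s [^] (j::int)) ` (C \<times> UNIV)"
  have s: "s \<in> carrier G" using insert by auto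
  note D = subgroup_adjoin_powers[OF insert.prems(2) s, folded D_def]
  have DG: "D \<subseteq> carrier G" and CG: "C \<subseteq> carrier G" using D(1) insert.prems(2) subgroup.subset by auto
  have "generate G (insert s S \<union> C) \<subseteq> generate G (S \<union> D)"
    using D by (intro mono_generate) auto
  then have "generate G (S \<union> D) = carrier G"
    using insert.prems generate_incl[of "S \<union> D"] DG by auto
  then have fD: "finite_index G D" using insert.IH[of D] D insert.prems by auto
  show ?case
  proof (rule finite_index_trans[OF D(1) fD insert.prems(2) D(2)])
    have "rcosets\<^bsub>G\<lparr>carrier := D\<rparr>\<^esub> C \<subseteq> (\<lambda>r::nat. C #> s [^] r) ` {..<c}"
    proof
      fix E assume "E \<in> rcosets\<^bsub>G\<lparr>carrier := D\<rparr>\<^esub> C"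
      then obtain x where x: "x \<in> D" "E = C #> x" by (auto simp: RCOSETS_def)
      then obtain a j where aj: "a \<in> C" "x = a \<otimes> s [^] (j::int)" by (auto simp: D_def)
      have ac: "a \<in> carrier G" using aj CG by auto
      define r where "r = nat (j mod int c)"
      have r: "r < c" "j = int c * (j div int c) + int r" using assms(1) by (auto simp: r_def nat_less_iff)
      have "s [^] j = (s [^] int c) [^] (j div int c) \<otimes> s [^] int r"
        using s r(2) by (metis int_pow_mult int_pow_pow)
      then have sj: "s [^] j = (s [^] c) [^] (j div int c) \<otimes> s [^] r" by (simp add: int_pow_int)
      have sc: "(s [^] c) [^] (j div int c) \<in> C"
        using subgroup_int_pow_closed[OF insert.prems(2)] insert.prems(4)[OF s] by simp
      have "x \<otimes> inv (s [^] r) = a \<otimes> (s [^] c) [^] (j div int c)"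
        unfolding aj(2) sj using ac s by (simp add: m_assoc)
      then have "x \<otimes> inv (s [^] r) \<in> C" using subgroup.m_closed[OF insert.prems(2) aj(1) sc] by simp
      then have "E = C #> s [^] r" using x(2) coset_eq_iff[OF insert.prems(2), of x "s [^] r"] s x(1) DG by auto
      then show "E \<in> (\<lambda>r::nat. C #> s [^] r) ` {..<c}" using r(1) by blast
    qed
    then show "finite_index (G\<lparr>carrier := D\<rparr>) C" using finite_subset by blast
  qed
qed

lemma (in comm_group) hom_finprod:
  assumes "\<And>x y. x \<in> carrier G \<Longrightarrow> y \<in> carrier G \<Longrightarrow> h (x \<otimes> y) = h x \<otimes> h y"
    and "h \<in> carrier G \<rightarrow> carrier G" "f \<in> A \<rightarrow> carrier G"
  shows "h (finprod G f A) = finprod G (\<lambda>x. h (f x)) A"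
proof -
  have one: "h \<one> = \<one>"
    using assms(1)[of \<one> \<one>] assms(2) by (metis Pi_mem l_one one_closed r_cancel_one)
  show ?thesis
    using assms(3)
  proof (induction A rule: infinite_finite_induct)
    case (insert a A)
    have "h (finprod G f (insert a A)) = h (f a \<otimes> finprod G f A)" using insert by simp
    also have "\<dots> = h (f a) \<otimes> h (finprod G f A)" using insert by (intro assms(1)) auto
    also have "\<dots> = finprod G (\<lambda>x. h (f x)) (insert a A)"
      using insert assms(2) by (subst finprod_insert) (auto simp: Pi_iff)
    finally show ?case .
  qed (auto simp: one)
qed

text \<open>Averaging \<open>g \<mapsto> g t(Cg)\<^sup>-\<^sup>1 t(C)\<close> over the cosets \<open>C\<close> of \<open>V\<close>, with \<open>t\<close> a transversal, gives
  a crossed homomorphism \<open>c\<close> from \<open>G\<close> to \<open>V\<close> whose restriction to \<open>V\<close> is the power map given by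
  the index of \<open>V\<close>. The preimage of \<open>{v\<^sup>p | v \<in> V}\<close> under \<open>c\<close>, with \<open>p\<close> a prime larger than
  that index, is a proper supplement of \<open>V\<close>.\<close>

theorem (in group) abelian_supplement:
  assumes V: "V \<lhd> G" "finite_index G V" "infinite V"
    and comm: "\<And>x y. x \<in> V \<Longrightarrow> y \<in> V \<Longrightarrow> x \<otimes> y = y \<otimes> x"
    and Y: "finite Y" "Y \<subseteq> V" "generate G Y = V"
  obtains L where "subgroup L G" "finite_index G L" "L \<noteq> carrier G" "L <#> V = carrier G"
proof -
  have Vs: "subgroup V G" using V(1) by (rule normal_imp_subgroup)
  have VG: "V \<subseteq> carrier G" using subgroup.subset[OF Vs] .
  define A where "A = G\<lparr>carrier := V\<rparr>"
  have A: "carrier A = V" "monoid.mult A = monoid.mult G" "one A = \<one>" by (auto simp: A_def)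
  have pA: "x [^]\<^bsub>A\<^esub> (n::nat) = x [^] n" for x n unfolding A_def by (rule nat_pow_consistent[symmetric])
  interpret A: group A unfolding A_def by (rule subgroup_imp_group[OF Vs])
  interpret A: comm_group A
    by (rule A.group_comm_groupI) (use comm in \<open>auto simp: A\<close>)
  define h where "h = card (rcosets V)"
  obtain p where p: "prime p" "p > h" using bigger_prime by blast
  have "rcosets V \<noteq> {}" by (auto simp: RCOSETS_def)
  then have h0: "h > 0" using V(2) by (simp add: h_def card_gt_0_iff)
  have "\<not> p dvd h" using p(2) h0 by (auto dest: dvd_imp_le)
  then have cop: "coprime h p" using p(1) prime_imp_coprime coprime_commute by blast
  define U where "U = (\<lambda>v. v [^] p) ` V"
  have UV: "U \<subseteq> V" using A.nat_pow_closed[where n = p] by (auto simp: U_def A pA)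
  have UA: "subgroup U A"
  proof (rule A.subgroupI)
    show "U \<subseteq> carrier A" using UV by (simp add: A)
    show "U \<noteq> {}" using subgroup.one_closed[OF Vs] by (auto simp: U_def)
    fix x assume "x \<in> U"
    then obtain v where v: "v \<in> V" "x = v [^] p" by (auto simp: U_def)
    have "inv\<^bsub>A\<^esub> x = (inv\<^bsub>A\<^esub> v) [^] p"
      using A.nat_pow_inv[of v p] v by (simp add: A pA)
    then show "inv\<^bsub>A\<^esub> x \<in> U" using A.inv_closed[of v] v by (auto simp: U_def A)
    fix y assume "y \<in> U"
    then obtain w where w: "w \<in> V" "y = w [^] p" by (auto simp: U_def)
    have "x \<otimes>\<^bsub>A\<^esub> y = (v \<otimes>\<^bsub>A\<^esub> w) [^] p"
      using A.nat_pow_distrib[of v w p] v w by (simp add: A pA)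
    then show "x \<otimes>\<^bsub>A\<^esub> y \<in> U" using A.m_closed[of v w] v w by (auto simp: U_def A)
  qed
  have Us: "subgroup U G" using incl_subgroup[OF Vs] UA by (simp add: A_def)
  have genA: "generate A (Y \<union> C) = carrier A" if "subgroup C A" for C
  proof -
    have "C \<subseteq> V" using subgroup.subset[OF that] by (simp add: A)
    then have "generate A (Y \<union> C) = generate G (Y \<union> C)"
      unfolding A_def using Y(2) by (intro generate_consistent Vs) auto
    moreover have "V \<subseteq> generate G (Y \<union> C)" using Y(3) mono_generate[of Y "Y \<union> C"] by auto
    moreover have "generate G (Y \<union> C) \<subseteq> V" using Y(2) \<open>C \<subseteq> V\<close> by (intro generate_subgroup_incl Vs) auto
    ultimately show ?thesis by (simp add: A)
  qed
  have "finite_index A U"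
    by (rule A.finite_index_finite_exponent[of p Y])
      (use prime_gt_0_nat[OF p(1)] Y UA genA[OF UA] in \<open>auto simp: A pA U_def\<close>)
  then have fU: "finite_index G U"
    using finite_index_trans[OF Vs V(2) Us UV] by (simp add: A_def)
  \<comment> \<open>Otherwise \<open>V\<close> would be \<open>p\<close>-divisible and finitely
    generated, hence of finite exponent and finite.\<close>
  have UneV: "U \<noteq> V"
  proof
    assume "U = V"
    have triv: "subgroup {\<one>\<^bsub>A\<^esub>} A" by (rule A.triv_subgroup)
    have "\<exists>c::nat. c > 0 \<and> coprime c p \<and> (\<forall>x\<in>carrier A. x [^]\<^bsub>A\<^esub> c \<in> {\<one>\<^bsub>A\<^esub>})"
    proof (rule A.divisible_finitely_generated[OF p(1) _ Y(1) _ triv genA[OF triv]])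
      show "\<exists>y\<in>carrier A. x = y [^]\<^bsub>A\<^esub> p" if "x \<in> carrier A" for x
        using that \<open>U = V\<close> by (auto simp: A pA U_def)
    qed (use Y in \<open>simp add: A\<close>)
    then obtain c :: nat where c: "c > 0" "\<And>x. x \<in> carrier A \<Longrightarrow> x [^]\<^bsub>A\<^esub> c \<in> {\<one>\<^bsub>A\<^esub>}" by blast
    have "finite_index A {\<one>\<^bsub>A\<^esub>}"
      by (rule A.finite_index_finite_exponent[OF c(1) Y(1) _ triv genA[OF triv] c(2)]) (use Y in \<open>auto simp: A\<close>)
    moreover have "finite C" if "C \<in> rcosets\<^bsub>A\<^esub> {\<one>\<^bsub>A\<^esub>}" for C
      using that by (auto simp: RCOSETS_def r_coset_def)
    ultimately have "finite (\<Union>(rcosets\<^bsub>A\<^esub> {\<one>\<^bsub>A\<^esub>}))" by (rule finite_Union)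
    then show False using V(3) A.rcosets_part_G[OF triv] by (simp add: A)
  qed
  define t where "t C = (SOME g. g \<in> carrier G \<and> V #> g = C)" for C
  have t: "t C \<in> carrier G" "V #> t C = C" if "C \<in> rcosets V" for C
    using someI_ex[of "\<lambda>g. g \<in> carrier G \<and> V #> g = C"] that by (auto simp: t_def RCOSETS_def)
  have act: "C #> g \<in> rcosets V" if Cg: "C \<in> rcosets V" "g \<in> carrier G" for C g
  proof -
    have "C #> g = V #> (t C \<otimes> g)"
      using coset_mult_assoc[OF VG t(1)[OF Cg(1)] Cg(2)] t(2)[OF Cg(1)] by simp
    then show ?thesis using t(1)[OF Cg(1)] Cg VG by (auto intro: rcosetsI)
  qed
  have Csub: "C \<subseteq> carrier G" if "C \<in> rcosets V" for C
    using subgroup.rcosets_carrier[OF Vs group_axioms that] .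
  define f where "f g C = g \<otimes> inv (t (C #> g)) \<otimes> t C" for g C
  have fV: "f g C \<in> V" if Cg: "C \<in> rcosets V" "g \<in> carrier G" for C g
  proof -
    define a b where "a = t C" and "b = t (C #> g)"
    have ab: "a \<in> carrier G" "b \<in> carrier G" "V #> a = C" "V #> b = C #> g"
      using t[OF Cg(1)] t[OF act[OF Cg]] by (auto simp: a_def b_def)
    have "V #> (a \<otimes> g) = V #> b" using coset_mult_assoc[OF VG ab(1) Cg(2)] ab by simp
    then have "a \<otimes> g \<otimes> inv b \<in> V" using coset_eq_iff[OF Vs m_closed[OF ab(1) Cg(2)] ab(2)] by simp
    then have "inv a \<otimes> (a \<otimes> g \<otimes> inv b) \<otimes> a \<in> V" using normal.inv_op_closed1[OF V(1) ab(1)] by simp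
    moreover have "inv a \<otimes> (a \<otimes> g \<otimes> inv b) \<otimes> a = f g C" unfolding f_def a_def[symmetric] b_def[symmetric]
      using ab Cg(2) by (simp add: m_assoc[symmetric])
    ultimately show ?thesis by simp
  qed
  define c where "c g = finprod A (f g) (rcosets V)" for g
  have cV: "c g \<in> V" if "g \<in> carrier G" for g
    using A.finprod_closed[of "f g" "rcosets V"] fV that by (auto simp: c_def A)
  have conjV: "g \<otimes> v \<otimes> inv g \<in> V" if "g \<in> carrier G" "v \<in> V" for g v
    using normal.inv_op_closed2[OF V(1) that] .
  \<comment> \<open>The factor of \<open>c (g k)\<close> at the coset \<open>C\<close> is the
    conjugate by \<open>g\<close> of the factor of \<open>c k\<close> at \<open>C g\<close>, times
    the factor of \<open>c g\<close> at \<open>C\<close>; as \<open>C\<close> varies, so does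
    \<open>C g\<close>, and the product can be reindexed.\<close>
  have cmult: "c (g \<otimes> k) = (g \<otimes> c k \<otimes> inv g) \<otimes> c g" if gk: "g \<in> carrier G" "k \<in> carrier G" for g k
  proof -
    have "g \<otimes> c k \<otimes> inv g = finprod A (\<lambda>C. g \<otimes> f k C \<otimes> inv g) (rcosets V)"
      unfolding c_def
    proof (rule A.hom_finprod)
      show "g \<otimes> (x \<otimes>\<^bsub>A\<^esub> y) \<otimes> inv g = (g \<otimes> x \<otimes> inv g) \<otimes>\<^bsub>A\<^esub> (g \<otimes> y \<otimes> inv g)"
        if "x \<in> carrier A" "y \<in> carrier A" for x y
      proof -
        have "x \<in> carrier G" "y \<in> carrier G" using that VG by (auto simp: A)
        then show ?thesis using gk by (simp add: A m_assoc inv_cancel_assoc)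
      qed
    qed (use gk conjV fV in \<open>auto simp: A\<close>)
    also have "\<dots> = finprod A (\<lambda>C. g \<otimes> f k C \<otimes> inv g) ((\<lambda>C. C #> g) ` (rcosets V))"
    proof -
      have "(\<lambda>C. C #> g) ` (rcosets V) = rcosets V"
      proof
        show "(\<lambda>C. C #> g) ` (rcosets V) \<subseteq> rcosets V" using act gk by auto
        show "rcosets V \<subseteq> (\<lambda>C. C #> g) ` (rcosets V)"
        proof
          fix C assume C: "C \<in> rcosets V"
          have "(C #> inv g) #> g = C" using gk Csub[OF C] by (simp add: coset_mult_assoc)
          then show "C \<in> (\<lambda>C. C #> g) ` (rcosets V)" using act[OF C, of "inv g"] gk by force
        qed
      qed
      then show ?thesis by simp
    qed
    also have "\<dots> = finprod A (\<lambda>C. g \<otimes> f k (C #> g) \<otimes> inv g) (rcosets V)"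
    proof (rule A.finprod_reindex)
      show "(\<lambda>C. g \<otimes> f k C \<otimes> inv g) \<in> (\<lambda>C. C #> g) ` (rcosets V) \<rightarrow> carrier A"
        using act conjV fV gk by (auto simp: A)
      show "inj_on (\<lambda>C. C #> g) (rcosets V)"
      proof (rule inj_on_inverseI)
        show "(C #> g) #> inv g = C" if "C \<in> rcosets V" for C
          using gk Csub[OF that] by (simp add: coset_mult_assoc)
      qed
    qed
    finally have 1: "g \<otimes> c k \<otimes> inv g = finprod A (\<lambda>C. g \<otimes> f k (C #> g) \<otimes> inv g) (rcosets V)" .
    have "c (g \<otimes> k) = finprod A (\<lambda>C. (g \<otimes> f k (C #> g) \<otimes> inv g) \<otimes>\<^bsub>A\<^esub> f g C) (rcosets V)"
      unfolding c_def
    proof (rule A.finprod_cong')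
      show "(\<lambda>C. (g \<otimes> f k (C #> g) \<otimes> inv g) \<otimes>\<^bsub>A\<^esub> f g C) \<in> rcosets V \<rightarrow> carrier A"
        using conjV fV act gk subgroup.m_closed[OF Vs] by (auto simp: A)
      fix C assume C: "C \<in> rcosets V"
      have tc: "t C \<in> carrier G" "t (C #> g) \<in> carrier G" "t (C #> g #> k) \<in> carrier G"
        using t(1) act C gk by auto
      have "C #> (g \<otimes> k) = C #> g #> k" using Csub[OF C] gk by (simp add: coset_mult_assoc)
      then show "f (g \<otimes> k) C = (g \<otimes> f k (C #> g) \<otimes> inv g) \<otimes>\<^bsub>A\<^esub> f g C"
        using tc gk by (simp add: f_def A m_assoc inv_cancel_assoc)
    qed simp
    also have "\<dots> = (g \<otimes> c k \<otimes> inv g) \<otimes>\<^bsub>A\<^esub> c g"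
      unfolding 1 unfolding c_def
      by (rule A.finprod_multf) (use conjV fV act gk in \<open>auto simp: A\<close>)
    finally show ?thesis by (simp add: A)
  qed
  have cv: "c v = v [^] h" if v: "v \<in> V" for v
  proof -
    have vc: "v \<in> carrier G" using v VG by auto
    have "c v = finprod A (\<lambda>C. v) (rcosets V)"
      unfolding c_def
    proof (rule A.finprod_cong')
      show "(\<lambda>C. v) \<in> rcosets V \<rightarrow> carrier A" using v by (simp add: A)
      fix C assume C: "C \<in> rcosets V"
      have "C #> v = V #> (t C \<otimes> v)" using coset_mult_assoc[OF VG t(1)[OF C] vc] t(2)[OF C] by simp
      also have "\<dots> = V #> t C"
        using coset_eq_iff[OF Vs, of "t C \<otimes> v" "t C"] t(1)[OF C] vc conjV[OF t(1)[OF C] v] by simp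
      finally have "C #> v = C" using t(2)[OF C] by simp
      then show "f v C = v" using t(1)[OF C] vc by (simp add: f_def m_assoc)
    qed simp
    also have "\<dots> = v [^] h" using A.finprod_const[of v "rcosets V"] v by (simp add: A pA h_def)
    finally show ?thesis .
  qed
  have conjU: "g \<otimes> u \<otimes> inv g \<in> U" if gu: "g \<in> carrier G" "u \<in> U" for g u
  proof -
    obtain v where v: "v \<in> V" "u = v [^] p" using gu by (auto simp: U_def)
    have vc: "v \<in> carrier G" using v VG by auto
    have "(g \<otimes> v \<otimes> inv g) [^] n = g \<otimes> v [^] n \<otimes> inv g" for n :: nat
      by (induction n) (use gu vc in \<open>auto simp: m_assoc inv_cancel_assoc\<close>)
    then have "(g \<otimes> v \<otimes> inv g) [^] p = g \<otimes> u \<otimes> inv g" using v(2) by simp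
    moreover have "(g \<otimes> v \<otimes> inv g) [^] p \<in> U" unfolding U_def by (rule imageI[OF conjV[OF gu(1) v(1)]])
    ultimately show ?thesis by (simp only:)
  qed
  define L where "L = {g \<in> carrier G. c g \<in> U}"
  have UI: "v [^] (p * n) \<in> U" if "v \<in> V" for v and n :: nat
  proof -
    have "v [^] n \<in> V" using A.nat_pow_closed[of v n] that by (simp add: A pA)
    then have "(v [^] n) [^] p \<in> U" by (auto simp: U_def)
    then show ?thesis using that VG by (auto simp: nat_pow_pow mult.commute)
  qed
  have UL: "U \<subseteq> L"
  proof
    fix u assume "u \<in> U"
    then obtain v where v: "v \<in> V" "u = v [^] p" by (auto simp: U_def)
    have uV: "u \<in> V" and vc: "v \<in> carrier G" using UV \<open>u \<in> U\<close> v(1) VG by auto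
    have "c u = v [^] (p * h)" using cv[OF uV] nat_pow_pow[OF vc] v(2) by simp
    then have "c u \<in> U" using UI[OF v(1)] by (simp only:)
    then show "u \<in> L" using uV VG by (auto simp: L_def)
  qed
  have one: "c \<one> = \<one>" using cv[OF subgroup.one_closed[OF Vs]] by simp
  have Ls: "subgroup L G"
  proof (rule subgroupI)
    have "\<one> \<in> L" using one subgroup.one_closed[OF Us] by (simp add: L_def)
    then show "L \<noteq> {}" by blast
    fix g assume g: "g \<in> L"
    then have gc: "g \<in> carrier G" "c g \<in> U" by (auto simp: L_def)
    have cgG: "c g \<in> carrier G" and cig: "c (inv g) \<in> carrier G" using cV gc VG by auto
    have "(inv g \<otimes> c g \<otimes> g) \<otimes> c (inv g) = \<one>" using cmult[of "inv g" g] gc one by simp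
    then have "inv (c (inv g)) = inv g \<otimes> c g \<otimes> g"
      by (rule inv_equality) (use gc cgG cig in auto)
    then have "c (inv g) = inv (inv g \<otimes> c g \<otimes> g)" using inv_inv[OF cig] by simp
    moreover have "inv (inv g \<otimes> c g \<otimes> g) \<in> U"
      using conjU[of "inv g" "c g"] gc subgroup.m_inv_closed[OF Us] by simp
    ultimately show "inv g \<in> L" using gc by (simp add: L_def)
    fix k assume k: "k \<in> L"
    then have kc: "k \<in> carrier G" "c k \<in> U" by (auto simp: L_def)
    then show "g \<otimes> k \<in> L"
      using gc cmult[OF gc(1) kc(1)] conjU[OF gc(1) kc(2)] subgroup.m_closed[OF Us] by (simp add: L_def)
  qed (auto simp: L_def)
  moreover have "finite_index G L" by (rule finite_index_mono[OF Us Ls UL fU])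
  \<comment> \<open>These exponents serve twice. If \<open>v^h\<close> lies in \<open>U\<close>, so
    does \<open>v\<close>, because \<open>v^(1 + a h)\<close> is a \<open>p\<close>-th power. And
    multiplying \<open>g\<close> by \<open>v = c(g)^a\<close> changes \<open>c(g)\<close> into
    \<open>c(g)^(1 + a h)\<close>, which lies in \<open>U\<close>.\<close>
  moreover obtain a b :: nat where ab: "1 + a * h = p * b"
  proof -
    obtain x y where xy: "p * x = h * y + 1" using bezout_nat[of p h] prime_gt_0_nat[OF p(1)] cop
      by (auto simp: coprime_commute coprime_iff_gcd_eq_1)
    then show ?thesis using that[of y x] by (simp add: mult.commute)
  qed
  moreover have "L \<noteq> carrier G"
  proof
    assume "L = carrier G"
    have "v \<in> U" if v: "v \<in> V" for v
    proof -
      have vc: "v \<in> carrier G" using v VG by auto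
      then have "v \<in> L" using \<open>L = carrier G\<close> by simp
      then have "v [^] h \<in> U" unfolding L_def cv[OF v, symmetric] by simp
      then have 1: "(v [^] h) [^] a \<in> U"
        using subgroup_int_pow_closed[OF Us, of "v [^] h" "int a"] by (simp add: int_pow_int)
      have "v [^] (1 + a * h) \<in> U" unfolding ab using UI[OF v] .
      moreover have "v \<otimes> (v [^] h) [^] a = v [^] (1 + a * h)"
        using vc nat_pow_Suc2[OF vc, of "a * h"] by (simp add: nat_pow_pow mult.commute)
      ultimately have "v \<otimes> (v [^] h) [^] a \<in> U" by (simp only:)
      then have "(v \<otimes> (v [^] h) [^] a) \<otimes> inv ((v [^] h) [^] a) \<in> U"
        by (rule subgroup.m_closed[OF Us _ subgroup.m_inv_closed[OF Us 1]])
      then show ?thesis using vc by (simp add: m_assoc)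
    qed
    then have "V \<subseteq> U" by (rule subsetI)
    then show False using UneV UV by simp
  qed
  moreover have "L <#> V = carrier G"
  proof
    show "L <#> V \<subseteq> carrier G" using VG by (intro setmult_subset_G) (auto simp: L_def)
    show "carrier G \<subseteq> L <#> V"
    proof
      fix g assume g: "g \<in> carrier G"
      define v where "v = c g [^] a"
      have cgV: "c g \<in> V" and cgG: "c g \<in> carrier G" using cV[OF g] VG by auto
      have vV: "v \<in> V" using A.nat_pow_closed[of "c g" a] cgV by (simp add: v_def A pA)
      then have vc: "v \<in> carrier G" using VG by auto
      have "c (v \<otimes> g) = (v \<otimes> c g \<otimes> inv v) \<otimes> c v" by (rule cmult[OF vc g])
      also have "v \<otimes> c g \<otimes> inv v = c g" using comm[OF vV cgV] vc cgG by (simp add: m_assoc)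
      also have "c g \<otimes> c v = c g [^] (1 + a * h)"
        using cv[OF vV] cgG nat_pow_Suc2[OF cgG, of "a * h"] by (simp add: v_def nat_pow_pow)
      also have "\<dots> \<in> U" unfolding ab using UI[OF cgV] .
      finally have vg: "v \<otimes> g \<in> L" using vc g by (simp add: L_def)
      define w where "w = inv (v \<otimes> g) \<otimes> inv v \<otimes> (v \<otimes> g)"
      have "w \<in> V" unfolding w_def
        using normal.inv_op_closed1[OF V(1), of "v \<otimes> g" "inv v"] vc g subgroup.m_inv_closed[OF Vs vV] by simp
      then have "(v \<otimes> g) \<otimes> w \<in> L <#> V" using vg unfolding set_mult_def by blast
      moreover have "(v \<otimes> g) \<otimes> w = g" using vc g by (simp add: w_def m_assoc[symmetric])
      ultimately show "g \<in> L <#> V" by (simp only:)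
    qed
  qed
  ultimately show ?thesis using that by blast
qed

text \<open>The derived series of \<open>N\<close> ends in a subgroup of infinite index, so some
  \<open>D i\<close> has finite index while \<open>D (Suc i)\<close> has not. Modulo
  \<open>D (Suc i)\<close>, the image of \<open>D i\<close> is abelian, infinite, and finitely
  generated by Schreier's lemma. A supplement of \<open>D i\<close> also supplements
  \<open>N\<close>, which contains it.\<close>

theorem (in group) solvable_supplement:
  assumes inf: "infinite (carrier G)" and S: "finite S" "S \<subseteq> carrier G" "generate G S = carrier G"
    and N: "N \<lhd> G" "finite_index G N" and solv: "(derived G ^^ d) N \<subseteq> {\<one>}"
  obtains L where "subgroup L G" "finite_index G L" "L \<noteq> carrier G" "L <#> N = carrier G"
proof -
  define D where "D i = (derived G ^^ i) N" for i
  have DN: "D i \<lhd> G" for i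
    by (induction i) (use N(1) derived_is_normal in \<open>auto simp: D_def\<close>)
  have Ds: "subgroup (D i) G" for i using DN by (rule normal_imp_subgroup)
  have D0: "D 0 = N" and DSuc: "D (Suc i) = derived G (D i)" for i by (simp_all add: D_def)
  have Dd: "\<not> finite_index G (D d)"
  proof
    assume fin: "finite_index G (D d)"
    have "finite C" if "C \<in> rcosets (D d)" for C
      using that solv finite_subset[of "D d" "{\<one>}"] by (auto simp: RCOSETS_def r_coset_def D_def)
    with fin have "finite (\<Union>(rcosets (D d)))" by (rule finite_Union)
    then show False using inf rcosets_part_G[OF Ds] by simp
  qed
  have "\<exists>i. finite_index G (D i) \<and> \<not> finite_index G (D (Suc i))"
  proof (rule ccontr)
    assume "\<not> ?thesis"
    then have "finite_index G (D i)" for i by (induction i) (use N(2) D0 in auto)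
    then show False using Dd by simp
  qed
  then obtain i where i: "finite_index G (D i)" "\<not> finite_index G (D (Suc i))" by blast
  define M K where "M = D i" and "K = derived G (D i)"
  have M: "M \<lhd> G" "subgroup M G" "finite_index G M" using DN Ds i by (auto simp: M_def)
  have K: "K \<lhd> G" "subgroup K G" "\<not> finite_index G K" using DN[of "Suc i"] Ds[of "Suc i"] i(2) by (auto simp: K_def DSuc)
  have MG: "M \<subseteq> carrier G" and KG: "K \<subseteq> carrier G" using M K subgroup.subset by auto
  have KM: "K \<subseteq> M" using derived_incl[OF subset_refl M(2)] by (simp add: K_def M_def)
  have DiN: "D j \<subseteq> N" for j
  proof (induction j)
    case (Suc j)
    then show ?case unfolding DSuc by (rule derived_incl[OF _ normal_imp_subgroup[OF N(1)]])
  qed (simp add: D0)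
  obtain Y where Y: "finite Y" "Y \<subseteq> M" "generate G Y = M"
    using finite_index_finitely_generated[OF S M(2,3)] .
  define Q where "Q = G Mod K"
  define r where "r g = K #> g" for g
  interpret Q: group Q unfolding Q_def using normal.factorgroup_is_group[OF K(1)] .
  have "r \<in> hom G Q" using normal.r_coset_hom_Mod[OF K(1)] by (simp add: r_def[abs_def] Q_def)
  then interpret r: group_hom G Q r
    by (intro group_hom.intro group_hom_axioms.intro group_axioms Q.group_axioms)
  have cQ: "r ` carrier G = carrier Q" by (simp add: Q_def r_def[abs_def] carrier_FactGroup)
  have rK: "r g = \<one>\<^bsub>Q\<^esub>" if "g \<in> K" for g
    using coset_join2[OF _ K(2) that] that KG by (auto simp: r_def Q_def)
  have Vs: "subgroup (r ` M) Q" using r.subgroup_img_is_subgroup[OF M(2)] .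
  obtain L where L: "subgroup L Q" "finite_index Q L" "L \<noteq> carrier Q" "L <#>\<^bsub>Q\<^esub> r ` M = carrier Q"
  proof (rule Q.abelian_supplement[of "r ` M" "r ` Y"])
    show "r ` M \<lhd> Q"
      unfolding Q.normal_inv_iff
    proof (intro conjI Vs ballI)
      fix x h assume "x \<in> carrier Q" "h \<in> r ` M"
      then obtain g n where gn: "g \<in> carrier G" "x = r g" "n \<in> M" "h = r n" unfolding cQ[symmetric] by auto
      then have "x \<otimes>\<^bsub>Q\<^esub> h \<otimes>\<^bsub>Q\<^esub> inv\<^bsub>Q\<^esub> x = r (g \<otimes> n \<otimes> inv g)" using MG by (auto simp: subset_iff)
      then show "x \<otimes>\<^bsub>Q\<^esub> h \<otimes>\<^bsub>Q\<^esub> inv\<^bsub>Q\<^esub> x \<in> r ` M" using normal.inv_op_closed2[OF M(1) gn(1,3)] by simp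
    qed
    show "finite_index Q (r ` M)"
    proof (rule finite_subset)
      show "finite ((\<lambda>C. r ` C) ` (rcosets M))" using M(3) by simp
      show "rcosets\<^bsub>Q\<^esub> (r ` M) \<subseteq> (\<lambda>C. r ` C) ` (rcosets M)"
      proof
        fix C assume "C \<in> rcosets\<^bsub>Q\<^esub> (r ` M)"
        then obtain g where g: "g \<in> carrier G" "C = r ` M #>\<^bsub>Q\<^esub> r g"
          unfolding Q.rcosets_image cQ[symmetric] by auto
        have "r ` (M #> g) = (\<lambda>m. r (m \<otimes> g)) ` M" by (auto simp: r_coset_def)
        also have "\<dots> = (\<lambda>m. r m \<otimes>\<^bsub>Q\<^esub> r g) ` M" using g(1) MG by (intro image_cong) auto
        also have "\<dots> = C" unfolding g(2) by (auto simp: r_coset_def)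
        finally show "C \<in> (\<lambda>C. r ` C) ` (rcosets M)" using imageI[OF rcosetsI[OF MG g(1)], of "\<lambda>C. r ` C"] by (simp only:)
      qed
    qed
    show "infinite (r ` M)"
    proof
      assume "finite (r ` M)"
      moreover have "rcosets\<^bsub>G\<lparr>carrier := M\<rparr>\<^esub> K = r ` M" by (auto simp: RCOSETS_def r_def)
      ultimately have "finite_index G K" using finite_index_trans[OF M(2,3) K(2) KM] by simp
      then show False using K(3) by simp
    qed
    show "x \<otimes>\<^bsub>Q\<^esub> y = y \<otimes>\<^bsub>Q\<^esub> x" if xy: "x \<in> r ` M" "y \<in> r ` M" for x y
    proof -
      obtain a b where ab: "a \<in> M" "b \<in> M" "x = r a" "y = r b" using xy by auto
      have c: "a \<in> carrier G" "b \<in> carrier G" using ab MG by auto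
      have "commutator G a b \<in> K" unfolding K_def derived_def M_def[symmetric]
        by (rule generate.incl) (use ab in blast)
      then have r1: "r (commutator G a b) = \<one>\<^bsub>Q\<^esub>" by (rule rK)
      have e: "a \<otimes> b = commutator G a b \<otimes> (b \<otimes> a)" using c by (simp add: m_assoc inv_cancel_assoc)
      have "r (a \<otimes> b) = r (commutator G a b \<otimes> (b \<otimes> a))" by (rule arg_cong[OF e])
      also have "\<dots> = r (commutator G a b) \<otimes>\<^bsub>Q\<^esub> r (b \<otimes> a)" by (rule r.hom_mult) (use c in auto)
      also have "\<dots> = r (b \<otimes> a)" unfolding r1 using c by simp
      finally have "r (a \<otimes> b) = r (b \<otimes> a)" .
      then show ?thesis using ab(3,4) c by simp
    qed
    show "finite (r ` Y)" "r ` Y \<subseteq> r ` M" using Y by auto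
    show "generate Q (r ` Y) = r ` M" using r.generate_img[of Y] Y MG by auto
  qed
  define L' where "L' = {g \<in> carrier G. r g \<in> L}"
  note pb = r.pullback_supplement[OF cQ L(1) MG L(4), folded L'_def]
  have "L' \<noteq> carrier G"
  proof
    assume "L' = carrier G"
    then have "carrier Q \<subseteq> L" unfolding cQ[symmetric] by (auto simp: L'_def)
    then show False using L(3) subgroup.subset[OF L(1)] by blast
  qed
  moreover have "L' <#> N = carrier G"
  proof
    show "L' <#> N \<subseteq> carrier G"
      using subgroup.subset[OF pb(1)] subgroup.subset[OF normal_imp_subgroup[OF N(1)]] by (rule setmult_subset_G)
    have "L' <#> M \<subseteq> L' <#> N" using DiN by (intro mono_set_mult) (auto simp: M_def)
    then show "carrier G \<subseteq> L' <#> N" using pb(2) by simp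
  qed
  ultimately show ?thesis using that[OF pb(1) pb(3)[OF L(2)]] by blast
qed

subsection \<open>Nilpotent groups of linear maps\<close>

lemma (in group) commutator_central:
  assumes a: "a \<in> carrier G" "\<And>y. y \<in> carrier G \<Longrightarrow> a \<otimes> y = y \<otimes> a"
    and gy: "g \<in> carrier G" "y \<in> carrier G"
  shows "commutator G (a \<otimes> g) y = commutator G g y" "commutator G y (a \<otimes> g) = commutator G y g"
proof -
  have ia: "inv a \<otimes> w = w \<otimes> inv a" if w: "w \<in> carrier G" for w
  proof -
    have "inv a \<otimes> w = inv a \<otimes> (w \<otimes> a) \<otimes> inv a" using a(1) w by (simp add: m_assoc)
    also have "w \<otimes> a = a \<otimes> w" using a(2)[OF w] by simp
    finally show ?thesis using a(1) w by (simp add: m_assoc inv_cancel_assoc)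
  qed
  have "commutator G (a \<otimes> g) y = a \<otimes> (g \<otimes> y \<otimes> inv g) \<otimes> inv a \<otimes> inv y"
    using a(1) gy by (simp add: m_assoc inv_mult_group)
  also have "a \<otimes> (g \<otimes> y \<otimes> inv g) = (g \<otimes> y \<otimes> inv g) \<otimes> a" using gy by (intro a(2)) auto
  finally show "commutator G (a \<otimes> g) y = commutator G g y"
    using a(1) gy by (simp add: m_assoc inv_cancel_assoc)
  have "commutator G y (a \<otimes> g) = (y \<otimes> a) \<otimes> g \<otimes> inv y \<otimes> inv g \<otimes> inv a"
    using a(1) gy by (simp add: m_assoc inv_mult_group)
  also have "y \<otimes> a = a \<otimes> y" using a(2)[OF gy(2)] by simp
  also have "a \<otimes> y \<otimes> g \<otimes> inv y \<otimes> inv g \<otimes> inv a = a \<otimes> (commutator G y g \<otimes> inv a)"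
    using a(1) gy by (simp add: m_assoc)
  also have "commutator G y g \<otimes> inv a = inv a \<otimes> commutator G y g" using gy by (intro ia[symmetric]) auto
  finally show "commutator G y (a \<otimes> g) = commutator G y g"
    using a(1) gy by (simp add: inv_cancel_assoc)
qed

text \<open>Conjugation by \<open>z\<close> multiplies every element by a central one, so it fixes all commutators.\<close>

lemma (in group) second_centre_centralizes_derived:
  assumes z: "z \<in> carrier G"
    and cen: "\<And>g y. g \<in> carrier G \<Longrightarrow> y \<in> carrier G \<Longrightarrow> commutator G z g \<otimes> y = y \<otimes> commutator G z g"
    and x: "x \<in> derived G (carrier G)"
  shows "z \<otimes> x = x \<otimes> z"
proof -
  define C where "C = {x \<in> carrier G. z \<otimes> x \<otimes> inv z = x}"
  have C: "subgroup C G"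
  proof (rule subgroupI)
    have "\<one> \<in> C" using z by (simp add: C_def)
    then show "C \<noteq> {}" by blast
    fix a assume "a \<in> C"
    then have a: "a \<in> carrier G" "z \<otimes> a \<otimes> inv z = a" by (auto simp: C_def)
    have "inv (z \<otimes> a \<otimes> inv z) = z \<otimes> inv a \<otimes> inv z" using a(1) z by (simp add: inv_mult_group m_assoc)
    then show "inv a \<in> C" using a by (simp add: C_def)
    fix b assume "b \<in> C"
    then have b: "b \<in> carrier G" "z \<otimes> b \<otimes> inv z = b" by (auto simp: C_def)
    have "z \<otimes> (a \<otimes> b) \<otimes> inv z = (z \<otimes> a \<otimes> inv z) \<otimes> (z \<otimes> b \<otimes> inv z)"
      using a(1) b(1) z by (simp add: m_assoc inv_cancel_assoc)
    then show "a \<otimes> b \<in> C" using a b by (simp add: C_def)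
  qed (auto simp: C_def)
  have "commutator G g h \<in> C" if gh: "g \<in> carrier G" "h \<in> carrier G" for g h
  proof -
    define k where "k g = commutator G z g" for g
    have kc: "k g \<in> carrier G" if "g \<in> carrier G" for g using z that by (simp add: k_def)
    have kg: "z \<otimes> g \<otimes> inv z = k g \<otimes> g" if "g \<in> carrier G" for g
      using z that by (simp add: k_def m_assoc)
    have "z \<otimes> commutator G g h \<otimes> inv z = commutator G (z \<otimes> g \<otimes> inv z) (z \<otimes> h \<otimes> inv z)"
      using gh z by (simp add: m_assoc inv_mult_group inv_cancel_assoc)
    also have "\<dots> = commutator G (k g \<otimes> g) (k h \<otimes> h)" using kg gh by simp
    also have "\<dots> = commutator G g (k h \<otimes> h)"
      by (rule commutator_central(1)) (use kc gh cen in \<open>auto simp: k_def\<close>)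
    also have "\<dots> = commutator G g h"
      by (rule commutator_central(2)) (use kc gh cen in \<open>auto simp: k_def\<close>)
    finally show ?thesis using gh by (simp add: C_def)
  qed
  then have "derived_set G (carrier G) \<subseteq> C" by blast
  then have "derived G (carrier G) \<subseteq> C" unfolding derived_def by (rule generate_subgroup_incl[OF _ C])
  then have xc: "x \<in> carrier G" "z \<otimes> x \<otimes> inv z = x" using x by (auto simp: C_def)
  have "z \<otimes> x = (z \<otimes> x \<otimes> inv z) \<otimes> z" using xc(1) z by (simp add: m_assoc)
  then show ?thesis using xc(2) by simp
qed

text \<open>\<open>z\<close> represents an element of the second centre of the nilpotent group
  \<open>H/T\<close> that is not central. If \<open>m\<close> is the least level of iterated
  commutators inside \<open>T\<close>, then \<open>m\<close> is at least 2 because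
  \<open>H/T\<close> is not abelian, and \<open>z\<close> is found at level
  \<open>m - 2\<close>.\<close>

lemma (in group) nilpotent_noncentral:
  assumes H: "subgroup H G" and T: "subgroup T G" "T \<subseteq> H"
    and Tn: "\<And>h t. h \<in> H \<Longrightarrow> t \<in> T \<Longrightarrow> h \<otimes> t \<otimes> inv h \<in> T"
    and nil: "iter_comm G H H c \<subseteq> T" and nab: "\<not> derived G H \<subseteq> T"
  obtains z g where "z \<in> H" "g \<in> H" "commutator G z g \<notin> T"
    "\<And>x. x \<in> derived G H \<Longrightarrow> commutator G z x \<in> T"
proof -
  have HG: "H \<subseteq> carrier G" using subgroup.subset[OF H] .
  define m where "m = (LEAST c. iter_comm G H H c \<subseteq> T)"
  have m: "iter_comm G H H m \<subseteq> T" unfolding m_def using nil by (rule LeastI)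
  have least: "\<not> iter_comm G H H j \<subseteq> T" if "j < m" for j
    using not_less_Least[of j] that unfolding m_def by blast
  have "derived_set G H \<subseteq> T" if "iter_comm G H H 1 \<subseteq> T"
  proof -
    have "derived_set G H \<subseteq> iter_comm G H H 1" by force
    then show ?thesis using that by (rule subset_trans)
  qed
  then have m1: "m \<noteq> 1" using m nab generate_subgroup_incl[OF _ T(1)] unfolding derived_def by blast
  have m0: "m \<noteq> 0"
  proof
    assume "m = 0"
    then have "H \<subseteq> T" using m by simp
    then show False using derived_incl[OF subset_refl H] nab by blast
  qed
  obtain k where k: "m = Suc (Suc k)" using m0 m1 by (metis One_nat_def not0_implies_Suc)
  have sub: "iter_comm G H H k \<subseteq> H" by (rule iter_comm_subgroup[OF H])
  have "\<not> iter_comm G H H (Suc k) \<subseteq> T" by (rule least) (simp add: k)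
  then obtain z g where zg: "z \<in> iter_comm G H H k" "g \<in> H" "commutator G z g \<notin> T" by auto
  have zH: "z \<in> H" using zg sub by blast
  have cen: "commutator G (commutator G z g) y \<in> T" if "g \<in> H" "y \<in> H" for g y
  proof -
    have "commutator G z g \<in> iter_comm G H H (Suc k)" using zg(1) that(1) by auto
    then have "commutator G (commutator G z g) y \<in> iter_comm G H H (Suc (Suc k))"
      using that(2) unfolding iter_comm.simps(2)[of G H H "Suc k"] by (intro image_eqI[of _ _ "(commutator G z g, y)"]) auto
    then show ?thesis using m k by blast
  qed
  define HH where "HH = G\<lparr>carrier := H\<rparr>"
  interpret HH: group HH unfolding HH_def by (rule subgroup_imp_group[OF H])
  have HHs: "carrier HH = H" "monoid.mult HH = monoid.mult G" "one HH = \<one>" by (auto simp: HH_def)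
  have invH: "inv\<^bsub>HH\<^esub> x = inv x" if "x \<in> H" for x
    using m_inv_consistent[OF H that] by (simp add: HH_def)
  have comH: "commutator HH x y = commutator G x y" if "x \<in> H" "y \<in> H" for x y
    using that invH by (simp add: HHs)
  have TH: "T \<lhd> HH"
    unfolding HH.normal_inv_iff using subgroup_incl[OF T(1) H T(2)] Tn invH by (simp add: HHs HH_def[symmetric])
  define Q where "Q = HH Mod T"
  define r where "r g = T #>\<^bsub>HH\<^esub> g" for g
  interpret Q: group Q unfolding Q_def using normal.factorgroup_is_group[OF TH] .
  have "r \<in> hom HH Q" using normal.r_coset_hom_Mod[OF TH] by (simp add: r_def[abs_def] Q_def)
  then interpret r: group_hom HH Q r
    by (intro group_hom.intro group_hom_axioms.intro HH.group_axioms Q.group_axioms)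
  have cQ: "carrier Q = r ` H" by (simp add: Q_def r_def[abs_def] carrier_FactGroup HHs)
  have comm_iff: "commutator G x y \<in> T \<longleftrightarrow> r x \<otimes>\<^bsub>Q\<^esub> r y = r y \<otimes>\<^bsub>Q\<^esub> r x" if "x \<in> H" "y \<in> H" for x y
    using HH.commutator_mem_iff[OF TH, of x y] that comH
    by (simp add: HHs r_def r.hom_mult[unfolded r_def, symmetric])
  have rH: "r x \<in> carrier Q" if "x \<in> H" for x using that by (simp add: cQ)
  have rc: "r (commutator G x y) = commutator Q (r x) (r y)" if "x \<in> H" "y \<in> H" for x y
  proof -
    have "x \<in> carrier HH" "y \<in> carrier HH" using that by (simp_all add: HHs(1))
    then have "r (commutator HH x y) = commutator Q (r x) (r y)" by simp
    then show ?thesis using comH[OF that] by simp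
  qed
  have comcl: "commutator G x y \<in> H" if "x \<in> H" "y \<in> H" for x y
    using that subgroup.m_closed[OF H] subgroup.m_inv_closed[OF H] by simp
  have "commutator G z x \<in> T" if x: "x \<in> derived G H" for x
  proof -
    have xH: "x \<in> H" using derived_incl[OF subset_refl H] x by blast
    have "derived HH H = derived G H" unfolding HH_def by (rule derived_consistent[OF subset_refl H])
    then have "r x \<in> derived Q (carrier Q)"
      using r.derived_img[of H] x by (simp add: HHs cQ)
    then have "r z \<otimes>\<^bsub>Q\<^esub> r x = r x \<otimes>\<^bsub>Q\<^esub> r z"
    proof (rule Q.second_centre_centralizes_derived[OF rH[OF zH], rotated])
      fix a b assume "a \<in> carrier Q" "b \<in> carrier Q"
      then obtain g y where gy: "g \<in> H" "y \<in> H" "a = r g" "b = r y" by (auto simp: cQ)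
      have "r (commutator G z g) \<otimes>\<^bsub>Q\<^esub> r y = r y \<otimes>\<^bsub>Q\<^esub> r (commutator G z g)"
        using comm_iff[OF comcl[OF zH gy(1)] gy(2)] cen[OF gy(1,2)] by blast
      then show "commutator Q (r z) a \<otimes>\<^bsub>Q\<^esub> b = b \<otimes>\<^bsub>Q\<^esub> commutator Q (r z) a"
        unfolding gy(3,4) rc[OF zH gy(1)] .
    qed
    then show ?thesis using comm_iff[OF zH xH] by blast
  qed
  then show ?thesis using that zH zg(2,3) by blast
qed

lemma (in group) derived_pow_subset:
  "subgroup H G \<Longrightarrow> (derived G ^^ k) H \<subseteq> H"
  using derived_incl by (induction k) auto

section \<open>Modules between \<open>M^n\<close> and \<open>A^n\<close>\<close>

definition scl :: "'a::semigroup_mult \<Rightarrow> (nat \<Rightarrow> 'a) \<Rightarrow> nat \<Rightarrow> 'a" where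
  "scl a v = (\<lambda>i. a * v i)"

text \<open>Vectors are functions that vanish from \<open>n\<close> on, so that the dimension is a
  term and not a type; the set is \<open>A\<close> or \<open>M\<close>, giving \<open>A^n\<close>
  and \<open>M^n\<close>.\<close>

definition lattice_over :: "'a::zero set \<Rightarrow> nat \<Rightarrow> (nat \<Rightarrow> 'a) set" where
  "lattice_over A n = {v. (\<forall>i<n. v i \<in> A) \<and> (\<forall>i\<ge>n. v i = 0)}"

definition submod :: "'a::comm_ring_1 set \<Rightarrow> (nat \<Rightarrow> 'a) set \<Rightarrow> bool" where
  "submod A W \<longleftrightarrow> 0 \<in> W \<and> (\<forall>v\<in>W. \<forall>w\<in>W. v + w \<in> W) \<and> (\<forall>a\<in>A. \<forall>v\<in>W. scl a v \<in> W)"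

lemma submodD:
  assumes "submod A W"
  shows "0 \<in> W" "v \<in> W \<Longrightarrow> w \<in> W \<Longrightarrow> v + w \<in> W" "a \<in> A \<Longrightarrow> v \<in> W \<Longrightarrow> scl a v \<in> W"
  using assms by (auto simp: submod_def)

lemma submod_diff:
  assumes "submod A W" "subring_set A"
  shows "v \<in> W \<Longrightarrow> - v \<in> W" "v \<in> W \<Longrightarrow> w \<in> W \<Longrightarrow> v - w \<in> W"
proof -
  have m: "- v \<in> W" if "v \<in> W" for v
  proof -
    have "-1 \<in> A" using subring_setD(5)[OF assms(2) subring_setD(1)[OF assms(2)]] .
    then have "scl (-1) v \<in> W" using submodD(3)[OF assms(1)] that by blast
    moreover have "scl (-1) v = - v" by (auto simp: scl_def)
    ultimately show ?thesis by simp
  qed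
  then show "v \<in> W \<Longrightarrow> - v \<in> W" .
  show "v \<in> W \<Longrightarrow> w \<in> W \<Longrightarrow> v - w \<in> W" using m[of w] submodD(2)[OF assms(1), of v "- w"] by simp
qed

text \<open>For \<open>M\<^sup>n \<subseteq> W \<subseteq> A\<^sup>n\<close>, the pivots count the dimension of \<open>W / M\<^sup>n\<close> over the residue field.\<close>

definition pivots :: "'a set \<Rightarrow> nat \<Rightarrow> (nat \<Rightarrow> 'a) set \<Rightarrow> nat set" where
  "pivots M n W = {i. i < n \<and> (\<exists>v\<in>W. v i \<notin> M \<and> (\<forall>j>i. v j \<in> M))}"

text \<open>Gaussian elimination from the top coordinate down. If \<open>W'\<close> has no new
  pivot, a vector of \<open>W'\<close> whose last coordinate outside \<open>M\<close> is the
  \<open>k\<close>-th can be corrected by a multiple of a vector of \<open>W\<close> with pivot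
  \<open>k\<close>, whose entry there has its inverse in \<open>A\<close>. What remains in the end
  lies in \<open>M^n\<close>, hence in \<open>W\<close>.\<close>

lemma pivots_strict_mono:
  assumes pl: "place A M" and W: "submod A W" "submod A W'"
    and sub: "lattice_over M n \<subseteq> W" "W \<subset> W'" "W' \<subseteq> lattice_over A n"
  shows "card (pivots M n W) < card (pivots M n W')"
proof (rule ccontr)
  note A = placeD(1)[OF pl]
  assume "\<not> card (pivots M n W) < card (pivots M n W')"
  moreover have "pivots M n W \<subseteq> pivots M n W'" using sub(2) by (auto simp: pivots_def)
  moreover have "finite (pivots M n W')" by (simp add: pivots_def)
  ultimately have eq: "pivots M n W = pivots M n W'" by (metis card_seteq not_less)
  have main: "v \<in> W" if "v \<in> W'" "\<forall>j\<ge>k. v j \<in> M" for v k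
    using that
  proof (induction k arbitrary: v)
    case 0
    then have "v \<in> lattice_over M n" using sub(3) by (auto simp: lattice_over_def)
    then show ?case using sub(1) by blast
  next
    case (Suc k)
    show ?case
    proof (cases "v k \<in> M")
      case True
      then have "\<forall>j\<ge>k. v j \<in> M" using Suc.prems(2) by (metis Suc_leI le_neq_implies_less)
      then show ?thesis using Suc by blast
    next
      case False
      have "k < n"
      proof (rule ccontr)
        assume "\<not> k < n"
        then have "v k = 0" using Suc.prems(1) sub(3) by (auto simp: lattice_over_def)
        then show False using False placeD(3)[OF pl] by simp
      qed
      then have "k \<in> pivots M n W'" using False Suc.prems by (auto simp: pivots_def Suc_le_eq)
      then obtain w where w: "w \<in> W" "w k \<notin> M" "\<forall>j>k. w j \<in> M" unfolding eq[symmetric] by (auto simp: pivots_def)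
      have "w k \<noteq> 0" using w(2) placeD(3)[OF pl] by auto
      have vA: "v k \<in> A" using Suc.prems(1) sub(3) \<open>k < n\<close> by (auto simp: lattice_over_def)
      define a where "a = v k * inverse (w k)"
      have a: "a \<in> A" unfolding a_def by (rule subring_setD(4)[OF A vA place_inverse[OF pl w(2)]])
      have aw: "scl a w \<in> W" by (rule submodD(3)[OF W(1) a w(1)])
      have "v - scl a w \<in> W'" using submod_diff(2)[OF W(2) A Suc.prems(1)] aw sub(2) by blast
      moreover have "\<forall>j\<ge>k. (v - scl a w) j \<in> M"
      proof (intro allI impI)
        fix j assume j: "j \<ge> k"
        show "(v - scl a w) j \<in> M"
        proof (cases "j = k")
          case True
          then show ?thesis using \<open>w k \<noteq> 0\<close> placeD(3)[OF pl] by (simp add: scl_def a_def mult.assoc)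
        next
          case False
          then have "v j \<in> M" "w j \<in> M" using j Suc.prems(2) w(3) by auto
          then show ?thesis using place_diff(1)[OF pl _ placeD(6)[OF pl a]] by (simp add: scl_def)
        qed
      qed
      ultimately have "v - scl a w \<in> W" by (rule Suc.IH)
      then have "(v - scl a w) + scl a w \<in> W" by (rule submodD(2)[OF W(1) _ aw])
      then show ?thesis by simp
    qed
  qed
  have "W' \<subseteq> W"
  proof
    fix v assume v: "v \<in> W'"
    then have "\<forall>j\<ge>n. v j \<in> M" using sub(3) placeD(3)[OF pl] by (auto simp: lattice_over_def)
    then show "v \<in> W" by (rule main[OF v])
  qed
  then show False using sub(2) by blast
qed

lemma pivots_le: "card (pivots M n W) \<le> n"
proof -
  have "pivots M n W \<subseteq> {..<n}" by (auto simp: pivots_def)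
  then show ?thesis using card_mono[of "{..<n}"] by fastforce
qed

text \<open>The laws involving the group structure are restricted to the lattice because a matrix
  discards the coordinates from \<open>n\<close> on; its identity fixes only vectors supported below
  \<open>n\<close>.\<close>

locale lattice_action = group G for G :: "('g, 'm) monoid_scheme" (structure) +
  fixes A M :: "'a::alg_closed_field set" and n :: nat and act :: "'g \<Rightarrow> (nat \<Rightarrow> 'a) \<Rightarrow> nat \<Rightarrow> 'a"
  assumes place: "place A M"
    and act_add: "g \<in> carrier G \<Longrightarrow> act g (v + w) = act g v + act g w"
    and act_scl: "g \<in> carrier G \<Longrightarrow> act g (scl a v) = scl a (act g v)"
    and act_mult: "g \<in> carrier G \<Longrightarrow> h \<in> carrier G \<Longrightarrow> v \<in> lattice_over A n \<Longrightarrow> act (g \<otimes> h) v = act g (act h v)"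
    and act_one: "v \<in> lattice_over A n \<Longrightarrow> act \<one> v = v"
begin

lemmas subring = placeD(1)[OF place]

lemma act_zero: "g \<in> carrier G \<Longrightarrow> act g 0 = 0"
  using act_add[of g 0 0] by simp

lemma act_diff: "g \<in> carrier G \<Longrightarrow> act g (v - w) = act g v - act g w"
  using act_add[of g "v - w" w] by (simp add: algebra_simps)

text \<open>The vector \<open>p(z) v\<close>, with the polynomial in the operator
  \<open>act z\<close> evaluated by Horner's rule, so that no algebra of operators has to be set
  up.\<close>

definition horner :: "'g \<Rightarrow> 'a poly \<Rightarrow> (nat \<Rightarrow> 'a) \<Rightarrow> nat \<Rightarrow> 'a" where
  "horner z p v = fold_coeffs (\<lambda>a w. scl a v + act z w) p 0"

lemma scl_simps: "scl 0 v = 0" "scl 1 v = v" "scl (a + b) v = scl a v + scl b v" "scl (a * b) v = scl a (scl b v)"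
    "scl a 0 = 0" "scl a (v + w) = scl a v + scl a w" "scl (- a) v = - scl a v" for a b :: 'a
  by (auto simp: scl_def algebra_simps fun_eq_iff)

lemma horner_0: "horner z 0 v = 0"
  by (simp add: horner_def)

lemma horner_pCons:
  assumes "z \<in> carrier G"
  shows "horner z (pCons a p) v = scl a v + act z (horner z p v)"
  by (cases "a = 0 \<and> p = 0") (auto simp: horner_def scl_simps act_zero[OF assms])

lemma horner_add:
  assumes "z \<in> carrier G"
  shows "horner z (p + q) v = horner z p v + horner z q v"
proof (induction p q rule: poly_induct2)
  case (pCons a p b q)
  then show ?case
    by (simp only: add_pCons horner_pCons[OF assms] scl_simps act_add[OF assms] ac_simps)
qed (simp only: horner_0 add_0_left)

lemma horner_smult:
  assumes "z \<in> carrier G"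
  shows "horner z (smult c p) v = scl c (horner z p v)"
proof (induction p)
  case (pCons a p)
  show ?case
    by (simp only: smult_pCons horner_pCons[OF assms] pCons.IH scl_simps act_scl[OF assms])
qed (simp only: smult_0_right horner_0 scl_simps)

lemma horner_linear_factor:
  assumes "z \<in> carrier G"
  shows "horner z ([:- c, 1:] * q) v = act z (horner z q v) - scl c (horner z q v)"
proof -
  have "[:- c, 1:] * q = smult (- c) q + pCons 0 q" by simp
  then show ?thesis
    by (simp only: horner_add[OF assms] horner_smult[OF assms] horner_pCons[OF assms] scl_simps
        add_0_left uminus_add_conv_diff)
qed

lemma horner_monom:
  assumes "z \<in> carrier G" "v \<in> lattice_over A n" "\<And>g. g \<in> carrier G \<Longrightarrow> act g v \<in> lattice_over A n"
  shows "horner z (monom 1 e) v = act (z [^] e) v"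
proof (induction e)
  case 0
  show ?case
    by (simp only: monom_0 horner_pCons[OF assms(1)] horner_0 scl_simps act_zero[OF assms(1)] add_0_right
        nat_pow_0 act_one[OF assms(2)])
next
  case (Suc e)
  have e: "z [^] Suc e = z \<otimes> z [^] e" using assms(1) by (rule nat_pow_Suc2)
  show ?case
    by (simp only: monom_Suc horner_pCons[OF assms(1)] Suc e scl_simps add_0_left
        act_mult[OF assms(1) nat_pow_closed[OF assms(1)] assms(2)])
qed

text \<open>\<open>X^e - 1\<close> splits into linear factors whose roots, being roots of unity, lie
  in \<open>A\<close>. Applied to \<open>v\<close> one after the other, the factors lead from
  outside \<open>U\<close> into \<open>U\<close>; the last vector still outside is an eigenvector
  modulo \<open>U\<close>. Nothing is assumed about \<open>e\<close> and the residue
  characteristic.\<close>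

lemma eigenvector:
  assumes z: "z \<in> carrier G" and V: "submod A V" "V \<subseteq> lattice_over A n" "\<And>g v. g \<in> carrier G \<Longrightarrow> v \<in> lattice_over A n \<Longrightarrow> act g v \<in> lattice_over A n"
    and zV: "\<And>v. v \<in> V \<Longrightarrow> act z v \<in> V" and v: "v \<in> V" "v \<notin> U"
    and e: "(e::nat) > 0" "act (z [^] e) v - v \<in> U"
  obtains c w where "c \<in> A" "w \<in> V" "w \<notin> U" "act z w - scl c w \<in> U"
proof -
  let ?p = "monom (1::'a) e - 1"
  have deg: "degree ?p = e" "lead_coeff ?p = 1"
  proof -
    have "?p = monom 1 e + (- 1)" by simp
    moreover have "degree (- 1 :: 'a poly) < degree (monom (1::'a) e)" using e by (simp add: degree_monom_eq)
    ultimately show "degree ?p = e" "lead_coeff ?p = 1"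
      using degree_add_eq_left[of "- 1" "monom (1::'a) e"] lead_coeff_add_le[of "- 1" "monom (1::'a) e"] e
      by (auto simp: degree_monom_eq coeff_eq_0)
  qed
  then have "?p \<noteq> 0" by auto
  then obtain B where B: "?p = smult (lead_coeff ?p) (\<Prod>x\<in>#B. [:- x, 1:])"
    using alg_closed_imp_factorization by blast
  obtain zs where zs: "mset zs = B" using ex_mset by blast
  have pz: "?p = prod_list (map (\<lambda>x. [:- x, 1:]) zs)"
    using B unfolding deg(2) smult_1_left zs[symmetric] prod_mset_prod_list[symmetric] mset_map .
  have zA: "c \<in> A" if "c \<in> set zs" for c
  proof -
    have "poly ?p c = 0" unfolding pz using that by (induction zs) auto
    then have "c ^ e = 1" by (simp add: poly_monom)
    then show ?thesis using place_root_of_unity[OF place _ e(1)] by blast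
  qed
  have horner_1: "horner z 1 v = v"
    by (simp only: one_pCons horner_pCons[OF z] horner_0 act_zero[OF z] scl_simps add_0_right)
  have inV: "horner z (prod_list (map (\<lambda>x. [:- x, 1:]) ys)) v \<in> V" if "set ys \<subseteq> A" for ys
    using that
  proof (induction ys)
    case Nil
    show ?case using v(1) by (simp only: list.map prod_list.Nil horner_1)
  next
    case (Cons c ys)
    then show ?case
      unfolding list.map prod_list.Cons horner_linear_factor[OF z]
      by (intro submod_diff(2)[OF V(1) subring] zV submodD(3)[OF V(1)]) auto
  qed
  have key: "\<exists>c\<in>set ys. \<exists>w\<in>V. w \<notin> U \<and> act z w - scl c w \<in> U"
    if "set ys \<subseteq> A" "horner z (prod_list (map (\<lambda>x. [:- x, 1:]) ys)) v \<in> U" for ys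
    using that
  proof (induction ys)
    case Nil
    then show ?case using v(2) by (simp only: list.map prod_list.Nil horner_1)
  next
    case (Cons c ys)
    define w where "w = horner z (prod_list (map (\<lambda>x. [:- x, 1:]) ys)) v"
    have w: "w \<in> V" using inV[of ys] Cons.prems(1) by (simp add: w_def)
    have wU: "act z w - scl c w \<in> U"
      using Cons.prems(2) unfolding list.map prod_list.Cons horner_linear_factor[OF z] w_def .
    show ?case
    proof (cases "w \<in> U")
      case True
      then show ?thesis using Cons by (auto simp: w_def)
    next
      case False
      then show ?thesis by (intro bexI[of _ c] bexI[of _ w] conjI wU w list.set_intros(1))
    qed
  qed
  have p: "horner z ?p v = act (z [^] e) v - v"
  proof -
    have 1: "?p = monom 1 e + [:- 1:]" by (simp add: one_pCons)
    have 2: "horner z [:- 1:] v = - v"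
      by (simp only: horner_pCons[OF z] horner_0 act_zero[OF z] scl_simps add_0_right)
    have 3: "horner z (monom 1 e) v = act (z [^] e) v"
      using horner_monom[OF z, of v e] v V by blast
    show ?thesis by (simp only: 1 horner_add[OF z] 2 3 add_uminus_conv_diff)
  qed
  have zsA: "set zs \<subseteq> A" using zA by blast
  have "horner z ?p v \<in> U" unfolding p by (rule e(2))
  then have "\<exists>c\<in>set zs. \<exists>w\<in>V. w \<notin> U \<and> act z w - scl c w \<in> U"
    unfolding pz by (rule key[OF zsA])
  then obtain c w where "c \<in> set zs" "w \<in> V" "w \<notin> U" "act z w - scl c w \<in> U" by blast
  then show ?thesis by (intro that[of c w] zA)
qed

definition trivial_on :: "(nat \<Rightarrow> 'a) set \<Rightarrow> (nat \<Rightarrow> 'a) set \<Rightarrow> 'g \<Rightarrow> bool" where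
  "trivial_on V U g \<longleftrightarrow> (\<forall>v\<in>V. act g v - v \<in> U)"

lemma trivial_on_mono: "trivial_on V U g \<Longrightarrow> V' \<subseteq> V \<Longrightarrow> U \<subseteq> U' \<Longrightarrow> trivial_on V' U' g"
  by (auto simp: trivial_on_def)

context
  fixes U V :: "(nat \<Rightarrow> 'a) set" and H :: "'g set"
  assumes U: "submod A U" and V: "submod A V" "V \<subseteq> lattice_over A n" and UV: "U \<subseteq> V"
    and H: "subgroup H G"
    and HU: "\<And>h u. h \<in> H \<Longrightarrow> u \<in> U \<Longrightarrow> act h u \<in> U" and HV: "\<And>h v. h \<in> H \<Longrightarrow> v \<in> V \<Longrightarrow> act h v \<in> V"
begin

lemma H_carrier: "h \<in> H \<Longrightarrow> h \<in> carrier G"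
  using subgroup.subset[OF H] by blast

lemma act_inv: "h \<in> H \<Longrightarrow> v \<in> V \<Longrightarrow> act (inv h) (act h v) = v" "h \<in> H \<Longrightarrow> v \<in> V \<Longrightarrow> act h (act (inv h) v) = v"
  using act_mult[of "inv h" h v, symmetric] act_mult[of h "inv h" v, symmetric] act_one[of v] H_carrier V(2) by auto

lemma trivial_mult:
  assumes g: "g \<in> H" "trivial_on V U g" and h: "h \<in> H" "trivial_on V U h"
  shows "trivial_on V U (g \<otimes> h)"
  unfolding trivial_on_def
proof
  fix v assume v: "v \<in> V"
  have eq: "act (g \<otimes> h) v - v = act g (act h v - v) + (act g v - v)"
    using act_mult[of g h v] act_diff[of g "act h v" v] H_carrier g h v V(2) by auto
  have "act h v - v \<in> U" and 1: "act g v - v \<in> U" using g h v by (auto simp: trivial_on_def)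
  then have "act g (act h v - v) \<in> U" by (intro HU[OF g(1)])
  then show "act (g \<otimes> h) v - v \<in> U" unfolding eq by (rule submodD(2)[OF U _ 1])
qed

lemma trivial_inv:
  assumes g: "g \<in> H" "trivial_on V U g"
  shows "trivial_on V U (inv g)"
  unfolding trivial_on_def
proof
  fix v assume v: "v \<in> V"
  have ig: "inv g \<in> H" using subgroup.m_inv_closed[OF H g(1)] .
  have "act (inv g) v - v = - act (inv g) (act g v - v)"
    using act_diff[of "inv g" "act g v" v] act_inv(1)[OF g(1) v] H_carrier[OF ig] by simp
  moreover have "act g v - v \<in> U" using g(2) v by (auto simp: trivial_on_def)
  ultimately show "act (inv g) v - v \<in> U"
    using HU[OF ig] submod_diff(1)[OF U subring] by simp
qed

lemma trivial_conj:
  assumes h: "h \<in> H" and g: "g \<in> H" "trivial_on V U g"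
  shows "trivial_on V U (h \<otimes> g \<otimes> inv h)"
  unfolding trivial_on_def
proof
  fix v assume v: "v \<in> V"
  have ih: "inv h \<in> H" using subgroup.m_inv_closed[OF H h] .
  define w where "w = act (inv h) v"
  have w: "w \<in> V" "act h w = v" using HV[OF ih v] act_inv(2)[OF h v] by (auto simp: w_def)
  have "act (h \<otimes> g \<otimes> inv h) v = act (h \<otimes> g) w"
    unfolding w_def using H_carrier h g(1) ih v V(2) by (intro act_mult) auto
  also have "\<dots> = act h (act g w)" using H_carrier h g(1) w V(2) by (intro act_mult) auto
  finally have "act (h \<otimes> g \<otimes> inv h) v - v = act h (act g w - w)"
    using act_diff[OF H_carrier[OF h]] w(2) by simp
  moreover have "act g w - w \<in> U" using g(2) w(1) by (auto simp: trivial_on_def)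
  ultimately show "act (h \<otimes> g \<otimes> inv h) v - v \<in> U" using HU[OF h] by simp
qed

lemma trivial_subgroup: "subgroup {h \<in> H. trivial_on V U h} G"
proof (rule subgroupI)
  show "{h \<in> H. trivial_on V U h} \<subseteq> carrier G" using H_carrier by blast
  have "trivial_on V U \<one>"
    unfolding trivial_on_def using act_one V(2) submodD(1)[OF U] by auto
  then show "{h \<in> H. trivial_on V U h} \<noteq> {}" using subgroup.one_closed[OF H] by blast
qed (use trivial_inv trivial_mult subgroup.m_inv_closed[OF H] subgroup.m_closed[OF H] in auto)

lemma trivial_commutator_iff:
  assumes gh: "g \<in> H" "h \<in> H"
  shows "trivial_on V U (commutator G g h) \<longleftrightarrow> (\<forall>v\<in>V. act g (act h v) - act h (act g v) \<in> U)"
proof -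
  have hg: "h \<otimes> g \<in> H" "g \<otimes> h \<in> H" using subgroup.m_closed[OF H] gh by auto
  have ihg: "inv (h \<otimes> g) \<in> H" using subgroup.m_inv_closed[OF H hg(1)] .
  have c: "commutator G g h = (g \<otimes> h) \<otimes> inv (h \<otimes> g)"
    using H_carrier gh by (simp add: m_assoc inv_mult_group)
  have act2: "act (g \<otimes> h) v = act g (act h v)" "act (h \<otimes> g) v = act h (act g v)" if "v \<in> V" for v
    using act_mult H_carrier gh that V(2) by auto
  show ?thesis
  proof
    assume t: "trivial_on V U (commutator G g h)"
    show "\<forall>v\<in>V. act g (act h v) - act h (act g v) \<in> U"
    proof
      fix v assume v: "v \<in> V"
      define w where "w = act (h \<otimes> g) v"
      have w: "w \<in> V" "act (inv (h \<otimes> g)) w = v"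
        using HV[OF hg(1) v] act_inv(1)[OF hg(1) v] by (auto simp: w_def)
      have "act (commutator G g h) w = act (g \<otimes> h) v"
        unfolding c using act_mult[of "g \<otimes> h" "inv (h \<otimes> g)" w] H_carrier hg ihg w V(2) by auto
      then show "act g (act h v) - act h (act g v) \<in> U"
        using t w(1) act2[OF v] by (auto simp: trivial_on_def w_def)
    qed
  next
    assume r: "\<forall>v\<in>V. act g (act h v) - act h (act g v) \<in> U"
    show "trivial_on V U (commutator G g h)"
      unfolding trivial_on_def
    proof
      fix w assume w: "w \<in> V"
      define v where "v = act (inv (h \<otimes> g)) w"
      have v: "v \<in> V" "act (h \<otimes> g) v = w"
        using HV[OF ihg w] act_inv(2)[OF hg(1) w] by (auto simp: v_def)
      have "act (commutator G g h) w = act (g \<otimes> h) v"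
        unfolding c v_def using act_mult[of "g \<otimes> h" "inv (h \<otimes> g)" w] H_carrier hg ihg w V(2) by auto
      then show "act (commutator G g h) w - w \<in> U"
        using bspec[OF r v(1)] act2[OF v(1)] v(2) by simp
    qed
  qed
qed

end

text \<open>If the group does not act by commuting maps on \<open>V/U\<close>, there is a noncentral \<open>z\<close> that
  commutes with the derived subgroup, and an eigenspace of \<open>z\<close> on \<open>V/U\<close> splits the problem.\<close>

theorem nilpotent_derived_trivial:
  assumes pres: "\<And>g v. g \<in> carrier G \<Longrightarrow> v \<in> lattice_over A n \<Longrightarrow> act g v \<in> lattice_over A n"
    and "submod A U" "submod A V" "lattice_over M n \<subseteq> U" "U \<subseteq> V" "V \<subseteq> lattice_over A n"
    and "subgroup H G" "\<And>h u. h \<in> H \<Longrightarrow> u \<in> U \<Longrightarrow> act h u \<in> U" "\<And>h v. h \<in> H \<Longrightarrow> v \<in> V \<Longrightarrow> act h v \<in> V"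
    and "\<And>h. h \<in> H \<Longrightarrow> \<exists>e>0. trivial_on V U (h [^] (e::nat))"
    and "\<And>x. x \<in> iter_comm G H H c \<Longrightarrow> trivial_on V U x"
    and "card (pivots M n V) \<le> card (pivots M n U) + l"
    and "x \<in> (derived G ^^ (2 * l)) H"
  shows "trivial_on V U x"
  using assms(2-)
proof (induction l arbitrary: U V H x)
  \<comment> \<open>Without new pivots \<open>U = V\<close>, and triviality modulo \<open>V\<close>
    is mere invariance of \<open>V\<close>.\<close>
  case 0
  have "U = V"
    using pivots_strict_mono[OF place 0(1,2,3) _ 0(5)] 0(4,11) by auto
  moreover have "act x v - v \<in> V" if "v \<in> V" for v
    using 0 that by (intro submod_diff(2)[OF 0(2) subring]) auto
  ultimately show ?case by (simp add: trivial_on_def)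
next
  case (Suc l)
  note U = Suc.prems(1) and V = Suc.prems(2,5) and MU = Suc.prems(3) and UV = Suc.prems(4) and H = Suc.prems(6)
    and HU = Suc.prems(7) and HV = Suc.prems(8) and ex = Suc.prems(9) and nil = Suc.prems(10) and piv = Suc.prems(11)
  note facts = U V UV H HU HV
  define T where "T = {h \<in> H. trivial_on V U h}"
  have T: "subgroup T G" unfolding T_def by (rule trivial_subgroup) (fact facts)+
  \<comment> \<open>Each level of the induction spends two derivations: the first replaces
    \<open>H\<close> by its derived subgroup, which preserves the eigenspace; the last turns
    triviality on both layers \<open>V/W\<close> and \<open>W/U\<close> into triviality on
    \<open>V/U\<close>.\<close>
  have xd: "x \<in> (derived G ^^ (2 * l)) (derived G (derived G H))"
    using Suc.prems(12) by (simp add: funpow_swap1)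
  have dH: "subgroup (derived G H) G" by (rule derived_is_subgroup[OF subgroup.subset[OF H]])
  have dHH: "derived G H \<subseteq> H" by (rule derived_incl[OF subset_refl H])
  have comm_T: "commutator G p q \<in> T" if "p \<in> H" "q \<in> H" "trivial_on V U (commutator G p q)" for p q
    using that subgroup.m_closed[OF H] subgroup.m_inv_closed[OF H] by (simp add: T_def)
  have tci: "trivial_on V U (commutator G p q) \<longleftrightarrow> (\<forall>v\<in>V. act p (act q v) - act q (act p v) \<in> U)"
    if "p \<in> H" "q \<in> H" for p q
    by (rule trivial_commutator_iff) (fact facts that)+
  show ?case
  proof (cases "derived G H \<subseteq> T")
    case True
    have "derived G (derived G H) \<subseteq> derived G H" by (rule derived_incl[OF subset_refl dH])
    then have "x \<in> derived G H"
      using subsetD[OF derived_pow_subset[OF derived_is_subgroup[OF subgroup.subset[OF dH]]] xd] by (rule subsetD)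
    then show ?thesis using True by (auto simp: T_def)
  next
    case False
    obtain z g where zg: "z \<in> H" "g \<in> H" "commutator G z g \<notin> T"
      and zd: "\<And>x. x \<in> derived G H \<Longrightarrow> commutator G z x \<in> T"
    proof (rule nilpotent_noncentral[OF H T _ _ _ False])
      show "T \<subseteq> H" by (auto simp: T_def)
      show "h \<otimes> t \<otimes> inv h \<in> T" if "h \<in> H" "t \<in> T" for h t
      proof -
        have "trivial_on V U (h \<otimes> t \<otimes> inv h)"
          using that by (intro trivial_conj[where U = U and V = V and H = H] facts) (simp_all add: T_def)
        then show ?thesis using that subgroup.m_closed[OF H] subgroup.m_inv_closed[OF H] by (auto simp: T_def)
      qed
      show "iter_comm G H H c \<subseteq> T" using nil iter_comm_subgroup[OF H] by (auto simp: T_def)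
    qed (rule that)
    have zc: "z \<in> carrier G" and gc: "g \<in> carrier G" using zg subgroup.subset[OF H] by auto
    have "U \<noteq> V"
    proof
      assume "U = V"
      have "act (commutator G z g) v - v \<in> V" if "v \<in> V" for v
        using that HV zg subgroup.m_closed[OF H] subgroup.m_inv_closed[OF H]
        by (intro submod_diff(2)[OF V(1) subring]) auto
      then have "trivial_on V U (commutator G z g)" using \<open>U = V\<close> by (simp add: trivial_on_def)
      then show False using comm_T zg by blast
    qed
    then obtain v where v: "v \<in> V" "v \<notin> U" using UV by blast
    obtain e :: nat where e: "e > 0" "trivial_on V U (z [^] e)" using ex[OF zg(1)] by blast
    have ev: "act (z [^] e) v - v \<in> U" using e(2) v(1) by (simp add: trivial_on_def)
    obtain a w where aw: "a \<in> A" "w \<in> V" "w \<notin> U" "act z w - scl a w \<in> U"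
      by (rule eigenvector[OF zc V pres HV[OF zg(1)] v e(1) ev])
    \<comment> \<open>The preimage in \<open>V\<close> of the eigenspace of \<open>z\<close> on
      \<open>V/U\<close> for \<open>a\<close>. Both inclusions
      \<open>U \<subset> W \<subset> V\<close> are strict, so each layer has a smaller pivot
      count.\<close>
    define W where "W = {v \<in> V. act z v - scl a v \<in> U}"
    have scld: "scl c (p - q) = scl c p - scl c q" for c and p q :: "nat \<Rightarrow> 'a"
      by (auto simp: scl_def algebra_simps)
    have sclc: "scl b (scl c p) = scl c (scl b p)" for b c and p :: "nat \<Rightarrow> 'a"
      by (auto simp: scl_def)
    have W: "submod A W"
      unfolding submod_def
    proof (intro conjI ballI)
      have "act z 0 - scl a 0 = 0" by (simp only: act_zero[OF zc] scl_simps diff_self)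
      then show "0 \<in> W" using submodD(1)[OF V(1)] submodD(1)[OF U] by (simp add: W_def)
      fix p assume p: "p \<in> W"
      show "p + q \<in> W" if q: "q \<in> W" for q
      proof -
        have "act z (p + q) - scl a (p + q) = (act z p - scl a p) + (act z q - scl a q)"
          unfolding act_add[OF zc] scl_simps by (rule add_diff_add)
        then show ?thesis using p q submodD(2)[OF V(1)] submodD(2)[OF U] by (simp add: W_def)
      qed
      show "scl b p \<in> W" if b: "b \<in> A" for b
      proof -
        have "act z (scl b p) - scl a (scl b p) = scl b (act z p - scl a p)"
          unfolding act_scl[OF zc] scld sclc[of a b] ..
        then show ?thesis using p b submodD(3)[OF V(1)] submodD(3)[OF U] by (simp add: W_def)
      qed
    qed
    have UW: "U \<subset> W"
    proof
      show "U \<subseteq> W"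
        unfolding W_def using UV HU[OF zg(1)] submodD(3)[OF U aw(1)] by (auto intro!: submod_diff(2)[OF U subring])
      show "U \<noteq> W" using aw by (auto simp: W_def)
    qed
    \<comment> \<open>Otherwise \<open>z\<close> would act on \<open>V/U\<close> as the scalar
      \<open>a\<close> and commute there with \<open>g\<close>, against the choice of
      \<open>g\<close>.\<close>
    have WV: "W \<subset> V"
    proof
      show "W \<subseteq> V" by (auto simp: W_def)
      show "W \<noteq> V"
      proof
        assume WV: "W = V"
        have "act z (act g v) - act g (act z v) \<in> U" if v: "v \<in> V" for v
        proof -
          have 1: "act z (act g v) - scl a (act g v) \<in> U" using HV[OF zg(2) v] WV by (auto simp: W_def)
          have "act z v - scl a v \<in> U" using v WV by (auto simp: W_def)
          then have "act g (act z v - scl a v) \<in> U" by (rule HU[OF zg(2)])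
          then have 2: "act g (act z v) - scl a (act g v) \<in> U" by (simp only: act_diff[OF gc] act_scl[OF gc])
          have "(act z (act g v) - scl a (act g v)) - (act g (act z v) - scl a (act g v)) \<in> U"
            by (rule submod_diff(2)[OF U subring 1 2])
          then show ?thesis by (simp only: diff_diff_eq2 diff_add_cancel)
        qed
        then have "trivial_on V U (commutator G z g)"
          unfolding tci[OF zg(1,2)] by (rule ballI)
        then show False using comm_T zg by blast
      qed
    qed
    \<comment> \<open>Elements of the derived subgroup commute with \<open>z\<close> on
      \<open>V/U\<close>, so they preserve its eigenspaces; elements of \<open>H\<close> itself need
      not.\<close>
    have dW: "act h v \<in> W" if h: "h \<in> derived G H" and v: "v \<in> W" for h v
    proof -
      have hH: "h \<in> H" using h dHH by blast
      have hc: "h \<in> carrier G" using hH subgroup.subset[OF H] by blast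
      have vV: "v \<in> V" "act z v - scl a v \<in> U" using v by (auto simp: W_def)
      have "trivial_on V U (commutator G z h)" using zd[OF h] by (auto simp: T_def)
      then have 1: "act z (act h v) - act h (act z v) \<in> U"
        unfolding tci[OF zg(1) hH] using vV(1) by (rule bspec)
      have 2: "act h (act z v) - scl a (act h v) \<in> U"
        using HU[OF hH vV(2)] by (simp only: act_diff[OF hc] act_scl[OF hc])
      have "(act z (act h v) - act h (act z v)) + (act h (act z v) - scl a (act h v)) \<in> U"
        by (rule submodD(2)[OF U 1 2])
      then have "act z (act h v) - scl a (act h v) \<in> U" by simp
      then show ?thesis using HV[OF hH vV(1)] by (simp add: W_def)
    qed
    have ncl: "iter_comm G (derived G H) (derived G H) c \<subseteq> iter_comm G H H c"
      by (rule iter_comm_mono[OF dHH dHH])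
    have p1: "card (pivots M n U) < card (pivots M n W)"
      by (rule pivots_strict_mono[OF place U W MU UW]) (use WV V(2) in blast)
    have p2: "card (pivots M n W) < card (pivots M n V)"
      by (rule pivots_strict_mono[OF place W V(1) _ WV V(2)]) (use MU UW in blast)
    have low: "trivial_on W U y" if y: "y \<in> (derived G ^^ (2 * l)) (derived G H)" for y
    proof (rule Suc.IH[OF U W MU _ _ dH])
      show "U \<subseteq> W" "W \<subseteq> lattice_over A n" using UW WV V(2) by auto
      show "act h u \<in> U" if "h \<in> derived G H" "u \<in> U" for h u by (rule HU[OF subsetD[OF dHH that(1)] that(2)])
      show "act h u \<in> W" if "h \<in> derived G H" "u \<in> W" for h u by (rule dW[OF that])
      show "\<exists>e>0. trivial_on W U (h [^] (e::nat))" if hd: "h \<in> derived G H" for h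
      proof -
        obtain e :: nat where e: "e > 0" "trivial_on V U (h [^] e)" using ex[OF subsetD[OF dHH hd]] by blast
        show ?thesis using e(1) trivial_on_mono[OF e(2) psubset_imp_subset[OF WV] subset_refl] by (intro exI[of _ e] conjI)
      qed
      show "trivial_on W U x" if "x \<in> iter_comm G (derived G H) (derived G H) c" for x
        by (rule trivial_on_mono[OF nil[OF subsetD[OF ncl that]] psubset_imp_subset[OF WV] subset_refl])
      show "card (pivots M n W) \<le> card (pivots M n U) + l" using p2 piv by simp
    qed (rule y)
    have high: "trivial_on V W y" if y: "y \<in> (derived G ^^ (2 * l)) (derived G H)" for y
    proof (rule Suc.IH[OF W V(1) _ _ V(2) dH])
      show "lattice_over M n \<subseteq> W" "W \<subseteq> V" using UW WV MU by auto
      show "act h u \<in> V" if "h \<in> derived G H" "u \<in> V" for h u by (rule HV[OF subsetD[OF dHH that(1)] that(2)])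
      show "act h u \<in> W" if "h \<in> derived G H" "u \<in> W" for h u by (rule dW[OF that])
      show "\<exists>e>0. trivial_on V W (h [^] (e::nat))" if hd: "h \<in> derived G H" for h
      proof -
        obtain e :: nat where e: "e > 0" "trivial_on V U (h [^] e)" using ex[OF subsetD[OF dHH hd]] by blast
        show ?thesis using e(1) trivial_on_mono[OF e(2) subset_refl psubset_imp_subset[OF UW]] by (intro exI[of _ e] conjI)
      qed
      show "trivial_on V W x" if "x \<in> iter_comm G (derived G H) (derived G H) c" for x
        by (rule trivial_on_mono[OF nil[OF subsetD[OF ncl that]] subset_refl psubset_imp_subset[OF UW]])
      show "card (pivots M n V) \<le> card (pivots M n W) + l" using p1 piv by simp
    qed (rule y)
    define Y where "Y = (derived G ^^ (2 * l)) (derived G H)"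
    have YH: "Y \<subseteq> H" unfolding Y_def using derived_pow_subset[OF dH] dHH by blast
    \<comment> \<open>Both \<open>p - 1\<close> and \<open>q - 1\<close> map \<open>V\<close> into
      \<open>W\<close> and \<open>W\<close> into \<open>U\<close>, so their products in either order
      vanish on \<open>V/U\<close>. Hence so does \<open>p q - q p\<close>, which equals
      \<open>(p - 1)(q - 1) - (q - 1)(p - 1)\<close>.\<close>
    have "commutator G p q \<in> T" if pq: "p \<in> Y" "q \<in> Y" for p q
    proof -
      have pqH: "p \<in> H" "q \<in> H" using pq YH by auto
      have pqc: "p \<in> carrier G" "q \<in> carrier G" using pqH subgroup.subset[OF H] by auto
      have "act p (act q v) - act q (act p v) \<in> U" if v: "v \<in> V" for v
      proof -
        have "act q v - v \<in> W" "act p v - v \<in> W" using high pq v unfolding Y_def trivial_on_def by blast+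
        then have 1: "act p (act q v - v) - (act q v - v) \<in> U" "act q (act p v - v) - (act p v - v) \<in> U"
          using low pq unfolding Y_def trivial_on_def by blast+
        have "(act p (act q v - v) - (act q v - v)) - (act q (act p v - v) - (act p v - v)) \<in> U"
          by (rule submod_diff(2)[OF U subring 1])
        moreover have "(act p (act q v - v) - (act q v - v)) - (act q (act p v - v) - (act p v - v)) =
            act p (act q v) - act q (act p v)"
          unfolding act_diff[OF pqc(1)] act_diff[OF pqc(2)] by (simp add: fun_eq_iff)
        ultimately show ?thesis by (simp only:)
      qed
      then have "trivial_on V U (commutator G p q)"
        unfolding tci[OF pqH] by (rule ballI)
      then show ?thesis by (rule comm_T[OF pqH])
    qed
    then have "derived_set G Y \<subseteq> T" by blast
    then have "derived G Y \<subseteq> T" unfolding derived_def by (rule generate_subgroup_incl[OF _ T])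
    moreover have "x \<in> derived G Y"
      using Suc.prems(12) by (simp add: Y_def funpow_swap1)
    ultimately show ?thesis by (auto simp: T_def)
  qed
qed

end

subsection \<open>Permutation representations\<close>

text \<open>The orthogonal sum, over the fibres of \<open>b\<close>, of the square-summable
  functions with sum zero. The condition on the sums removes the constants on each fibre, which are
  what a transitive action leaves invariant.\<close>

definition block_space :: "'i set \<Rightarrow> ('i \<Rightarrow> 'b) \<Rightarrow> ('i \<Rightarrow> complex) inner_space" where
  "block_space J b =
    \<lparr>carrier = {f. (\<forall>x. x \<notin> J \<longrightarrow> f x = 0) \<and> (\<forall>i. (\<Sum>x | x \<in> J \<and> b x = i. f x) = 0)},
     monoid.mult = \<lambda>f g. f, monoid.one = \<lambda>x. 0, ring.zero = \<lambda>x. 0, ring.add = \<lambda>f g x. f x + g x,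
     module.smult = \<lambda>c f x. c * f x, ip = \<lambda>f g. \<Sum>x\<in>J. f x * cnj (g x)\<rparr>"

lemma block_space_simps:
  "f \<in> carrier (block_space J b) \<longleftrightarrow>
     (\<forall>x. x \<notin> J \<longrightarrow> f x = 0) \<and> (\<forall>i. (\<Sum>x | x \<in> J \<and> b x = i. f x) = 0)"
  "\<zero>\<^bsub>block_space J b\<^esub> = (\<lambda>x. 0)"
  "f \<oplus>\<^bsub>block_space J b\<^esub> g = (\<lambda>x. f x + g x)"
  "c \<odot>\<^bsub>block_space J b\<^esub> f = (\<lambda>x. c * f x)"
  "ip (block_space J b) f g = (\<Sum>x\<in>J. f x * cnj (g x))"
  by (simp_all add: block_space_def)

lemma Re_mult_cnj: "Re (z * cnj z) = (cmod z)\<^sup>2"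
  unfolding cmod_power2 by (simp add: power2_eq_square)

lemma hnorm_block_space: "hnorm (block_space J b) f = sqrt (\<Sum>x\<in>J. (cmod (f x))\<^sup>2)"
  by (simp only: hnorm_def block_space_simps Re_mult_cnj Re_sum)

lemma block_space_scale_closed: "f \<in> carrier (block_space J b) \<Longrightarrow> (\<lambda>x. a * f x) \<in> carrier (block_space J b)"
  by (simp add: block_space_simps sum_distrib_left[symmetric])

lemma abelian_group_block_space: "abelian_group (block_space J b)"
proof (rule abelian_groupI)
  fix f assume f: "f \<in> carrier (block_space J b)"
  show "\<exists>g\<in>carrier (block_space J b). g \<oplus>\<^bsub>block_space J b\<^esub> f = \<zero>\<^bsub>block_space J b\<^esub>"
    by (rule bexI[of _ "\<lambda>x. - f x"]) (use f in \<open>simp_all add: block_space_simps sum_negf\<close>)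
qed (simp_all add: block_space_simps sum.distrib ac_simps)

lemma block_space_minus:
  assumes "f \<in> carrier (block_space J b)" "g \<in> carrier (block_space J b)"
  shows "f \<ominus>\<^bsub>block_space J b\<^esub> g = (\<lambda>x. f x - g x)"
proof -
  have "\<ominus>\<^bsub>block_space J b\<^esub> g = (\<lambda>x. - g x)"
    by (rule abelian_group.minus_equality[OF abelian_group_block_space])
      (use assms(2) in \<open>simp_all add: block_space_simps sum_negf\<close>)
  then show ?thesis by (simp add: a_minus_def block_space_simps)
qed

lemma vectorspace_block_space: "vectorspace (class_ring :: complex ring) (block_space J b)"
proof (rule vectorspace.intro)
  show "field (class_ring :: complex ring)" by (rule class_field)
  then have "cring (class_ring :: complex ring)" by (simp add: field_def domain_def)
  then show "module (class_ring :: complex ring) (block_space J b)"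
    by (rule moduleI[OF _ abelian_group_block_space])
      (simp_all add: block_space_simps class_ring_simps sum_distrib_left[symmetric] algebra_simps)
qed

lemma complex_hilbert_space_block_space:
  assumes J: "finite J"
  shows "complex_hilbert_space (block_space J b)"
proof -
  let ?H = "block_space J b"
  have inner: "complex_inner_space ?H"
  proof (intro complex_inner_space.intro vectorspace_block_space complex_inner_space_axioms.intro)
    fix f assume f: "f \<in> carrier ?H" "f \<noteq> \<zero>\<^bsub>?H\<^esub>"
    then obtain x where x: "x \<in> J" "f x \<noteq> 0" by (auto simp: block_space_simps fun_eq_iff)
    have "0 < (cmod (f x))\<^sup>2" using x by simp
    also have "\<dots> \<le> (\<Sum>x\<in>J. (cmod (f x))\<^sup>2)" by (rule member_le_sum) (use x J in auto)
    finally show "0 < Re (ip ?H f f)" by (simp only: block_space_simps Re_mult_cnj Re_sum)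
  qed (simp_all add: block_space_simps sum.distrib sum_distrib_left algebra_simps)
  have complete: "\<exists>f\<in>carrier ?H. (\<lambda>n. hnorm ?H (F n \<ominus>\<^bsub>?H\<^esub> f)) \<longlonglongrightarrow> 0"
    if F: "range F \<subseteq> carrier ?H" and cau: "\<And>e. 0 < e \<Longrightarrow> \<exists>N. \<forall>m\<ge>N. \<forall>n\<ge>N. hnorm ?H (F m \<ominus>\<^bsub>?H\<^esub> F n) < e" for F
  proof -
    have Fc: "F n \<in> carrier ?H" for n using F by auto
    have le: "cmod (F m x - F n x) \<le> hnorm ?H (F m \<ominus>\<^bsub>?H\<^esub> F n)" if x: "x \<in> J" for m n x
    proof -
      have "(cmod (F m x - F n x))\<^sup>2 \<le> (\<Sum>x\<in>J. (cmod (F m x - F n x))\<^sup>2)"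
        by (rule member_le_sum) (use x J in auto)
      then show ?thesis
        by (simp add: hnorm_block_space block_space_minus[OF Fc Fc] real_le_rsqrt)
    qed
    have "convergent (\<lambda>n. F n x)" if x: "x \<in> J" for x
      unfolding Cauchy_convergent_iff[symmetric]
    proof (rule CauchyI)
      fix e :: real assume "0 < e"
      then obtain N where "\<forall>m\<ge>N. \<forall>n\<ge>N. hnorm ?H (F m \<ominus>\<^bsub>?H\<^esub> F n) < e" using cau by blast
      then show "\<exists>N. \<forall>m\<ge>N. \<forall>n\<ge>N. cmod (F m x - F n x) < e"
        using le[OF x] by (meson le_less_trans)
    qed
    note conv = this
    define f where "f x = (if x \<in> J then lim (\<lambda>n. F n x) else 0)" for x
    have lim: "(\<lambda>n. F n x) \<longlonglongrightarrow> f x" if "x \<in> J" for x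
      using conv[OF that] that by (simp add: f_def convergent_LIMSEQ_iff)
    have "(\<Sum>x | x \<in> J \<and> b x = i. f x) = 0" for i
    proof (rule LIMSEQ_unique)
      show "(\<lambda>n. \<Sum>x | x \<in> J \<and> b x = i. F n x) \<longlonglongrightarrow> (\<Sum>x | x \<in> J \<and> b x = i. f x)"
        by (rule tendsto_sum) (simp add: lim)
      show "(\<lambda>n. \<Sum>x | x \<in> J \<and> b x = i. F n x) \<longlonglongrightarrow> 0"
        using Fc by (simp add: block_space_simps)
    qed
    then have f: "f \<in> carrier ?H" by (simp add: block_space_simps f_def)
    have "(\<lambda>n. sqrt (\<Sum>x\<in>J. (cmod (F n x - f x))\<^sup>2)) \<longlonglongrightarrow> sqrt (\<Sum>x\<in>J. (cmod (f x - f x))\<^sup>2)"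
      by (intro tendsto_intros lim)
    then show ?thesis
      by (intro bexI[OF _ f]) (simp add: hnorm_block_space block_space_minus[OF Fc f])
  qed
  show ?thesis
    by (intro complex_hilbert_space.intro complex_hilbert_space_axioms.intro inner) (rule complete)
qed

section \<open>Nonnegativity of the constants\<close>

lemma (in complex_inner_space) hnorm_nonneg: "x \<in> carrier H \<Longrightarrow> 0 \<le> hnorm H x"
proof (cases "x = \<zero>\<^bsub>H\<^esub>")
  case True
  have "\<zero>\<^bsub>H\<^esub> = 0 \<odot>\<^bsub>H\<^esub> \<zero>\<^bsub>H\<^esub>"
    using smult_r_null[of 0] by (simp add: class_ring_simps)
  then have "ip H \<zero>\<^bsub>H\<^esub> \<zero>\<^bsub>H\<^esub> = 0" using ip_smult[of "\<zero>\<^bsub>H\<^esub>" "\<zero>\<^bsub>H\<^esub>" 0] by simp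
  then show ?thesis by (simp add: hnorm_def True)
qed (use ip_pos[of x] in \<open>simp add: hnorm_def\<close>)

lemma tau_nonneg:
  assumes S: "finite S" "S \<noteq> {}" "S \<subseteq> carrier G"
  shows "0 \<le> tau U G S"
  unfolding tau_def
proof (rule INF_greatest, clarify, rule INF_greatest)
  fix H \<pi> \<xi> assume "(H, \<pi>) \<in> finite_image_reps U G" and \<xi>: "\<xi> \<in> {\<xi> \<in> carrier H. hnorm H \<xi> = 1}"
  then have H: "complex_hilbert_space H" and \<pi>: "\<pi> \<in> hom G (unitary_group H)"
    by (auto simp: finite_image_reps_def)
  interpret complex_hilbert_space H by (rule H)
  obtain s where s: "s \<in> S" using S(2) by blast
  have "\<pi> s \<in> carrier (unitary_group H)" using hom_in_carrier[OF \<pi>] S(3) s by blast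
  then have "\<pi> s \<xi> \<in> carrier H"
    using \<xi> Bij_imp_funcset by (auto simp: unitary_group_def)
  then have "0 \<le> hnorm H (\<pi> s \<xi> \<ominus>\<^bsub>H\<^esub> \<xi>)" using \<xi> by (intro hnorm_nonneg minus_closed) auto
  then have "0 \<le> ereal (hnorm H (\<pi> s \<xi> \<ominus>\<^bsub>H\<^esub> \<xi>))" by simp
  also have "\<dots> \<le> Max ((\<lambda>s. ereal (hnorm H (\<pi> s \<xi> \<ominus>\<^bsub>H\<^esub> \<xi>))) ` S)"
    using S(1) s by (intro Max_ge) auto
  finally show "0 \<le> Max ((\<lambda>s. ereal (hnorm H (\<pi> s \<xi> \<ominus>\<^bsub>H\<^esub> \<xi>))) ` S)" .
qed

text \<open>The group being infinite, no generating set is empty; this matters because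
  \<open>Max\<close> of the empty set has no specified value.\<close>

lemma (in group) tau_u_nonneg:
  assumes "infinite (carrier G)"
  shows "0 \<le> tau_u U G"
  unfolding tau_u_def
proof (rule INF_greatest)
  fix S assume S: "S \<in> finite_generating_sets G"
  then have "S \<noteq> {}" using assms generate_empty by (auto simp: finite_generating_sets_def)
  then show "0 \<le> tau U G S" using S by (intro tau_nonneg) (auto simp: finite_generating_sets_def)
qed

text \<open>The fibres of \<open>b\<close> are the orbits, and \<open>act\<close> is a right action, as on right cosets.\<close>

locale block_action = group G for G :: "('g, 'm) monoid_scheme" (structure) +
  fixes J :: "'i set" and b :: "'i \<Rightarrow> 'b" and act :: "'g \<Rightarrow> 'i \<Rightarrow> 'i"
  assumes finite_points: "finite J"
    and act_closed: "g \<in> carrier G \<Longrightarrow> x \<in> J \<Longrightarrow> act g x \<in> J"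
    and act_block: "g \<in> carrier G \<Longrightarrow> x \<in> J \<Longrightarrow> b (act g x) = b x"
    and act_comp: "g \<in> carrier G \<Longrightarrow> h \<in> carrier G \<Longrightarrow> x \<in> J \<Longrightarrow> act (g \<otimes> h) x = act h (act g x)"
    and act_id: "x \<in> J \<Longrightarrow> act \<one> x = x"
    and transitive: "x \<in> J \<Longrightarrow> y \<in> J \<Longrightarrow> b x = b y \<Longrightarrow> \<exists>g\<in>carrier G. act g x = y"
begin

abbreviation "\<H> \<equiv> block_space J b"

text \<open>Precomposition with a right action is a left representation. The restriction to the
  carrier is imposed by \<open>Bij\<close>, whose elements are extensional.\<close>

definition perm_rep :: "'g \<Rightarrow> ('i \<Rightarrow> complex) \<Rightarrow> 'i \<Rightarrow> complex" where
  "perm_rep g = (\<lambda>f\<in>carrier \<H>. \<lambda>x. if x \<in> J then f (act g x) else 0)"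

lemma act_cancel:
  "g \<in> carrier G \<Longrightarrow> x \<in> J \<Longrightarrow> act (inv g) (act g x) = x"
  "g \<in> carrier G \<Longrightarrow> x \<in> J \<Longrightarrow> act g (act (inv g) x) = x"
  using act_comp[of g "inv g" x] act_comp[of "inv g" g x] act_id[of x] by auto

lemma act_bij: "g \<in> carrier G \<Longrightarrow> bij_betw (act g) J J"
  by (rule bij_betw_byWitness[of J "act (inv g)"]) (auto simp: act_cancel act_closed)

lemma act_bij_block: "g \<in> carrier G \<Longrightarrow> bij_betw (act g) {x \<in> J. b x = i} {x \<in> J. b x = i}"
  by (rule bij_betw_byWitness[of _ "act (inv g)"]) (auto simp: act_cancel act_closed act_block)

lemma perm_rep_closed:
  assumes g: "g \<in> carrier G" and f: "f \<in> carrier \<H>"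
  shows "perm_rep g f \<in> carrier \<H>"
proof -
  have "(\<Sum>x | x \<in> J \<and> b x = i. f (act g x)) = (\<Sum>x | x \<in> J \<and> b x = i. f x)" for i
    by (rule sum.reindex_bij_betw[OF act_bij_block[OF g]])
  then show ?thesis using f by (simp add: perm_rep_def block_space_simps)
qed

lemma perm_rep_mult:
  assumes "g \<in> carrier G" "h \<in> carrier G" "f \<in> carrier \<H>"
  shows "perm_rep (g \<otimes> h) f = perm_rep g (perm_rep h f)"
  using perm_rep_closed[OF assms(2,3)] assms by (auto simp: perm_rep_def act_comp act_closed)

lemma perm_rep_one: "f \<in> carrier \<H> \<Longrightarrow> perm_rep \<one> f = f"
  by (auto simp: perm_rep_def act_id block_space_simps)

lemma perm_rep_Bij:
  assumes g: "g \<in> carrier G"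
  shows "perm_rep g \<in> Bij (carrier \<H>)"
proof -
  have "perm_rep (inv g) (perm_rep g f) = f" "perm_rep g (perm_rep (inv g) f) = f" if "f \<in> carrier \<H>" for f
    using that g by (simp_all add: perm_rep_mult[symmetric] perm_rep_one)
  then have "bij_betw (perm_rep g) (carrier \<H>) (carrier \<H>)"
    by (intro bij_betw_byWitness[of _ "perm_rep (inv g)"]) (use g perm_rep_closed in auto)
  then show ?thesis by (simp add: Bij_def perm_rep_def)
qed

lemma perm_rep_unitary:
  assumes g: "g \<in> carrier G"
  shows "perm_rep g \<in> carrier (unitary_group \<H>)"
proof -
  have "f \<oplus>\<^bsub>\<H>\<^esub> f' \<in> carrier \<H>" if "f \<in> carrier \<H>" "f' \<in> carrier \<H>" for f f'
    using that by (simp add: block_space_simps sum.distrib)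
  moreover have "c \<odot>\<^bsub>\<H>\<^esub> f \<in> carrier \<H>" if "f \<in> carrier \<H>" for f c
    using block_space_scale_closed[OF that] by (simp add: block_space_simps(4))
  ultimately have "perm_rep g \<in> module_hom class_ring \<H> \<H>"
    using perm_rep_closed[OF g]
    by (auto simp: module_hom_def perm_rep_def block_space_simps(2-5))
  moreover have "ip \<H> (perm_rep g f) (perm_rep g f') = ip \<H> f f'" if "f \<in> carrier \<H>" "f' \<in> carrier \<H>" for f f'
  proof -
    have "ip \<H> (perm_rep g f) (perm_rep g f') = (\<Sum>x\<in>J. f (act g x) * cnj (f' (act g x)))"
      using that by (simp add: block_space_simps(5) perm_rep_def)
    also have "\<dots> = ip \<H> f f'"
      unfolding block_space_simps(5) by (rule sum.reindex_bij_betw[OF act_bij[OF g]])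
    finally show ?thesis .
  qed
  ultimately show ?thesis using perm_rep_Bij[OF g] by (simp add: unitary_group_def)
qed

lemma perm_rep_hom: "perm_rep \<in> hom G (unitary_group \<H>)"
proof (rule homI)
  fix g h assume gh: "g \<in> carrier G" "h \<in> carrier G"
  have "perm_rep (g \<otimes> h) = compose (carrier \<H>) (perm_rep g) (perm_rep h)"
  proof
    fix f show "perm_rep (g \<otimes> h) f = compose (carrier \<H>) (perm_rep g) (perm_rep h) f"
    proof (cases "f \<in> carrier \<H>")
      case True
      then show ?thesis by (simp add: gh perm_rep_mult compose_def)
    next
      case False
      then show ?thesis by (simp add: compose_def perm_rep_def)
    qed
  qed
  then show "perm_rep (g \<otimes> h) = perm_rep g \<otimes>\<^bsub>unitary_group \<H>\<^esub> perm_rep h"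
    using gh perm_rep_Bij by (simp add: unitary_group_def BijGroup_def)
qed (rule perm_rep_unitary)

lemma perm_rep_finite_image: "finite (perm_rep ` carrier G)"
proof (rule finite_surj)
  show "finite (J \<rightarrow>\<^sub>E J)" by (intro finite_PiE finite_points)
  have "perm_rep g = (\<lambda>p. \<lambda>f\<in>carrier \<H>. \<lambda>x. if x \<in> J then f (p x) else 0) (restrict (act g) J)" for g
    by (auto simp: perm_rep_def fun_eq_iff)
  then show "perm_rep ` carrier G \<subseteq> (\<lambda>p. \<lambda>f\<in>carrier \<H>. \<lambda>x. if x \<in> J then f (p x) else 0) ` (J \<rightarrow>\<^sub>E J)"
    using act_closed by (intro image_subsetI) (auto intro!: image_eqI)
qed

text \<open>An invariant function is constant on each fibre of \<open>b\<close> by transitivity, and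
  its sum over the fibre is zero.\<close>

lemma perm_rep_invariant: "invariant_vectors G \<H> perm_rep = {\<zero>\<^bsub>\<H>\<^esub>}"
proof
  show "invariant_vectors G \<H> perm_rep \<subseteq> {\<zero>\<^bsub>\<H>\<^esub>}"
  proof
    fix f assume f: "f \<in> invariant_vectors G \<H> perm_rep"
    then have fH: "f \<in> carrier \<H>" by (simp add: invariant_vectors_def)
    have inva: "f (act g x) = f x" if "g \<in> carrier G" "x \<in> J" for g x
    proof -
      have "perm_rep g f x = f x" using f that by (simp add: invariant_vectors_def)
      then show ?thesis using that fH by (simp add: perm_rep_def)
    qed
    have "f x = 0" if x: "x \<in> J" for x
    proof -
      let ?B = "{y \<in> J. b y = b x}"
      have "f y = f x" if "y \<in> ?B" for y
        using transitive[of x y] inva[of _ x] x that by auto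
      then have "(\<Sum>y\<in>?B. f y) = of_nat (card ?B) * f x" by simp
      moreover have "(\<Sum>y\<in>?B. f y) = 0" using fH by (simp add: block_space_simps)
      moreover have "card ?B \<noteq> 0" using x finite_points by auto
      ultimately show ?thesis by simp
    qed
    then show "f \<in> {\<zero>\<^bsub>\<H>\<^esub>}" using fH by (auto simp: block_space_simps)
  qed
  show "{\<zero>\<^bsub>\<H>\<^esub>} \<subseteq> invariant_vectors G \<H> perm_rep"
    by (auto simp: invariant_vectors_def block_space_simps perm_rep_def)
qed

lemma perm_rep_in_reps: "(\<H>, perm_rep) \<in> finite_image_reps TYPE('i \<Rightarrow> complex) G"
  unfolding finite_image_reps_def
  using complex_hilbert_space_block_space[OF finite_points] perm_rep_hom perm_rep_finite_image perm_rep_invariant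
  by blast

end

section \<open>An almost invariant vector with many components\<close>

lemma hnorm_block_space_scale: "hnorm (block_space J b) (\<lambda>x. a * f x) = cmod a * hnorm (block_space J b) f"
  by (simp add: hnorm_block_space norm_mult power_mult_distrib sum_distrib_left[symmetric] real_sqrt_mult)

text \<open>\<open>K\<close> orbits with one base point each. An orbit of size 1 carries no nonzero
  function of sum zero, which explains the lower bound on the sizes; for coset spaces it says that
  the subgroups are proper.\<close>

locale pointed_block_action = block_action G J b act
  for G :: "('g, 'm) monoid_scheme" (structure) and J :: "'i set" and b :: "'i \<Rightarrow> nat" and act +
  fixes K :: nat and p :: "nat \<Rightarrow> 'i"
  assumes block_less: "x \<in> J \<Longrightarrow> b x < K"
    and point: "i < K \<Longrightarrow> p i \<in> J" "i < K \<Longrightarrow> b (p i) = i"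
    and card_block: "i < K \<Longrightarrow> 2 \<le> card {x \<in> J. b x = i}"
begin

definition point_vector :: "'i \<Rightarrow> complex" where
  "point_vector x = (if x \<in> J then of_bool (x = p (b x)) - 1 / of_nat (card {y \<in> J. b y = b x}) else 0)"

lemma point_vector_closed: "point_vector \<in> carrier \<H>"
proof -
  have "(\<Sum>x | x \<in> J \<and> b x = i. point_vector x) = 0" for i
  proof (cases "i < K")
    case True
    let ?B = "{x \<in> J. b x = i}"
    have "(\<Sum>x\<in>?B. point_vector x) = (\<Sum>x\<in>?B. of_bool (x = p i) - 1 / of_nat (card ?B))"
      by (rule sum.cong) (auto simp: point_vector_def)
    also have "\<dots> = (\<Sum>x\<in>?B. if x = p i then 1 else 0) - of_nat (card ?B) * (1 / of_nat (card ?B))"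
      by (simp add: sum_subtractf of_bool_def)
    also have "\<dots> = 0"
    proof -
      have "p i \<in> ?B" "card ?B \<noteq> 0" using point[OF True] card_block[OF True] by auto
      moreover have "finite ?B" using finite_points by simp
      ultimately show ?thesis by (simp only: sum.delta' sum.delta if_True) simp
    qed
    finally show ?thesis .
  next
    case False
    then have "{x \<in> J. b x = i} = {}" using block_less by auto
    then show ?thesis by (simp only: sum.empty)
  qed
  then show ?thesis by (simp add: block_space_simps point_vector_def)
qed

text \<open>In a block of size \<open>d\<close> the base point alone contributes
  \<open>(1 - 1/d)^2\<close>, at least 1/4 because \<open>d\<close> is at least 2.\<close>

lemma hnorm_point_vector: "sqrt (K / 4) \<le> hnorm \<H> point_vector"
proof -
  have quarter: "1 / 4 \<le> (cmod (point_vector (p i)))\<^sup>2" if i: "i < K" for i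
  proof -
    let ?d = "card {y \<in> J. b y = i}"
    have "1 / real ?d \<le> 1 / 2" using card_block[OF i] by (intro divide_left_mono) auto
    then have "1 / 2 \<le> cmod 1 - cmod (1 / of_nat ?d)" by (simp add: norm_divide)
    also have "\<dots> \<le> cmod (1 - 1 / of_nat ?d)" by (rule norm_triangle_ineq2)
    finally have "(1 / 2)\<^sup>2 \<le> (cmod (1 - 1 / of_nat ?d))\<^sup>2" by (intro power_mono) auto
    then show ?thesis using point[OF i] by (simp add: point_vector_def power2_eq_square)
  qed
  have inj: "inj_on p {..<K}" using point(2) by (auto intro: inj_on_inverseI[of _ b])
  have "real K / 4 = (\<Sum>i<K. 1 / 4)" by simp
  also have "\<dots> \<le> (\<Sum>i<K. (cmod (point_vector (p i)))\<^sup>2)" using quarter by (intro sum_mono) auto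
  also have "\<dots> = (\<Sum>x\<in>p ` {..<K}. (cmod (point_vector x))\<^sup>2)" by (simp add: sum.reindex[OF inj])
  also have "\<dots> \<le> (\<Sum>x\<in>J. (cmod (point_vector x))\<^sup>2)"
    using point(1) finite_points by (intro sum_mono2) auto
  finally show ?thesis by (simp add: hnorm_block_space)
qed

lemma hnorm_point_vector_displacement:
  assumes s: "s \<in> carrier G" and fixd: "\<And>j. j < K \<Longrightarrow> j \<noteq> i \<Longrightarrow> act s (p j) = p j" and i: "i < K"
  shows "sqrt (\<Sum>x\<in>J. (cmod (point_vector (act s x) - point_vector x))\<^sup>2) \<le> sqrt 2"
proof -
  \<comment> \<open>\<open>s\<close> fixes the base point, hence the vector, in every block other than the \<open>i\<close>-th.\<close>
  have "(cmod (point_vector (act s x) - point_vector x))\<^sup>2 \<le> of_bool (act s x = p i) + of_bool (x = p i)"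
    if x: "x \<in> J" for x
  proof -
    have eq: "point_vector (act s x) - point_vector x = of_bool (act s x = p (b x)) - of_bool (x = p (b x))"
      using x s by (simp add: point_vector_def act_closed act_block)
    show ?thesis
    proof (cases "b x = i")
      case True
      then show ?thesis unfolding eq by (cases "act s x = p i"; cases "x = p i") auto
    next
      case False
      have "act s (p (b x)) = p (b x)" by (rule fixd[OF block_less[OF x] False])
      then have "act s x = p (b x) \<longleftrightarrow> x = p (b x)"
        using act_cancel(1)[OF s x] act_cancel(1)[OF s point(1)[OF block_less[OF x]]] by metis
      then show ?thesis unfolding eq by simp
    qed
  qed
  then have "(\<Sum>x\<in>J. (cmod (point_vector (act s x) - point_vector x))\<^sup>2) \<le>
      (\<Sum>x\<in>J. of_bool (act s x = p i) + of_bool (x = p i))"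
    by (rule sum_mono)
  also have "\<dots> = (\<Sum>x\<in>J. of_bool (act s x = p i)) + (\<Sum>x\<in>J. of_bool (x = p i))"
    by (rule sum.distrib)
  \<comment> \<open>\<open>s\<close> permutes \<open>J\<close>, so exactly one point is sent to
    \<open>p i\<close>. Together with \<open>p i\<close> itself, at most two coordinates change,
    each by at most 1; hence \<open>sqrt 2\<close>.\<close>
  also have "(\<Sum>x\<in>J. of_bool (act s x = p i)) = (\<Sum>x\<in>J. of_bool (x = p i) :: real)"
    by (rule sum.reindex_bij_betw[OF act_bij[OF s]])
  also have "(\<Sum>x\<in>J. of_bool (x = p i) :: real) = 1"
    using finite_points point(1)[OF i] by (simp add: of_bool_def sum.delta)
  finally show ?thesis by simp
qed

text \<open>The bound is the displacement \<open>sqrt 2\<close> divided by the lower bound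
  \<open>sqrt (K / 4)\<close> for the norm of the vector before it is normalised.\<close>

lemma tau_le:
  assumes S: "finite S" "S \<noteq> {}" "S \<subseteq> carrier G" and K: "K > 0"
    and fixd: "\<And>s. s \<in> S \<Longrightarrow> \<exists>i<K. \<forall>j<K. j \<noteq> i \<longrightarrow> act s (p j) = p j"
  shows "tau TYPE('i \<Rightarrow> complex) G S \<le> ereal (sqrt (8 / K))"
proof -
  define a where "a = hnorm \<H> point_vector"
  define \<xi> where "\<xi> = (\<lambda>x. complex_of_real (1 / a) * point_vector x)"
  have a: "sqrt (K / 4) \<le> a" unfolding a_def by (rule hnorm_point_vector)
  have "0 < sqrt (K / 4)" using K by simp
  then have a0: "0 < a" using a by linarith
  have \<xi>: "\<xi> \<in> carrier \<H>"
    unfolding \<xi>_def by (rule block_space_scale_closed[OF point_vector_closed])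
  have \<xi>1: "hnorm \<H> \<xi> = 1"
    unfolding \<xi>_def hnorm_block_space_scale using a0 by (simp add: a_def[symmetric] norm_divide)
  have moved: "hnorm \<H> (perm_rep s \<xi> \<ominus>\<^bsub>\<H>\<^esub> \<xi>) \<le> sqrt (8 / K)" if s: "s \<in> S" for s
  proof -
    have sc: "s \<in> carrier G" using s S(3) by auto
    obtain i where i: "i < K" "\<forall>j<K. j \<noteq> i \<longrightarrow> act s (p j) = p j" using fixd[OF s] by auto
    let ?D = "\<lambda>x. if x \<in> J then point_vector (act s x) - point_vector x else 0"
    have "perm_rep s \<xi> \<ominus>\<^bsub>\<H>\<^esub> \<xi> = (\<lambda>x. perm_rep s \<xi> x - \<xi> x)"
      by (rule block_space_minus[OF perm_rep_closed[OF sc \<xi>] \<xi>])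
    also have "\<dots> = (\<lambda>x. complex_of_real (1 / a) * ?D x)"
    proof
      fix x
      have "perm_rep s \<xi> x = (if x \<in> J then \<xi> (act s x) else 0)" using \<xi> by (simp add: perm_rep_def)
      moreover have "point_vector x = 0" if "x \<notin> J" using that by (simp add: point_vector_def)
      ultimately show "perm_rep s \<xi> x - \<xi> x = complex_of_real (1 / a) * ?D x"
        by (cases "x \<in> J") (simp_all add: \<xi>_def diff_divide_distrib)
    qed
    finally have "hnorm \<H> (perm_rep s \<xi> \<ominus>\<^bsub>\<H>\<^esub> \<xi>) = (1 / a) * hnorm \<H> ?D"
      using a0 by (simp only: hnorm_block_space_scale norm_of_real) simp
    also have "hnorm \<H> ?D = sqrt (\<Sum>x\<in>J. (cmod (point_vector (act s x) - point_vector x))\<^sup>2)"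
      by (simp add: hnorm_block_space)
    also have "(1 / a) * \<dots> \<le> (1 / a) * sqrt 2"
      by (rule mult_left_mono[OF hnorm_point_vector_displacement[OF sc _ i(1)]]) (use i(2) a0 in auto)
    also have "\<dots> \<le> (1 / sqrt (K / 4)) * sqrt 2"
      by (intro mult_right_mono divide_left_mono a) (use K a0 in auto)
    also have "\<dots> = sqrt (8 / K)"
      by (simp add: real_sqrt_divide[symmetric] real_sqrt_mult[symmetric])
    finally show ?thesis .
  qed
  show ?thesis
    unfolding tau_def
  proof (rule INF_lower2[OF perm_rep_in_reps], simp only: prod.case, rule INF_lower2)
    show "\<xi> \<in> {\<xi> \<in> carrier \<H>. hnorm \<H> \<xi> = 1}" using \<xi> \<xi>1 by simp
    show "Max ((\<lambda>s. ereal (hnorm \<H> (perm_rep s \<xi> \<ominus>\<^bsub>\<H>\<^esub> \<xi>))) ` S) \<le> ereal (sqrt (8 / K))"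
      using S moved by (intro Max.boundedI) auto
  qed
qed

end

section \<open>Coset spaces as blocks\<close>

lemma (in group) rcosets_translate:
  assumes "subgroup H G" "C \<in> rcosets H" "g \<in> carrier G"
  shows "C #> g \<in> rcosets H"
proof -
  obtain a where "a \<in> carrier G" "C = H #> a" using assms(2) by (auto simp: RCOSETS_def)
  then show ?thesis
    using assms subgroup.subset[OF assms(1)] by (simp add: coset_mult_assoc rcosetsI)
qed

lemma (in group) rcosets_transitive:
  assumes H: "subgroup H G" "C \<in> rcosets H" "C' \<in> rcosets H"
  shows "\<exists>g\<in>carrier G. C #> g = C'"
proof -
  obtain a a' where a: "a \<in> carrier G" "C = H #> a" "a' \<in> carrier G" "C' = H #> a'"
    using assms by (auto simp: RCOSETS_def)
  show ?thesis
  proof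
    show "C #> (inv a \<otimes> a') = C'"
      using a subgroup.subset[OF H(1)] by (simp add: coset_mult_assoc m_assoc[symmetric])
  qed (use a in simp)
qed

text \<open>The Hilbert space must consist of functions on the given type \<open>'i\<close>, so the
  cosets are transported there by a bijection \<open>\<iota>\<close>; an infinite type has room for
  any finite set. The tag \<open>i\<close> keeps the blocks disjoint even if some of the
  \<open>L i\<close> coincide.\<close>

lemma (in group) tau_independent_subgroups_le:
  fixes L :: "nat \<Rightarrow> 'a set" and K :: nat
  assumes K: "K > 0"
    and L: "\<And>i. i < K \<Longrightarrow> subgroup (L i) G" "\<And>i. i < K \<Longrightarrow> finite_index G (L i)"
      "\<And>i. i < K \<Longrightarrow> L i \<noteq> carrier G"
    and S: "finite S" "S \<noteq> {}" "S \<subseteq> (\<Union>i<K. {g \<in> carrier G. \<forall>j<K. j \<noteq> i \<longrightarrow> g \<in> L j})"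
  shows "tau TYPE('i::infinite \<Rightarrow> complex) G S \<le> ereal (sqrt (8 / K))"
proof -
  let ?X = "SIGMA i:{..<K}. rcosets (L i)"
  have fX: "finite ?X" using L(2) by (intro finite_SigmaI) auto
  obtain J :: "'i set" where J: "finite J" "card J = card ?X"
    using infinite_arbitrarily_large[OF infinite_UNIV] by metis
  obtain \<iota> where \<iota>: "bij_betw \<iota> ?X J" using finite_same_card_bij[OF fX J(1)] J(2) by auto
  define \<kappa> where "\<kappa> = inv_into ?X \<iota>"
  have k1: "\<kappa> (\<iota> z) = z" "\<iota> z \<in> J" if "z \<in> ?X" for z
    unfolding \<kappa>_def using bij_betw_inv_into_left[OF \<iota> that] bij_betwE[OF \<iota>] that by blast+
  have k2: "\<kappa> x \<in> ?X" "\<iota> (\<kappa> x) = x" if "x \<in> J" for x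
    unfolding \<kappa>_def using bij_betw_inv_into_right[OF \<iota> that] bij_betwE[OF bij_betw_inv_into[OF \<iota>]] that by blast+
  have Jcases: "\<exists>i C. i < K \<and> C \<in> rcosets (L i) \<and> x = \<iota> (i, C)" if "x \<in> J" for x
    using k2[OF that] by (cases "\<kappa> x") auto
  define act where "act g x = \<iota> (fst (\<kappa> x), snd (\<kappa> x) #> g)" for g x
  define b where "b x = fst (\<kappa> x)" for x
  define p where "p i = \<iota> (i, L i)" for i
  have act_iota: "act g (\<iota> (i, C)) = \<iota> (i, C #> g)" if "i < K" "C \<in> rcosets (L i)" for g i C
    using that by (simp add: act_def k1)
  have b_iota: "b (\<iota> (i, C)) = i" if "i < K" "C \<in> rcosets (L i)" for i C
    using that by (simp add: b_def k1)
  have inJ: "\<iota> (i, C) \<in> J" if "i < K" "C \<in> rcosets (L i)" for i C using that by (intro k1) auto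
  have sub: "C \<subseteq> carrier G" if "i < K" "C \<in> rcosets (L i)" for i C
    using rcosets_part_G[OF L(1)[OF that(1)]] that(2) by blast
  have base: "L i \<in> rcosets (L i)" if "i < K" for i
    using subgroup.subgroup_in_rcosets[OF L(1)[OF that]] is_group by blast
  interpret pointed_block_action G J b act K p
  proof unfold_locales
    show "finite J" by (rule J)
    fix x assume x: "x \<in> J"
    then obtain i C where iC: "i < K" "C \<in> rcosets (L i)" "x = \<iota> (i, C)" using Jcases by blast
    show "b x < K" using iC by (simp add: b_iota)
    show "act \<one> x = x" using iC sub by (simp add: act_iota coset_mult_one)
    show "act g x \<in> J" "b (act g x) = b x" if "g \<in> carrier G" for g
      using iC that rcosets_translate[OF L(1) iC(2)] by (simp_all add: act_iota b_iota inJ)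
    show "act (g \<otimes> h) x = act h (act g x)" if "g \<in> carrier G" "h \<in> carrier G" for g h
      using iC that rcosets_translate[OF L(1) iC(2)] sub by (simp add: act_iota coset_mult_assoc)
    fix y assume "y \<in> J" "b x = b y"
    then obtain C' where "C' \<in> rcosets (L i)" "y = \<iota> (i, C')" using Jcases iC b_iota by metis
    moreover obtain g where "g \<in> carrier G" "C #> g = C'"
      using rcosets_transitive[OF L(1)] calculation(1) iC by blast
    ultimately show "\<exists>g\<in>carrier G. act g x = y" using iC by (auto simp: act_iota intro!: bexI[of _ g])
  next
    fix i assume i: "i < K"
    show "p i \<in> J" "b (p i) = i" using i base by (simp_all add: p_def inJ b_iota)
    obtain a where a: "a \<in> carrier G" "a \<notin> L i" using L(1,3)[OF i] subgroup.subset by blast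
    have C: "L i #> a \<in> rcosets (L i)" using a L(1)[OF i] subgroup.subset by (intro rcosetsI) auto
    have "L i #> a \<noteq> L i"
    proof
      assume "L i #> a = L i"
      from coset_join1[OF this a(1) L(1)[OF i]] show False using a(2) by simp
    qed
    moreover have "\<kappa> (\<iota> (i, L i)) = (i, L i)" "\<kappa> (\<iota> (i, L i #> a)) = (i, L i #> a)"
      using i C base[OF i] by (simp_all add: k1)
    ultimately have "\<iota> (i, L i) \<noteq> \<iota> (i, L i #> a)" by (metis prod.inject)
    then have "card {\<iota> (i, L i), \<iota> (i, L i #> a)} = 2" by simp
    moreover have "card {\<iota> (i, L i), \<iota> (i, L i #> a)} \<le> card {x \<in> J. b x = i}"
      using i C base J(1) by (intro card_mono) (auto simp: inJ b_iota)
    ultimately show "2 \<le> card {x \<in> J. b x = i}" by simp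
  qed
  show ?thesis
  proof (rule tau_le[OF S(1,2) _ K])
    show "S \<subseteq> carrier G" using S(3) by auto
    fix s assume "s \<in> S"
    then obtain i where i: "i < K" "s \<in> carrier G" "\<And>j. j < K \<Longrightarrow> j \<noteq> i \<Longrightarrow> s \<in> L j" using S(3) by blast
    have "act s (p j) = p j" if "j < K" "j \<noteq> i" for j
      using coset_join2[OF i(2) L(1)[OF that(1)] i(3)[OF that]] that base by (simp add: p_def act_iota)
    then show "\<exists>i<K. \<forall>j<K. j \<noteq> i \<longrightarrow> act s (p j) = p j" using i(1) by blast
  qed
qed

theorem (in group) has_supplements_tau_u:
  assumes "has_supplements G" "infinite (carrier G)"
    and "finite S" "S \<subseteq> carrier G" "generate G S = carrier G"
  shows "tau_u TYPE('i::infinite \<Rightarrow> complex) G = 0"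
proof (rule antisym)
  show "0 \<le> tau_u TYPE('i \<Rightarrow> complex) G" by (rule tau_u_nonneg[OF assms(2)])
  have bound: "tau_u TYPE('i \<Rightarrow> complex) G \<le> ereal (sqrt (8 / Suc k))" for k
  proof -
    obtain L where L: "\<forall>i<Suc k. subgroup (L i) G \<and> finite_index G (L i) \<and> L i \<noteq> carrier G"
      "generate G (\<Union>i<Suc k. {g \<in> carrier G. \<forall>j<Suc k. j \<noteq> i \<longrightarrow> g \<in> L j}) = carrier G"
      using independent_subgroups[OF assms(1), of k] by blast
    obtain F where F: "finite F" "F \<subseteq> (\<Union>i<Suc k. {g \<in> carrier G. \<forall>j<Suc k. j \<noteq> i \<longrightarrow> g \<in> L j})"
      "generate G F = carrier G"
      by (rule finite_generating_subset[OF assms(3,5) _ L(2)]) blast+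
    have Fc: "F \<subseteq> carrier G" using F(2) by blast
    have "F \<noteq> {}"
    proof
      assume "F = {}"
      then have "finite (generate G F)" by (simp add: generate_empty)
      then show False using F(3) assms(2) by simp
    qed
    then have "tau TYPE('i \<Rightarrow> complex) G F \<le> ereal (sqrt (8 / Suc k))"
      by (intro tau_independent_subgroups_le[where L = L]) (use L(1) F in simp_all)
    then show ?thesis
      unfolding tau_u_def using F Fc by (intro INF_lower2[of F]) (auto simp: finite_generating_sets_def)
  qed
  have "(\<lambda>k. ereal (sqrt (8 / Suc k))) \<longlonglongrightarrow> ereal (sqrt 0)"
    unfolding lim_ereal
    by (intro tendsto_real_sqrt) (use LIMSEQ_Suc[OF lim_const_over_n[of 8]] in simp)
  then have "tau_u TYPE('i \<Rightarrow> complex) G \<le> ereal (sqrt 0)"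
    by (rule LIMSEQ_le_const) (use bound in blast)
  then show "tau_u TYPE('i \<Rightarrow> complex) G \<le> 0" by (simp add: zero_ereal_def)
qed

subsection \<open>Finitely generated matrix groups\<close>

lemma submod_lattice_over:
  assumes "ideal_in A I"
  shows "submod A (lattice_over I n)"
  using assms by (auto simp: submod_def lattice_over_def ideal_in_def scl_def)

lemma ideal_in_sum: "ideal_in A I \<Longrightarrow> (\<And>x. x \<in> S \<Longrightarrow> f x \<in> I) \<Longrightarrow> sum f S \<in> I"
  by (induction S rule: infinite_finite_induct) (auto simp: ideal_in_def)

lemma subring_ideal_in: "subring_set R \<Longrightarrow> ideal_in R R"
  using subring_setD[of R] by (simp add: ideal_in_def)

lemma (in group) normal_finite_index_power:
  assumes K: "K \<lhd> G" "finite_index G K" and h: "h \<in> carrier G"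
  shows "\<exists>e>0. h [^] (e::nat) \<in> K"
proof -
  interpret K: normal K G by (rule K)
  interpret Q: group "G Mod K" by (rule K.factorgroup_is_group)
  have fin: "finite (carrier (G Mod K))" using K(2) by (simp add: carrier_FactGroup rcosets_image)
  have hom: "(\<lambda>g. K #> g) \<in> hom G (G Mod K)" by (rule K.r_coset_hom_Mod)
  interpret q: group_hom G "G Mod K" "\<lambda>g. K #> g"
    by (intro group_hom.intro group_hom_axioms.intro group_axioms Q.group_axioms hom)
  have "K #> (h [^] Coset.order (G Mod K)) = (K #> h) [^]\<^bsub>G Mod K\<^esub> Coset.order (G Mod K)"
    by (rule q.hom_nat_pow[OF h])
  also have "\<dots> = K" using Q.pow_order_eq_1[OF q.hom_closed[OF h]] by simp
  finally have "h [^] Coset.order (G Mod K) \<in> K"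
    by (rule coset_join1) (use h K.subgroup_axioms in auto)
  moreover have "Coset.order (G Mod K) > 0" using fin Q.order_gt_0_iff_finite by simp
  ultimately show ?thesis by blast
qed

text \<open>A faithful matrix representation given by its entries. They lie in an algebraically
  closed field because both the extension of places to transcendental elements and the eigenvectors
  need roots of polynomials.\<close>

locale matrix_group = group G for G :: "('g, 'm) monoid_scheme" (structure) +
  fixes n :: nat and \<rho> :: "'g \<Rightarrow> nat \<Rightarrow> nat \<Rightarrow> 'a::alg_closed_field"
  assumes entry_mult: "g \<in> carrier G \<Longrightarrow> h \<in> carrier G \<Longrightarrow> i < n \<Longrightarrow> j < n \<Longrightarrow>
      \<rho> (g \<otimes> h) i j = (\<Sum>l<n. \<rho> g i l * \<rho> h l j)"
    and entry_one: "i < n \<Longrightarrow> j < n \<Longrightarrow> \<rho> \<one> i j = of_bool (i = j)"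
    and faithful: "g \<in> carrier G \<Longrightarrow> (\<And>i j. i < n \<Longrightarrow> j < n \<Longrightarrow> \<rho> g i j = of_bool (i = j)) \<Longrightarrow> g = \<one>"
begin

definition mat_act :: "'g \<Rightarrow> (nat \<Rightarrow> 'a) \<Rightarrow> nat \<Rightarrow> 'a" where
  "mat_act g v = (\<lambda>i. if i < n then \<Sum>j<n. \<rho> g i j * v j else 0)"

lemma lattice_action_mat_act:
  assumes "place A M"
  shows "lattice_action G A M n mat_act"
proof (intro lattice_action.intro lattice_action_axioms.intro group_axioms assms)
  fix g h :: 'g and v w :: "nat \<Rightarrow> 'a" and a :: 'a
  show "mat_act g (v + w) = mat_act g v + mat_act g w"
    by (rule ext) (simp add: mat_act_def distrib_left sum.distrib)
  show "mat_act g (scl a v) = scl a (mat_act g v)"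
    by (rule ext) (simp add: mat_act_def scl_def sum_distrib_left ac_simps)
  show "mat_act \<one> v = v" if "v \<in> lattice_over A n"
  proof
    fix i show "mat_act \<one> v i = v i"
    proof (cases "i < n")
      case True
      then have "mat_act \<one> v i = (\<Sum>j<n. if i = j then v j else 0)"
        unfolding mat_act_def by (auto simp: entry_one intro!: sum.cong)
      then show ?thesis using True by (simp add: sum.delta)
    next
      case False
      then show ?thesis using that by (simp add: mat_act_def lattice_over_def)
    qed
  qed
  show "mat_act (g \<otimes> h) v = mat_act g (mat_act h v)" if "g \<in> carrier G" "h \<in> carrier G"
  proof
    fix i show "mat_act (g \<otimes> h) v i = mat_act g (mat_act h v) i"
    proof (cases "i < n")
      case True
      have "mat_act (g \<otimes> h) v i = (\<Sum>j<n. \<Sum>l<n. \<rho> g i l * \<rho> h l j * v j)"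
        using True that by (simp add: mat_act_def entry_mult sum_distrib_right)
      also have "\<dots> = (\<Sum>l<n. \<Sum>j<n. \<rho> g i l * \<rho> h l j * v j)" by (rule sum.swap)
      also have "\<dots> = mat_act g (mat_act h v) i"
        using True by (simp add: mat_act_def sum_distrib_left mult.assoc)
      finally show ?thesis .
    qed (simp add: mat_act_def)
  qed
qed

lemma entries_in_subring:
  assumes R: "subring_set R" and S: "generate G S = carrier G" "S \<subseteq> carrier G"
    and E: "\<And>s i j. s \<in> S \<Longrightarrow> i < n \<Longrightarrow> j < n \<Longrightarrow> \<rho> s i j \<in> R \<and> \<rho> (inv s) i j \<in> R"
    and g: "g \<in> carrier G" and ij: "i < n" "j < n"
  shows "\<rho> g i j \<in> R"
proof -
  have "g \<in> generate G S" using g S by simp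
  then have "\<forall>i<n. \<forall>j<n. \<rho> g i j \<in> R"
  proof induction
    case one
    then show ?case using subring_setD(1,2)[OF R] by (simp add: entry_one of_bool_def)
  next
    case (eng g h)
    then have "g \<in> carrier G" "h \<in> carrier G" using generate_in_carrier[OF S(2)] by auto
    then show ?case
      using eng.IH by (auto simp: entry_mult intro!: ideal_in_sum[OF subring_ideal_in[OF R]] subring_setD(4)[OF R])
  qed (use E in auto)
  then show ?thesis using ij by blast
qed

text \<open>For a nontrivial \<open>g\<close>, take a place at which some entry of
  \<open>g - 1\<close> is not in \<open>M\<close>. The group acts on \<open>A^n / M^n\<close> with a
  kernel \<open>K\<close> of finite index, as the entries have finitely many residues, and
  \<open>N\<close> acts through a nilpotent group. So the \<open>2 * n\<close>-th derived subgroup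
  acts trivially, which \<open>g\<close> does not.\<close>

lemma derived_trivial_if_nilpotent:
  assumes S: "finite S" "S \<subseteq> carrier G" "generate G S = carrier G"
    and N: "N \<lhd> G" and nilp: "\<And>K. K \<lhd> G \<Longrightarrow> finite_index G K \<Longrightarrow> \<exists>c. iter_comm G N N c \<subseteq> K"
  shows "(derived G ^^ (2 * n)) N \<subseteq> {\<one>}"
proof (rule subsetI, rule ccontr)
  fix g assume gd: "g \<in> (derived G ^^ (2 * n)) N" and g1: "g \<notin> {\<one>}"
  have Ns: "subgroup N G" using N by (rule normal_imp_subgroup)
  have gN: "g \<in> N" using derived_pow_subset[OF Ns] gd by (rule subsetD)
  have gc: "g \<in> carrier G" using gN subgroup.subset[OF Ns] by blast
  \<comment> \<open>Inverses of the generators are included because their entries involve the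
    inverse of a determinant, which the entries of the generators need not generate.\<close>
  define E where "E = (\<lambda>(s, i, j). \<rho> s i j) ` ((S \<union> m_inv G ` S) \<times> {..<n} \<times> {..<n})"
  have "finite E" using S(1) by (simp add: E_def)
  then obtain R where R: "subring_set R" "E \<subseteq> R" "place_separated R" by (rule finite_set_in_place_separated)
  have ER: "\<rho> s i j \<in> R" if "s \<in> S \<union> m_inv G ` S" "i < n" "j < n" for s i j
  proof -
    have "(s, i, j) \<in> (S \<union> m_inv G ` S) \<times> {..<n} \<times> {..<n}" using that by simp
    then have "\<rho> s i j \<in> E" unfolding E_def by (intro image_eqI[of _ _ "(s, i, j)"]) simp_all
    then show ?thesis using R(2) by blast
  qed
  have entR: "\<rho> h i j \<in> R" if "h \<in> carrier G" "i < n" "j < n" for h i j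
    by (rule entries_in_subring[OF R(1) S(3,2) _ that]) (use ER in blast)
  obtain i0 j0 where ij: "i0 < n" "j0 < n" "\<rho> g i0 j0 \<noteq> of_bool (i0 = j0)" using faithful[OF gc] g1 by blast
  have "of_bool (i0 = j0) \<in> R" using subring_setD(1,2)[OF R(1)] by (simp add: of_bool_def)
  then have "\<rho> g i0 j0 - of_bool (i0 = j0) \<in> R" by (intro subring_setD(3)[OF R(1)] entR gc ij)
  moreover have "\<rho> g i0 j0 - of_bool (i0 = j0) \<noteq> 0" using ij by simp
  ultimately obtain A M where pl: "place A M" and RA: "R \<subseteq> A" and b: "\<rho> g i0 j0 - of_bool (i0 = j0) \<notin> M"
    and res: "finite_residues R M"
    using R(3) unfolding place_separated_def by blast
  interpret lattice_action G A M n mat_act by (rule lattice_action_mat_act[OF pl])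
  have ring: "subring_set A" and idl: "ideal_in A M" using pl by (auto simp: place_def)
  have MA: "M \<subseteq> A" using idl by (simp add: ideal_in_def)
  define U where "U = lattice_over M n"
  define V where "V = lattice_over A n"
  have U: "submod A U" unfolding U_def by (rule submod_lattice_over[OF idl])
  have V: "submod A V" unfolding V_def by (rule submod_lattice_over[OF subring_ideal_in[OF ring]])
  have VA: "V \<subseteq> lattice_over A n" by (simp add: V_def)
  have UV: "U \<subseteq> V" using MA by (auto simp: U_def V_def lattice_over_def)
  have entA: "\<rho> h i j \<in> A" if "h \<in> carrier G" "i < n" "j < n" for h i j using entR[OF that] RA by blast
  have pres: "mat_act h v \<in> lattice_over I n"
    if "ideal_in A I" "h \<in> carrier G" "v \<in> lattice_over I n" for I h v
    using that entA by (auto simp: lattice_over_def mat_act_def ideal_in_def intro!: ideal_in_sum[OF that(1)])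
  have presU: "mat_act h v \<in> U" if "h \<in> carrier G" "v \<in> U" for h v
    using that unfolding U_def by (rule pres[OF idl])
  have presV: "mat_act h v \<in> V" if "h \<in> carrier G" "v \<in> V" for h v
    using that unfolding V_def by (rule pres[OF subring_ideal_in[OF ring]])
  define K where "K = {h \<in> carrier G. trivial_on V U h}"
  note facts = U V VA UV subgroup_self presU presV
  have Ks: "subgroup K G" unfolding K_def by (rule trivial_subgroup) (fact facts)+
  have Kn: "K \<lhd> G"
  proof (rule normal_invI[OF Ks])
    fix x h assume x: "x \<in> carrier G" and h: "h \<in> K"
    have "trivial_on V U (x \<otimes> h \<otimes> inv x)"
      by (rule trivial_conj[where H = "carrier G" and U = U and V = V])
        (use x h in \<open>simp_all add: K_def U V VA UV subgroup_self presU presV\<close>)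
    then show "x \<otimes> h \<otimes> inv x \<in> K" using x h by (simp add: K_def)
  qed
  obtain T where T: "finite T" "\<forall>r\<in>R. \<exists>t\<in>T. r - t \<in> M"
    using res unfolding finite_residues_def by (elim exE conjE)
  then have "\<forall>r\<in>R. \<exists>t. t \<in> T \<and> r - t \<in> M" by (simp only: Bex_def)
  from bchoice[OF this] obtain t where "\<forall>r\<in>R. t r \<in> T \<and> r - t r \<in> M" ..
  then have t: "t r \<in> T" "r - t r \<in> M" if "r \<in> R" for r using that by simp_all
  \<comment> \<open>The matrix of residues of \<open>h\<close>, through chosen representatives. It
    has finitely many values, and two elements with the same value differ by an element of
    \<open>K\<close>.\<close>
  define f where "f h = (\<lambda>(i, j)\<in>{..<n} \<times> {..<n}. t (\<rho> h i j))" for h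
  have Kfin: "finite_index G K"
  proof (rule finite_indexI[OF Ks])
    have "f h \<in> {..<n} \<times> {..<n} \<rightarrow>\<^sub>E T" if "h \<in> carrier G" for h
      unfolding f_def restrict_PiE_iff using t(1)[OF entR[OF that]] by auto
    then have "f ` carrier G \<subseteq> {..<n} \<times> {..<n} \<rightarrow>\<^sub>E T" by (rule image_subsetI)
    then show "finite (f ` carrier G)" by (rule finite_subset) (intro finite_PiE finite_SigmaI finite_lessThan T(1))
    fix x h assume x: "x \<in> carrier G" and h: "h \<in> carrier G" and eq: "f x = f h"
    have diff: "\<rho> x i j - \<rho> h i j \<in> M" if ij: "i < n" "j < n" for i j
    proof -
      have "t (\<rho> x i j) = t (\<rho> h i j)" using fun_cong[OF eq, of "(i, j)"] ij by (simp add: f_def)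
      then have split: "\<rho> x i j - \<rho> h i j = (\<rho> x i j - t (\<rho> x i j)) - (\<rho> h i j - t (\<rho> h i j))" by simp
      show ?thesis
        unfolding split by (rule place_diff(1)[OF pl t(2)[OF entR[OF x ij]] t(2)[OF entR[OF h ij]]])
    qed
    have "mat_act (x \<otimes> inv h) v - v \<in> U" if v: "v \<in> V" for v
    proof -
      define w where "w = mat_act (inv h) v"
      have w: "w \<in> V" unfolding w_def by (rule presV) (use h v in auto)
      have "v \<in> lattice_over A n" using v by (simp add: V_def)
      then have hv: "mat_act h w = v" and xv: "mat_act (x \<otimes> inv h) v = mat_act x w"
        unfolding w_def using act_mult[of h "inv h" v] act_mult[of x "inv h" v] act_one[of v] x h by simp_all
      have "(mat_act x w - mat_act h w) i \<in> M" if "i < n" for i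
      proof -
        have "(mat_act x w - mat_act h w) i = (\<Sum>j<n. w j * (\<rho> x i j - \<rho> h i j))"
          using that by (simp add: mat_act_def sum_subtractf right_diff_distrib mult.commute)
        also have "\<dots> \<in> M"
          using w diff[OF that] idl by (intro ideal_in_sum[OF idl]) (simp add: V_def lattice_over_def ideal_in_def)
        finally show ?thesis .
      qed
      then have "mat_act x w - mat_act h w \<in> U"
        unfolding U_def lattice_over_def by (simp add: mat_act_def)
      then show ?thesis by (simp only: xv hv)
    qed
    then show "x \<otimes> inv h \<in> K" using x h by (simp add: K_def trivial_on_def)
  qed
  obtain c where c: "iter_comm G N N c \<subseteq> K" using nilp[OF Kn Kfin] by blast
  have NG: "h \<in> carrier G" if "h \<in> N" for h using that subgroup.subset[OF Ns] by blast
  have "trivial_on V U g"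
  \<comment> \<open>There are at most \<open>n\<close> pivots at every place, so
    \<open>l = n\<close> works independently of the place and of \<open>c\<close>.\<close>
  proof (rule nilpotent_derived_trivial[where H = N and c = c and l = n])
    show "mat_act h v \<in> lattice_over A n" if "h \<in> carrier G" "v \<in> lattice_over A n" for h v
      using presV[of h v] that by (simp add: V_def)
    show "submod A U" "submod A V" "U \<subseteq> V" "V \<subseteq> lattice_over A n" "subgroup N G"
      by (fact U V UV VA Ns)+
    show "lattice_over M n \<subseteq> U" by (simp add: U_def)
    show "mat_act h u \<in> U" if "h \<in> N" "u \<in> U" for h u by (rule presU[OF NG[OF that(1)] that(2)])
    show "mat_act h u \<in> V" if "h \<in> N" "u \<in> V" for h u by (rule presV[OF NG[OF that(1)] that(2)])
    show "\<exists>e>0. trivial_on V U (h [^] (e::nat))" if "h \<in> N" for h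
      using normal_finite_index_power[OF Kn Kfin NG[OF that]] by (auto simp: K_def)
    show "trivial_on V U x" if "x \<in> iter_comm G N N c" for x using c that by (auto simp: K_def)
    show "card (pivots M n V) \<le> card (pivots M n U) + n" using pivots_le[of M n V] by simp
    show "g \<in> (derived G ^^ (2 * n)) N" by (rule gd)
  qed
  \<comment> \<open>The basis vector whose image under \<open>g - 1\<close> has the chosen entry, in
    row \<open>i0\<close> and column \<open>j0\<close>, as its coordinate at
    \<open>i0\<close>.\<close>
  define e where "e i = (of_bool (i = j0) :: 'a)" for i
  have "e \<in> V"
    using ij(2) subring_setD(1,2)[OF ring] by (auto simp: e_def V_def lattice_over_def)
  then have "mat_act g e - e \<in> U" using \<open>trivial_on V U g\<close> by (simp only: trivial_on_def)
  then have "(mat_act g e - e) i0 \<in> M" using ij(1) unfolding U_def lattice_over_def by blast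
  moreover have "mat_act g e i0 = (\<Sum>j<n. if j = j0 then \<rho> g i0 j else 0)"
    using ij(1) by (auto simp: mat_act_def e_def intro!: sum.cong)
  ultimately show False using b ij(2) by (simp add: sum.delta e_def)
qed

theorem has_supplements:
  assumes "infinite (carrier G)" "finite S" "S \<subseteq> carrier G" "generate G S = carrier G"
  shows "has_supplements G"
  unfolding has_supplements_def
proof (intro allI impI, rule ccontr)
  fix N assume N: "N \<lhd> G" "finite_index G N"
    and no: "\<nexists>L. subgroup L G \<and> finite_index G L \<and> L \<noteq> carrier G \<and> L <#> N = carrier G"
  have "(derived G ^^ (2 * n)) N \<subseteq> {\<one>}"
  proof (rule derived_trivial_if_nilpotent[OF assms(2-4) N(1)])
    show "\<exists>c. iter_comm G N N c \<subseteq> K" if "K \<lhd> G" "finite_index G K" for K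
      by (rule frattini_nilpotent[OF N(1) _ that]) (use no in blast)
  qed
  then obtain L where "subgroup L G" "finite_index G L" "L \<noteq> carrier G" "L <#> N = carrier G"
    by (rule solvable_supplement[OF assms N])
  then show False using no by blast
qed

end

theorem mainTheorem2:
  fixes \<Gamma> :: "'a::field mat set" and n :: nat
  assumes "n \<ge> 1"
    and "subgroup \<Gamma> (GL n)"
    and "\<exists>S. finite S \<and> S \<subseteq> \<Gamma> \<and> generate (GL n) S = \<Gamma>"
    and "infinite \<Gamma>"
  shows "tau_u TYPE('i::infinite \<Rightarrow> complex) (GL n\<lparr>carrier := \<Gamma>\<rparr>) = 0"
proof -
  let ?G = "GL n\<lparr>carrier := \<Gamma>\<rparr> :: 'a mat monoid"
  interpret GL: group "GL n :: 'a mat monoid" by (rule group_GL)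
  interpret G: group ?G by (rule GL.subgroup_imp_group[OF assms(2)])
  obtain S where S: "finite S" "S \<subseteq> \<Gamma>" "generate (GL n) S = \<Gamma>" using assms(3) by blast
  have gen: "generate ?G S = carrier ?G"
    using GL.generate_consistent[OF S(2) assms(2)] S(3) by simp
  have carr: "g \<in> carrier_mat n n" if "g \<in> \<Gamma>" for g
    using that subgroup.subset[OF assms(2)] by (auto simp: carrier_GL)
  have mult: "g \<otimes>\<^bsub>?G\<^esub> h = g * h" and one: "\<one>\<^bsub>?G\<^esub> = 1\<^sub>m n" for g h
    by (simp_all add: GL_def units_of_def ring_mat_simps)
  \<comment> \<open>The entries are moved into an algebraic closure by the injective map
    \<open>to_ac\<close>; the abstract group stays the same, and only its representation
    changes.\<close>
  interpret matrix_group ?G n "\<lambda>g i j. to_ac (g $$ (i, j))"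
  proof unfold_locales
    fix g h i j assume "g \<in> carrier ?G" "h \<in> carrier ?G" and ij: "i < n" "j < n"
    then have "g \<in> carrier_mat n n" "h \<in> carrier_mat n n" using carr by simp_all
    then show "to_ac ((g \<otimes>\<^bsub>?G\<^esub> h) $$ (i, j)) = (\<Sum>l<n. to_ac (g $$ (i, l)) * to_ac (h $$ (l, j)))"
      unfolding mult using ij
      by (simp add: scalar_prod_def to_ac_sum to_ac_mult atLeast0LessThan)
  next
    fix i j assume "i < n" "j < n"
    then show "to_ac (\<one>\<^bsub>?G\<^esub> $$ (i, j)) = of_bool (i = j)" by (simp add: one)
  next
    fix g assume g: "g \<in> carrier ?G" and e: "\<And>i j. i < n \<Longrightarrow> j < n \<Longrightarrow> to_ac (g $$ (i, j)) = of_bool (i = j)"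
    have "g $$ (i, j) = of_bool (i = j)" if "i < n" "j < n" for i j
      using e[OF that] by (auto simp: of_bool_def split: if_splits)
    then show "g = \<one>\<^bsub>?G\<^esub>"
      unfolding one using carr g by (intro eq_matI) (auto simp: carrier_matD)
  qed
  show ?thesis
    by (rule G.has_supplements_tau_u[OF has_supplements, OF _ S(1) _ gen _ S(1) _ gen])
      (use assms(4) S(2) in simp_all)
qed

end
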